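(* Let $\overline{L}\subset T^*(\mathbb R_+\times H^n)$ be a spinnable Lagrangian cobordism with a tame, spinnable generating family $F$ of the form $(\Lambda_-, f_-) \prec_{(\overline{L}, F)} (\Lambda_+, f_+)$. Then the spun Lagrangian cobordism $\Lambda_-^s \prec_{\overline{L}^s} \Lambda_+^s$ in $T^*(\mathbb R_+\times\mathbb R^{n+1})$ has a compatible, tame generating family.
   Context: $\mathbb R_+=(0,\infty)$, $H^n=\{x\in\mathbb R^n: x_n\ge 0\}$. For $M=\mathbb R^m$ or $M=H^n$: $J^1M$ has coordinates $(x,y,z)$ and contact form $\alpha=dz-y\,dx$; its symplectization $(\mathbb R\times J^1M,d(e^s\alpha))$ is identified with $T^*(\mathbb R_+\times M)$ via $(s,x,y,z)\mapsto(t,x,T,X)=(e^s,x,z,e^sy)$. A smooth function $f:M\times\mathbb R^N\to\mathbb R$ with $\mathbf 0$ a regular value of $\partial_\eta f$ generates the Legendrian $\{(x,\partial_xf,f):\partial_\eta f=0\}$; a smooth $F:\mathbb R_+\times M\times\mathbb R^N\to\mathbb R$ with $\mathbf 0$ a regular value of $\partial_\eta F$ generates the Lagrangian $\{(t,x,\partial_tF,\partial_xF):\partial_\eta F=0\}$. A Lagrangian cobordism $\Lambda_-\prec_{\overline L}\Lambda_+$ is an embedded Lagrangian $\overline L\subset T^*(\mathbb R_+\times M)$ which, for some $0<t_-<t_+$, coincides (under the identification) with the cylinder over $\Lambda_-$ for $t\le t_-$ and with the cylinder over $\Lambda_+$ for $t\ge t_+$, with compact middle part $t_-\le t\le t_+$.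 The notation $(\Lambda_-,f_-)\prec_{(\overline L,F)}(\Lambda_+,f_+)$ means in addition that $F$ generates $\overline L$, $f_\pm$ generate $\Lambda_\pm$, and $F(t,x,\eta)=tf_-(x,\eta)$ for $t\le t_-$, $F(t,x,\eta)=tf_+(x,\eta)$ for $t\ge t_+$ ("compatible"). Such a triple is tame if each of $f_\pm$ equals a nonzero linear function of $\eta$ outside a compact subset of $M\times\mathbb R^N$, and for each $t$, $F(t,\cdot,\cdot)$ equals a linear function $A_t(\eta)$ outside a compact subset of $\{t\}\times M\times\mathbb R^N$. A spinnable Lagrangian cobordism is a properly embedded Lagrangian cobordism $\overline L\subset T^*(\mathbb R_+\times H^n)$ that extends smoothly by reflection across $\partial T^*(\mathbb R_+\times H^n)$, i.e. its union with its image under $(x_n,X_n)\mapsto(-x_n,-X_n)$ is a smooth submanifold of $T^*(\mathbb R_+\times\mathbb R^n)$; spinnable Legendrians in $J^1H^n$ are defined in the same way with $(x_n,y_n)\mapsto(-x_n,-y_n)$. A generating family $F$ on $\mathbb R_+\times H^n\times\mathbb R^N$ is spinnable if extending it by $F(t,x_1,\dots,x_n,\eta)=F(t,x_1,\dots,-x_n,\eta)$ for $x_n<0$ gives a smooth function on $\mathbb R_+\times\mathbb R^n\times\mathbb R^N$. Spinning: $\overline L^s\subset T^*(\mathbb R_+\times\mathbb R^{n+1})$ is the set of points $(t,x_1,\dots,x_{n-1},x_n\cos\theta,x_n\sin\theta,T,X_1,\dots,X_{n-1},X_n\cos\theta,X_n\sin\theta)$ with $(t,x,T,X)\in\overline L$,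 $\theta\in S^1$; likewise $\Lambda^s\subset J^1\mathbb R^{n+1}$ is the set of points $(x_1,\dots,x_{n-1},x_n\cos\theta,x_n\sin\theta,y_1,\dots,y_{n-1},y_n\cos\theta,y_n\sin\theta,z)$ with $(x,y,z)\in\Lambda$ (the Legendrian whose front is obtained by rotating the front of $\Lambda$). *)

theory Defs
  imports "HOL-Analysis.Analysis"
begin

section \<open>Smooth functions\<close>

text \<open>
  Smoothness means that all iterated partial derivatives exist and are continuous.
  A coordinate direction is given by its coordinate lines: \<open>c p h\<close> is the point \<open>p\<close> moved by \<open>h\<close>
  in that direction.  This covers Euclidean types as well as products with a fibre \<open>\<real>\<^sup>N\<close> whose
  dimension is a term.

  All derivatives are taken within the domain \<open>A\<close>.  On an open set they are the usual ones; on a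
  relatively open subset of a half-space (or the product of one with a vector space) they are
  one-sided at boundary points, and the notion is that of smoothness up to the boundary.
  Values outside \<open>A\<close> are irrelevant.
\<close>

definition pderiv_on ::
  "'p set \<Rightarrow> ('p \<Rightarrow> real \<Rightarrow> 'p) \<Rightarrow> ('p \<Rightarrow> 'b::real_normed_vector) \<Rightarrow> 'p \<Rightarrow> 'b" where
  "pderiv_on A c f p = vector_derivative (\<lambda>h. f (c p h)) (at 0 within {h. c p h \<in> A})"

fun pderivs_on ::
  "'p set \<Rightarrow> ('p \<Rightarrow> real \<Rightarrow> 'p) list \<Rightarrow> ('p \<Rightarrow> 'b::real_normed_vector) \<Rightarrow> 'p \<Rightarrow> 'b" where
  "pderivs_on A [] f = f"
| "pderivs_on A (c # cs) f = pderiv_on A c (pderivs_on A cs f)"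

definition smooth_on ::
  "('p \<Rightarrow> real \<Rightarrow> 'p) set \<Rightarrow> 'p::topological_space set \<Rightarrow> ('p \<Rightarrow> 'b::real_normed_vector) \<Rightarrow> bool" where
  "smooth_on C A f \<longleftrightarrow>
    (\<forall>cs\<in>lists C. continuous_on A (pderivs_on A cs f) \<and>
      (\<forall>c\<in>C. \<forall>p\<in>A. (\<lambda>h. pderivs_on A cs f (c p h)) differentiable (at 0 within {h. c p h \<in> A})))"

definition line :: "'a::real_vector \<Rightarrow> 'a \<Rightarrow> real \<Rightarrow> 'a" where
  "line e p h = p + h *\<^sub>R e"

section \<open>Embedded submanifolds\<close>

definition chart_domain :: "'k::euclidean_space set \<Rightarrow> bool" where
  "chart_domain W \<longleftrightarrow>
    open W \<or> (\<exists>e\<in>Basis. openin (top_of_set {w. 0 \<le> w \<bullet> e}) W)"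

definition param ::
  "'a::euclidean_space set \<Rightarrow> 'k::euclidean_space set \<Rightarrow> ('k \<Rightarrow> 'a) \<Rightarrow> bool" where
  "param S W \<psi> \<longleftrightarrow>
    chart_domain W \<and>
    smooth_on (line ` Basis) W \<psi> \<and>
    (\<forall>w\<in>W. \<forall>v. (\<Sum>e\<in>Basis. (v \<bullet> e) *\<^sub>R pderiv_on W (line e) \<psi> w) = 0 \<longrightarrow> v = 0) \<and>
    openin (top_of_set S) (\<psi> ` W) \<and>
    (\<exists>\<phi>. homeomorphism W (\<psi> ` W) \<psi> \<phi>)"

text \<open>
  \<open>S\<close> is an embedded smooth submanifold, with boundary exactly \<open>B\<close>, of the dimension of \<open>'k\<close>.
\<close>

definition submanifold_with_boundary ::
  "'k::euclidean_space itself \<Rightarrow> 'a::euclidean_space set \<Rightarrow> 'a set \<Rightarrow> bool" where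
  "submanifold_with_boundary K S B \<longleftrightarrow>
    B \<subseteq> S \<and>
    (\<forall>p\<in>S - B. \<exists>W (\<psi> :: 'k \<Rightarrow> 'a). open W \<and> param S W \<psi> \<and> p \<in> \<psi> ` W) \<and>
    (\<forall>p\<in>B. \<exists>e\<in>Basis. \<exists>W (\<psi> :: 'k \<Rightarrow> 'a).
        openin (top_of_set {w. 0 \<le> w \<bullet> e}) W \<and> param S W \<psi> \<and> (\<exists>w\<in>W. w \<bullet> e = 0 \<and> \<psi> w = p))"

definition tangent_space ::
  "'k::euclidean_space itself \<Rightarrow> 'a::euclidean_space set \<Rightarrow> 'a \<Rightarrow> 'a set" where
  "tangent_space K S p =
    {\<Sum>e\<in>Basis. (v \<bullet> e) *\<^sub>R pderiv_on W (line e) \<psi> w | W (\<psi> :: 'k \<Rightarrow> 'a) w v.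
        param S W \<psi> \<and> w \<in> W \<and> \<psi> w = p}"

section \<open>Legendrians and Lagrangian cobordisms\<close>

text \<open>
  Points of \<open>J\<^sup>1M\<close> are triples \<open>(x, y, z)\<close>, points of \<open>T\<^sup>*(\<real>\<^sub>+ \<times> M)\<close> are quadruples
  \<open>(t, x, T, X)\<close> with \<open>t > 0\<close>, for a subset \<open>M\<close> of \<open>\<real>\<^sup>m\<close>; it is used with \<open>M = UNIV\<close> and with \<open>M\<close> a
  half-space.  A half-space is given by the index \<open>l\<close> of the coordinate required to be nonnegative,
  which plays the role of the last coordinate \<open>x\<^sub>n\<close>.
\<close>

definition halfspace :: "'n::finite \<Rightarrow> (real ^ 'n) set" where
  "halfspace l = {x. 0 \<le> x $ l}"

definition legendrian ::
  "(real ^ 'n::finite) set \<Rightarrow> ((real ^ 'n) \<times> (real ^ 'n) \<times> real) set \<Rightarrow> bool" where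
  "legendrian M \<Lambda> \<longleftrightarrow>
    (\<forall>(x, y, z)\<in>\<Lambda>. x \<in> M) \<and>
    (\<exists>B. (\<forall>(x, y, z)\<in>B. x \<in> frontier M) \<and>
         submanifold_with_boundary TYPE(real ^ 'n) \<Lambda> B) \<and>
    (\<forall>(x, y, z)\<in>\<Lambda>. \<forall>(dx, dy, dz)\<in>tangent_space TYPE(real ^ 'n) \<Lambda> (x, y, z).
        dz - y \<bullet> dx = 0)"

text \<open>
  The canonical form \<open>dt \<and> dT + dx \<and> dX\<close>; it equals \<open>-d(e\<^sup>s\<alpha>)\<close> under the identification of
  \<open>T\<^sup>*(\<real>\<^sub>+ \<times> M)\<close> with the symplectization, so both have the same Lagrangians.
\<close>

fun symp ::
  "real \<times> (real ^ 'n::finite) \<times> real \<times> (real ^ 'n) \<Rightarrow>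
   real \<times> (real ^ 'n) \<times> real \<times> (real ^ 'n) \<Rightarrow> real" where
  "symp (t, x, T, X) (t', x', T', X') = t * T' - t' * T + (x \<bullet> X' - x' \<bullet> X)"

definition lagrangian ::
  "(real ^ 'n::finite) set \<Rightarrow> (real \<times> (real ^ 'n) \<times> real \<times> (real ^ 'n)) set \<Rightarrow> bool" where
  "lagrangian M L \<longleftrightarrow>
    (\<forall>(t, x, T, X)\<in>L. 0 < t \<and> x \<in> M) \<and>
    (\<exists>B. (\<forall>(t, x, T, X)\<in>B. x \<in> frontier M) \<and>
         submanifold_with_boundary TYPE(real \<times> (real ^ 'n)) L B) \<and>
    (\<forall>p\<in>L. \<forall>u\<in>tangent_space TYPE(real \<times> (real ^ 'n)) L p.
       \<forall>v\<in>tangent_space TYPE(real \<times> (real ^ 'n)) L p. symp u v = 0)"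

definition cylinder ::
  "((real ^ 'n::finite) \<times> (real ^ 'n) \<times> real) set \<Rightarrow>
   (real \<times> (real ^ 'n) \<times> real \<times> (real ^ 'n)) set" where
  "cylinder \<Lambda> = {(t, x, z, t *\<^sub>R y) | t x y z. 0 < t \<and> (x, y, z) \<in> \<Lambda>}"

definition cobordism_between ::
  "real \<Rightarrow> real \<Rightarrow> (real ^ 'n::finite) set \<Rightarrow>
   ((real ^ 'n) \<times> (real ^ 'n) \<times> real) set \<Rightarrow>
   (real \<times> (real ^ 'n) \<times> real \<times> (real ^ 'n)) set \<Rightarrow>
   ((real ^ 'n) \<times> (real ^ 'n) \<times> real) set \<Rightarrow> bool" where
  "cobordism_between tm tp M \<Lambda>m L \<Lambda>p \<longleftrightarrow>
    0 < tm \<and> tm < tp \<and>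
    legendrian M \<Lambda>m \<and> legendrian M \<Lambda>p \<and> lagrangian M L \<and>
    {q \<in> L. fst q \<le> tm} = {q \<in> cylinder \<Lambda>m. fst q \<le> tm} \<and>
    {q \<in> L. tp \<le> fst q} = {q \<in> cylinder \<Lambda>p. tp \<le> fst q} \<and>
    compact {q \<in> L. tm \<le> fst q \<and> fst q \<le> tp}"

definition lagrangian_cobordism ::
  "(real ^ 'n::finite) set \<Rightarrow>
   ((real ^ 'n) \<times> (real ^ 'n) \<times> real) set \<Rightarrow>
   (real \<times> (real ^ 'n) \<times> real \<times> (real ^ 'n)) set \<Rightarrow>
   ((real ^ 'n) \<times> (real ^ 'n) \<times> real) set \<Rightarrow> bool" where
  "lagrangian_cobordism M \<Lambda>m L \<Lambda>p \<longleftrightarrow> (\<exists>tm tp. cobordism_between tm tp M \<Lambda>m L \<Lambda>p)"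

section \<open>Generating families\<close>

text \<open>
  The fibre \<open>\<real>\<^sup>N\<close> is the set of real sequences vanishing from index \<open>N\<close> on, with the product topology.
  A family is a function on \<open>D \<times> \<real>\<^sup>N\<close> with \<open>D\<close> a subset of a Euclidean space: \<open>D = M\<close> for
  Legendrians and \<open>D = \<real>\<^sub>+ \<times> M\<close> for Lagrangians.
\<close>

definition fibre :: "nat \<Rightarrow> (nat \<Rightarrow> real) set" where
  "fibre N = {\<eta>. \<forall>j\<ge>N. \<eta> j = 0}"

definition base_line ::
  "'a::real_vector \<Rightarrow> 'a \<times> (nat \<Rightarrow> real) \<Rightarrow> real \<Rightarrow> 'a \<times> (nat \<Rightarrow> real)" where
  "base_line e p h = (fst p + h *\<^sub>R e, snd p)"

definition fibre_line ::
  "nat \<Rightarrow> 'a \<times> (nat \<Rightarrow> real) \<Rightarrow> real \<Rightarrow> 'a \<times> (nat \<Rightarrow> real)" where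
  "fibre_line j p h = (fst p, (snd p)(j := snd p j + h))"

definition smooth_family ::
  "'a::euclidean_space set \<Rightarrow> nat \<Rightarrow> ('a \<times> (nat \<Rightarrow> real) \<Rightarrow> real) \<Rightarrow> bool" where
  "smooth_family D N f \<longleftrightarrow>
    smooth_on (base_line ` Basis \<union> fibre_line ` {..<N}) (D \<times> fibre N) f"

definition base_gradient ::
  "'a::euclidean_space set \<Rightarrow> nat \<Rightarrow> ('a \<times> (nat \<Rightarrow> real) \<Rightarrow> real) \<Rightarrow> 'a \<times> (nat \<Rightarrow> real) \<Rightarrow> 'a" where
  "base_gradient D N f p = (\<Sum>e\<in>Basis. pderiv_on (D \<times> fibre N) (base_line e) f p *\<^sub>R e)"

definition fibre_critical ::
  "'a::euclidean_space set \<Rightarrow> nat \<Rightarrow> ('a \<times> (nat \<Rightarrow> real) \<Rightarrow> real) \<Rightarrow> ('a \<times> (nat \<Rightarrow> real)) set" where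
  "fibre_critical D N f =
    {p \<in> D \<times> fibre N. \<forall>j<N. pderiv_on (D \<times> fibre N) (fibre_line j) f p = 0}"

text \<open>
  \<open>0\<close> is a regular value of \<open>\<partial>\<^sub>\<eta>f : D \<times> \<real>\<^sup>N \<rightarrow> \<real>\<^sup>N\<close>: the total derivative, here applied to the tangent
  vector \<open>(v, \<nu>)\<close>, is onto at every zero.
\<close>

definition regular_family ::
  "'a::euclidean_space set \<Rightarrow> nat \<Rightarrow> ('a \<times> (nat \<Rightarrow> real) \<Rightarrow> real) \<Rightarrow> bool" where
  "regular_family D N f \<longleftrightarrow>
    (\<forall>p\<in>fibre_critical D N f. \<forall>\<omega>\<in>fibre N. \<exists>v. \<exists>\<nu>\<in>fibre N. \<forall>j<N.
       (\<Sum>e\<in>Basis. (v \<bullet> e) * pderivs_on (D \<times> fibre N) [base_line e, fibre_line j] f p) +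
       (\<Sum>k<N. \<nu> k * pderivs_on (D \<times> fibre N) [fibre_line k, fibre_line j] f p) = \<omega> j)"

definition generates_legendrian ::
  "(real ^ 'n::finite) set \<Rightarrow> nat \<Rightarrow> ((real ^ 'n) \<times> (nat \<Rightarrow> real) \<Rightarrow> real) \<Rightarrow>
   ((real ^ 'n) \<times> (real ^ 'n) \<times> real) set \<Rightarrow> bool" where
  "generates_legendrian M N f \<Lambda> \<longleftrightarrow>
    smooth_family M N f \<and> regular_family M N f \<and>
    \<Lambda> = {(x, base_gradient M N f (x, \<eta>), f (x, \<eta>)) | x \<eta>. (x, \<eta>) \<in> fibre_critical M N f}"

definition pos_times :: "'a set \<Rightarrow> (real \<times> 'a) set" where
  "pos_times M = {0<..} \<times> M"

definition generates_lagrangian ::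
  "(real ^ 'n::finite) set \<Rightarrow> nat \<Rightarrow> ((real \<times> (real ^ 'n)) \<times> (nat \<Rightarrow> real) \<Rightarrow> real) \<Rightarrow>
   (real \<times> (real ^ 'n) \<times> real \<times> (real ^ 'n)) set \<Rightarrow> bool" where
  "generates_lagrangian M N F L \<longleftrightarrow>
    smooth_family (pos_times M) N F \<and> regular_family (pos_times M) N F \<and>
    L = {(t, x, base_gradient (pos_times M) N F ((t, x), \<eta>)) | t x \<eta>.
           ((t, x), \<eta>) \<in> fibre_critical (pos_times M) N F}"

text \<open>The relation \<open>(\<Lambda>\<^sub>-, f\<^sub>-) \<prec>\<^bsub>(L, F)\<^esub> (\<Lambda>\<^sub>+, f\<^sub>+)\<close>, with fibre dimension \<open>N\<close>.\<close>

definition compatible_families ::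
  "(real ^ 'n::finite) set \<Rightarrow> nat \<Rightarrow>
   ((real ^ 'n) \<times> (real ^ 'n) \<times> real) set \<Rightarrow> ((real ^ 'n) \<times> (nat \<Rightarrow> real) \<Rightarrow> real) \<Rightarrow>
   (real \<times> (real ^ 'n) \<times> real \<times> (real ^ 'n)) set \<Rightarrow>
   ((real \<times> (real ^ 'n)) \<times> (nat \<Rightarrow> real) \<Rightarrow> real) \<Rightarrow>
   ((real ^ 'n) \<times> (real ^ 'n) \<times> real) set \<Rightarrow> ((real ^ 'n) \<times> (nat \<Rightarrow> real) \<Rightarrow> real) \<Rightarrow> bool" where
  "compatible_families M N \<Lambda>m fm L F \<Lambda>p fp \<longleftrightarrow>
    (\<exists>tm tp. cobordism_between tm tp M \<Lambda>m L \<Lambda>p \<and>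
      (\<forall>t x \<eta>. 0 < t \<and> t \<le> tm \<and> x \<in> M \<and> \<eta> \<in> fibre N \<longrightarrow> F ((t, x), \<eta>) = t * fm (x, \<eta>)) \<and>
      (\<forall>t x \<eta>. tp \<le> t \<and> x \<in> M \<and> \<eta> \<in> fibre N \<longrightarrow> F ((t, x), \<eta>) = t * fp (x, \<eta>))) \<and>
    generates_lagrangian M N F L \<and>
    generates_legendrian M N fm \<Lambda>m \<and> generates_legendrian M N fp \<Lambda>p"

text \<open>The linear function of \<open>\<eta>\<close> with coefficients \<open>a\<close>, outside a compact subset of \<open>M \<times> \<real>\<^sup>N\<close>.\<close>

definition linear_at_infinity ::
  "(real ^ 'n::finite) set \<Rightarrow> nat \<Rightarrow> ((real ^ 'n) \<times> (nat \<Rightarrow> real) \<Rightarrow> real) \<Rightarrow>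
   (nat \<Rightarrow> real) \<Rightarrow> bool" where
  "linear_at_infinity M N f a \<longleftrightarrow>
    (\<exists>K. compact K \<and> K \<subseteq> M \<times> fibre N \<and>
      (\<forall>x \<eta>. (x, \<eta>) \<in> M \<times> fibre N - K \<longrightarrow> f (x, \<eta>) = (\<Sum>j<N. a j * \<eta> j)))"

definition tame ::
  "(real ^ 'n::finite) set \<Rightarrow> nat \<Rightarrow> ((real ^ 'n) \<times> (nat \<Rightarrow> real) \<Rightarrow> real) \<Rightarrow>
   ((real \<times> (real ^ 'n)) \<times> (nat \<Rightarrow> real) \<Rightarrow> real) \<Rightarrow> ((real ^ 'n) \<times> (nat \<Rightarrow> real) \<Rightarrow> real) \<Rightarrow> bool" where
  "tame M N fm F fp \<longleftrightarrow>
    (\<exists>a. (\<exists>j<N. a j \<noteq> 0) \<and> linear_at_infinity M N fm a) \<and>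
    (\<exists>a. (\<exists>j<N. a j \<noteq> 0) \<and> linear_at_infinity M N fp a) \<and>
    (\<forall>t>0. \<exists>a. linear_at_infinity M N (\<lambda>(x, \<eta>). F ((t, x), \<eta>)) a)"

section \<open>Spinning\<close>

definition reflect_vec :: "'n::finite \<Rightarrow> real ^ 'n \<Rightarrow> real ^ 'n" where
  "reflect_vec l x = (\<chi> i. if i = l then - x $ i else x $ i)"

definition reflect_cot ::
  "'n::finite \<Rightarrow> real \<times> (real ^ 'n) \<times> real \<times> (real ^ 'n) \<Rightarrow>
   real \<times> (real ^ 'n) \<times> real \<times> (real ^ 'n)" where
  "reflect_cot l = (\<lambda>(t, x, T, X). (t, reflect_vec l x, T, reflect_vec l X))"

text \<open>
  Properly embedded means that the boundary of \<open>L\<close> is its intersection with the boundary of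
  \<open>T\<^sup>*(\<real>\<^sub>+ \<times> H\<^sup>n)\<close>, and that \<open>L\<close> is transverse to the latter.
\<close>

definition spinnable_cobordism ::
  "'n::finite \<Rightarrow>
   ((real ^ 'n) \<times> (real ^ 'n) \<times> real) set \<Rightarrow>
   (real \<times> (real ^ 'n) \<times> real \<times> (real ^ 'n)) set \<Rightarrow>
   ((real ^ 'n) \<times> (real ^ 'n) \<times> real) set \<Rightarrow> bool" where
  "spinnable_cobordism l \<Lambda>m L \<Lambda>p \<longleftrightarrow>
    lagrangian_cobordism (halfspace l) \<Lambda>m L \<Lambda>p \<and>
    submanifold_with_boundary TYPE(real \<times> (real ^ 'n)) L {(t, x, T, X) \<in> L. x $ l = 0} \<and>
    (\<forall>(t, x, T, X)\<in>L. x $ l = 0 \<longrightarrow>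
      (\<exists>(dt, dx, dT, dX)\<in>tangent_space TYPE(real \<times> (real ^ 'n)) L (t, x, T, X). dx $ l \<noteq> 0)) \<and>
    submanifold_with_boundary TYPE(real \<times> (real ^ 'n)) (L \<union> reflect_cot l ` L) {}"

definition spinnable_family ::
  "'n::finite \<Rightarrow> nat \<Rightarrow> ((real \<times> (real ^ 'n)) \<times> (nat \<Rightarrow> real) \<Rightarrow> real) \<Rightarrow> bool" where
  "spinnable_family l N F \<longleftrightarrow>
    smooth_family (pos_times UNIV) N
      (\<lambda>((t, x), \<eta>). if 0 \<le> x $ l then F ((t, x), \<eta>) else F ((t, reflect_vec l x), \<eta>))"

text \<open>
  The coordinates of \<open>\<real>\<^sup>n\<^sup>+\<^sup>1\<close> are indexed by \<open>'n option\<close>: the new last coordinate \<open>x\<^sub>n\<^sub>+\<^sub>1\<close> has index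
  \<open>None\<close>, and the pair with indices \<open>Some l\<close> and \<open>None\<close> replaces \<open>x\<^sub>n\<close>.
\<close>

definition spin_vec :: "'n::finite \<Rightarrow> real \<Rightarrow> real ^ 'n \<Rightarrow> real ^ ('n option)" where
  "spin_vec l \<theta> x = (\<chi> i. case i of
      None \<Rightarrow> x $ l * sin \<theta>
    | Some j \<Rightarrow> if j = l then x $ l * cos \<theta> else x $ j)"

definition spin_lagrangian ::
  "'n::finite \<Rightarrow> (real \<times> (real ^ 'n) \<times> real \<times> (real ^ 'n)) set \<Rightarrow>
   (real \<times> (real ^ ('n option)) \<times> real \<times> (real ^ ('n option))) set" where
  "spin_lagrangian l L =
    {(t, spin_vec l \<theta> x, T, spin_vec l \<theta> X) | t x T X \<theta>. (t, x, T, X) \<in> L}"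

definition spin_legendrian ::
  "'n::finite \<Rightarrow> ((real ^ 'n) \<times> (real ^ 'n) \<times> real) set \<Rightarrow>
   ((real ^ ('n option)) \<times> (real ^ ('n option)) \<times> real) set" where
  "spin_legendrian l \<Lambda> = {(spin_vec l \<theta> x, spin_vec l \<theta> y, z) | x y z \<theta>. (x, y, z) \<in> \<Lambda>}"

end

theory Submission
  imports Defs
begin

text \<open>
  The spun family is \<open>F'(t, x', \<eta>) = F(t, x, \<eta>)\<close>, where \<open>x\<close> arises from \<open>x'\<close> by replacing the two rotated
  coordinates by their radius \<open>r\<close>.  Since the reflected extension of \<open>F\<close> is even in \<open>x\<^sub>l\<close>, the function
  \<open>F'\<close> is smooth (Whitney): \<open>\<partial>\<^sub>l F\<close> is odd, so \<open>\<partial>\<^sub>l F = x\<^sub>l h\<close> with \<open>h\<close> smooth and even (Hadamard), hence the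
  derivatives of \<open>F'\<close> in the rotated directions are the coordinates times \<open>h(\<dots>, r, \<dots>)\<close>, and this repeats.
  The gradient of \<open>F'\<close> is the rotated gradient of \<open>F\<close>, which gives regularity and the generated sets.

  The spun set is a Lagrangian submanifold.  Away from the axis, charts of \<open>L\<close> are rotated by an angle.
  At the axis evenness forces \<open>X\<^sub>l = 0\<close>, so the double of \<open>L\<close> is, near such a point, a graph over its
  tangent space that is equivariant under reflection; its odd entries are \<open>x\<^sub>l\<close> and \<open>X\<^sub>l = x\<^sub>l h\<close>, and it spins
  to a smooth graph.  Isotropy at the axis follows from isotropy off the axis by continuity.

  The Legendrian ends are slices \<open>t = const\<close> of the spun Lagrangian and of its family.
\<close>

section \<open>Smooth functions along coordinate lines\<close>

text \<open>Smoothness speaks of all words of partial derivatives, and spun functions, inverse maps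
  and parameter integrals offer no closed form for them. Each time a class of functions is exhibited
  that is closed under partial derivatives; for spinning it is the algebra generated by spun even
  functions and coordinates. The inverse of a chart is only known to be continuous, so charts are
  compared through linear maps: one that is injective on a tangent space makes the submanifold
  locally a graph over its target, and conversely a smooth section of a linear map is a chart. At
  the axis the obstacle is to find graph coordinates that contain \<open>x_l\<close> and avoid
  \<open>X_l\<close>. A tangent vector of the double pointing in the \<open>X_l\<close> direction
  alone would pair nontrivially with a tangent vector transverse to the boundary, against isotropy;
  so \<open>X_l\<close> can be dispensed with as a coordinate. The slices work because
  \<open>L\<close> contains the rays \<open>(t, x, z, t y)\<close> of the cylinder: contracting the
  symplectic form with the velocity \<open>(1, 0, 0, y)\<close> of a ray gives the contact form on
  the slice.\<close>

definition has_pderiv ::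
  "'p set \<Rightarrow> ('p \<Rightarrow> real \<Rightarrow> 'p) \<Rightarrow> ('p \<Rightarrow> 'b::real_normed_vector) \<Rightarrow> 'b \<Rightarrow> 'p \<Rightarrow> bool" where
  "has_pderiv A c f d p \<longleftrightarrow>
    ((\<lambda>h. f (c p h)) has_vector_derivative d) (at 0 within {h. c p h \<in> A})"

text \<open>The nontrivial filter makes one-sided derivatives unique, so that
  \<open>pderiv_on\<close> can be read off from \<open>has_pderiv\<close>. The equation
  \<open>c p 0 = p\<close> puts the zero step among the admissible ones.\<close>

definition line_domain :: "('p \<Rightarrow> real \<Rightarrow> 'p) set \<Rightarrow> 'p set \<Rightarrow> bool" where
  "line_domain C A \<longleftrightarrow>
    (\<forall>c\<in>C. \<forall>p\<in>A. c p 0 = p \<and> at 0 within {h. c p h \<in> A} \<noteq> bot)"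

lemma line_domainD:
  assumes "line_domain C A" "c \<in> C" "p \<in> A"
  shows "c p 0 = p" "at 0 within {h. c p h \<in> A} \<noteq> bot"
  using assms by (auto simp: line_domain_def)

lemma at_within_open_neq_bot:
  fixes x :: real
  assumes "open S" "x \<in> S"
  shows "at x within S \<noteq> bot"
  using assms at_within_open[of x S] by simp

lemma has_pderiv_pderiv_on_eq:
  assumes "line_domain C A" "c \<in> C" "p \<in> A" "has_pderiv A c f d p"
  shows "pderiv_on A c f p = d"
  using assms unfolding has_pderiv_def pderiv_on_def
  by (metis vector_derivative_within line_domainD(2))

lemma has_pderiv_cong:
  assumes "line_domain C A" "c \<in> C" "p \<in> A" "\<And>q. q \<in> A \<Longrightarrow> f q = g q"
  shows "has_pderiv A c f d p \<longleftrightarrow> has_pderiv A c g d p"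
proof -
  have "0 \<in> {h. c p h \<in> A}" using assms line_domainD(1) by fastforce
  then show ?thesis unfolding has_pderiv_def
    using assms(4) by (auto elim!: has_vector_derivative_transform[rotated 2])
qed

lemma has_pderiv_subset:
  assumes "has_pderiv A c f d p" "B \<subseteq> A"
  shows "has_pderiv B c f d p"
  using assms unfolding has_pderiv_def
  by (auto elim!: has_vector_derivative_within_subset)

lemma has_pderiv_const: "has_pderiv A c (\<lambda>_. k) 0 p"
  unfolding has_pderiv_def by (rule has_vector_derivative_const)

lemma has_pderiv_add:
  "has_pderiv A c f d p \<Longrightarrow> has_pderiv A c g e p \<Longrightarrow> has_pderiv A c (\<lambda>q. f q + g q) (d + e) p"
  unfolding has_pderiv_def by (rule has_vector_derivative_add)

lemma has_pderiv_mult: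
  fixes f g :: "'p \<Rightarrow> real"
  assumes "c p 0 = p" "has_pderiv A c f d p" "has_pderiv A c g e p"
  shows "has_pderiv A c (\<lambda>q. f q * g q) (f p * e + d * g p) p"
  using has_vector_derivative_mult[of "\<lambda>h. f (c p h)" d 0 "{h. c p h \<in> A}" "\<lambda>h. g (c p h)" e] assms
  unfolding has_pderiv_def by simp

lemma has_pderiv_bounded_linear:
  "bounded_linear T \<Longrightarrow> has_pderiv A c f d p \<Longrightarrow> has_pderiv A c (\<lambda>q. T (f q)) (T d) p"
  unfolding has_pderiv_def by (rule bounded_linear.has_vector_derivative)

lemma has_pderiv_sum:
  "(\<And>i. i \<in> I \<Longrightarrow> has_pderiv A c (f i) (d i) p) \<Longrightarrow>
    has_pderiv A c (\<lambda>q. \<Sum>i\<in>I. f i q) (\<Sum>i\<in>I. d i) p"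
  unfolding has_pderiv_def by (rule has_vector_derivative_sum)

lemma smooth_on_continuous: "smooth_on C A f \<Longrightarrow> continuous_on A f"
  unfolding smooth_on_def using lists.Nil by fastforce

lemma smooth_on_has_pderiv:
  assumes "smooth_on C A f" "c \<in> C" "p \<in> A"
  shows "has_pderiv A c f (pderiv_on A c f p) p"
proof -
  have "(\<lambda>h. pderivs_on A [] f (c p h)) differentiable (at 0 within {h. c p h \<in> A})"
    using assms unfolding smooth_on_def by (meson lists.Nil)
  then show ?thesis
    unfolding has_pderiv_def pderiv_on_def by (simp add: vector_derivative_works)
qed

lemma pderivs_on_append: "pderivs_on A (cs @ ds) f = pderivs_on A cs (pderivs_on A ds f)"
  by (induction cs) auto

lemma smooth_on_pderiv_on:
  assumes "smooth_on C A f" "c \<in> C"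
  shows "smooth_on C A (pderiv_on A c f)"
proof -
  have eq: "pderivs_on A cs (pderiv_on A c f) = pderivs_on A (cs @ [c]) f" for cs
    by (simp add: pderivs_on_append)
  have "cs @ [c] \<in> lists C" if "cs \<in> lists C" for cs
    using that assms(2) by simp
  then show ?thesis
    using assms(1) unfolding smooth_on_def eq by blast
qed

text \<open>An iterated derivative only has to agree on \<open>A\<close> with some member of
  \<open>P\<close>: the values of the inner derivative outside \<open>A\<close> do not influence the
  outer one. Hence a class of continuous functions closed under partial derivatives consists of
  smooth functions, and no derivative has to be written out.\<close>

lemma smooth_on_coinduct:
  assumes dom: "line_domain C A" and "P f"
    and cont: "\<And>f. P f \<Longrightarrow> continuous_on A f"
    and deriv: "\<And>f c. P f \<Longrightarrow> c \<in> C \<Longrightarrow> \<exists>g. P g \<and> (\<forall>p\<in>A. has_pderiv A c f (g p) p)"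
  shows "smooth_on C A f"
proof -
  have *: "\<exists>g. P g \<and> (\<forall>p\<in>A. pderivs_on A cs f p = g p)" if "cs \<in> lists C" for cs
    using that
  proof (induction cs)
    case Nil
    then show ?case using \<open>P f\<close> by auto
  next
    case (Cons c cs)
    then obtain g where g: "P g" "\<forall>p\<in>A. pderivs_on A cs f p = g p" and c: "c \<in> C" by auto
    obtain g' where g': "P g'" "\<forall>p\<in>A. has_pderiv A c g (g' p) p" using deriv[OF g(1) c] by blast
    have "pderivs_on A (c # cs) f p = g' p" if "p \<in> A" for p
      using has_pderiv_pderiv_on_eq[OF dom c that] has_pderiv_cong[OF dom c that] g(2) g'(2) that
      by (metis pderivs_on.simps(2))
    with g' show ?case by blast
  qed
  show ?thesis unfolding smooth_on_def
  proof (intro ballI conjI)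
    fix cs assume cs: "cs \<in> lists C"
    obtain g where g: "P g" "\<forall>p\<in>A. pderivs_on A cs f p = g p" using *[OF cs] by blast
    show "continuous_on A (pderivs_on A cs f)"
      using cont[OF g(1)] g(2) by (simp cong: continuous_on_cong)
    fix c p assume c: "c \<in> C" and p: "p \<in> A"
    obtain g' where "\<forall>p\<in>A. has_pderiv A c g (g' p) p" using deriv[OF g(1) c] by blast
    then have "has_pderiv A c (pderivs_on A cs f) (g' p) p"
      using has_pderiv_cong[OF dom c p] g(2) p by blast
    then show "(\<lambda>h. pderivs_on A cs f (c p h)) differentiable (at 0 within {h. c p h \<in> A})"
      unfolding has_pderiv_def by (rule differentiableI_vector)
  qed
qed

lemma smooth_on_cong:
  fixes f g :: "_ \<Rightarrow> 'b::real_normed_vector"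
  assumes dom: "line_domain C A" and f: "smooth_on C A f" and eq: "\<And>p. p \<in> A \<Longrightarrow> f p = g p"
  shows "smooth_on C A g"
proof (rule smooth_on_coinduct[OF dom, where P = "\<lambda>g. \<exists>f. smooth_on C A f \<and> (\<forall>p\<in>A. f p = g p)"])
  show "\<exists>f. smooth_on C A f \<and> (\<forall>p\<in>A. f p = g p)" using f eq by blast
next
  fix g :: "_ \<Rightarrow> 'b" assume "\<exists>f. smooth_on C A f \<and> (\<forall>p\<in>A. f p = g p)"
  then show "continuous_on A g"
    using smooth_on_continuous by (metis continuous_on_cong)
next
  fix g :: "_ \<Rightarrow> 'b" and c assume "\<exists>f. smooth_on C A f \<and> (\<forall>p\<in>A. f p = g p)" and c: "c \<in> C"
  then obtain f where f: "smooth_on C A f" "\<forall>p\<in>A. f p = g p" by blast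
  then have "\<forall>p\<in>A. has_pderiv A c g (pderiv_on A c f p) p"
    using has_pderiv_cong[OF dom c, of _ f g] smooth_on_has_pderiv c by metis
  then show "\<exists>h. (\<exists>f. smooth_on C A f \<and> (\<forall>p\<in>A. f p = h p)) \<and> (\<forall>p\<in>A. has_pderiv A c g (h p) p)"
    using smooth_on_pderiv_on[OF f(1) c] by blast
qed

lemma smooth_on_bounded_linear:
  assumes dom: "line_domain C A" and T: "bounded_linear T" and f: "smooth_on C A f"
  shows "smooth_on C A (\<lambda>p. T (f p))"
proof (rule smooth_on_coinduct[OF dom, where P = "\<lambda>g. \<exists>f. smooth_on C A f \<and> g = (\<lambda>p. T (f p))"])
  show "\<exists>fa. smooth_on C A fa \<and> (\<lambda>p. T (f p)) = (\<lambda>p. T (fa p))" using f by blast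
next
  fix g assume "\<exists>f. smooth_on C A f \<and> g = (\<lambda>p. T (f p))"
  then show "continuous_on A g"
    using smooth_on_continuous bounded_linear.continuous_on[OF T] by blast
next
  fix g c assume "\<exists>f. smooth_on C A f \<and> g = (\<lambda>p. T (f p))" and c: "c \<in> C"
  then obtain f where f: "smooth_on C A f" "g = (\<lambda>p. T (f p))" by blast
  then have "\<forall>p\<in>A. has_pderiv A c g (T (pderiv_on A c f p)) p"
    using has_pderiv_bounded_linear[OF T] smooth_on_has_pderiv c by metis
  then show "\<exists>h. (\<exists>f. smooth_on C A f \<and> h = (\<lambda>p. T (f p))) \<and> (\<forall>p\<in>A. has_pderiv A c g (h p) p)"
    using smooth_on_pderiv_on[OF f(1) c] by blast
qed

lemma has_pderiv_pullback:
  assumes f: "has_pderiv A c f d (\<Phi> p)" and "\<Phi> ` A' \<subseteq> A"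
    and line: "\<And>h. c' p h \<in> A' \<Longrightarrow> \<Phi> (c' p h) = c (\<Phi> p) h" and c': "c' p 0 = p" and p: "p \<in> A'"
  shows "has_pderiv A' c' (\<lambda>p. f (\<Phi> p)) d p"
proof -
  have "{h. c' p h \<in> A'} \<subseteq> {h. c (\<Phi> p) h \<in> A}" using assms(2) line by force
  then have "((\<lambda>h. f (c (\<Phi> p) h)) has_vector_derivative d) (at 0 within {h. c' p h \<in> A'})"
    using f unfolding has_pderiv_def by (rule has_vector_derivative_within_subset[rotated])
  then show ?thesis unfolding has_pderiv_def
    by (rule has_vector_derivative_transform[rotated 2]) (use line c' p in auto)
qed

text \<open>Where \<open>\<Phi>\<close> carries coordinate lines to coordinate lines at the same
  speed, or collapses them, partial derivatives pull back without a chain rule. This covers slices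
  and the passage between a base and a family over it, whose fibre is no Euclidean type.\<close>

lemma smooth_on_pullback:
  fixes f :: "'p::topological_space \<Rightarrow> 'b::real_normed_vector"
  assumes dom: "line_domain C' A'" and cont: "continuous_on A' \<Phi>" and sub: "\<Phi> ` A' \<subseteq> A"
    and f: "smooth_on C A f"
    and line: "\<And>c'. c' \<in> C' \<Longrightarrow>
      (\<exists>c\<in>C. \<forall>p\<in>A'. \<forall>h. c' p h \<in> A' \<longrightarrow> \<Phi> (c' p h) = c (\<Phi> p) h) \<or>
      (\<forall>p\<in>A'. \<forall>h. c' p h \<in> A' \<longrightarrow> \<Phi> (c' p h) = \<Phi> p)"
  shows "smooth_on C' A' (\<lambda>p. f (\<Phi> p))"
proof -
  \<comment> \<open>The zero function enters as the derivative along a direction that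
    \<open>\<Phi>\<close> collapses.\<close>
  let ?P = "\<lambda>g. g = (\<lambda>_. 0) \<or> (\<exists>f. smooth_on C A f \<and> g = (\<lambda>p. f (\<Phi> p)))"
  show ?thesis
  proof (rule smooth_on_coinduct[OF dom, where P = ?P])
    show "?P (\<lambda>p. f (\<Phi> p))" using f by blast
  next
    fix g :: "_ \<Rightarrow> 'b" assume "?P g"
    then consider "g = (\<lambda>_. 0)" | f where "smooth_on C A f" "g = (\<lambda>p. f (\<Phi> p))" by blast
    then show "continuous_on A' g"
    proof cases
      case (2 f)
      then show ?thesis using continuous_on_compose2[OF smooth_on_continuous[OF 2(1)] cont sub] by simp
    qed simp
  next
    fix g :: "_ \<Rightarrow> 'b" and c' assume "?P g" and c': "c' \<in> C'"
    then consider "g = (\<lambda>_. 0)" | f where "smooth_on C A f" "g = (\<lambda>p. f (\<Phi> p))" by blast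
    then show "\<exists>h. ?P h \<and> (\<forall>p\<in>A'. has_pderiv A' c' g (h p) p)"
    proof cases
      case 1
      then show ?thesis by (intro exI[of _ "\<lambda>_. 0"]) (simp add: has_pderiv_const)
    next
      case (2 f)
      from line[OF c'] show ?thesis
      proof
        assume "\<exists>c\<in>C. \<forall>p\<in>A'. \<forall>h. c' p h \<in> A' \<longrightarrow> \<Phi> (c' p h) = c (\<Phi> p) h"
        then obtain c where c: "c \<in> C" "\<And>p h. p\<in>A' \<Longrightarrow> c' p h \<in> A' \<Longrightarrow> \<Phi> (c' p h) = c (\<Phi> p) h"
          by blast
        have "has_pderiv A' c' g (pderiv_on A c f (\<Phi> p)) p" if "p \<in> A'" for p
          unfolding 2
          by (rule has_pderiv_pullback[where c = c, OF smooth_on_has_pderiv[OF 2(1) c(1)] sub])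
             (use c(2) that line_domainD[OF dom c'] sub in auto)
        then show ?thesis using smooth_on_pderiv_on[OF 2(1) c(1)]
          by (intro exI[of _ "\<lambda>p. pderiv_on A c f (\<Phi> p)"]) auto
      next
        assume cst: "\<forall>p\<in>A'. \<forall>h. c' p h \<in> A' \<longrightarrow> \<Phi> (c' p h) = \<Phi> p"
        have "has_pderiv A' c' g 0 p" if "p \<in> A'" for p
          unfolding has_pderiv_def 2
          by (rule has_vector_derivative_transform[OF _ _ has_vector_derivative_const[of "f (\<Phi> p)"]])
             (use cst that line_domainD[OF dom c'] in auto)
        then show ?thesis by (intro exI[of _ "\<lambda>_. 0"]) simp
      qed
    qed
  qed
qed

lemma pderiv_on_subset:
  assumes dom: "line_domain C B" and sub: "B \<subseteq> A" and f: "smooth_on C A f"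
    and eq: "\<And>q. q \<in> B \<Longrightarrow> g q = f q" and c: "c \<in> C" and p: "p \<in> B"
  shows "pderiv_on B c g p = pderiv_on A c f p"
  using has_pderiv_pderiv_on_eq[OF dom c p] has_pderiv_cong[OF dom c p, of g f]
    has_pderiv_subset[OF smooth_on_has_pderiv[OF f c] sub] eq p sub by blast

lemma smooth_on_subset:
  assumes dom: "line_domain C B" and sub: "B \<subseteq> A" and f: "smooth_on C A f"
  shows "smooth_on C B f"
  using smooth_on_pullback[OF dom continuous_on_id _ f] sub by auto

section \<open>Algebras of functions closed under differentiation\<close>

inductive gen_alg :: "('p \<Rightarrow> real) set \<Rightarrow> ('p \<Rightarrow> real) \<Rightarrow> bool" for G where
  gen: "g \<in> G \<Longrightarrow> gen_alg G g"
| const: "gen_alg G (\<lambda>_. k)"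
| add: "gen_alg G f \<Longrightarrow> gen_alg G g \<Longrightarrow> gen_alg G (\<lambda>p. f p + g p)"
| mult: "gen_alg G f \<Longrightarrow> gen_alg G g \<Longrightarrow> gen_alg G (\<lambda>p. f p * g p)"

lemma gen_alg_sum:
  "(\<And>i. i \<in> I \<Longrightarrow> gen_alg G (f i)) \<Longrightarrow> gen_alg G (\<lambda>p. \<Sum>i\<in>I. f i p)"
  by (induction I rule: infinite_finite_induct) (auto intro: gen_alg.intros)

lemma gen_alg_uminus: "gen_alg G f \<Longrightarrow> gen_alg G (\<lambda>p. - f p)"
  using gen_alg.mult[OF gen_alg.const[of G "-1"], of f] by simp

text \<open>By the sum and Leibniz rules it suffices to differentiate the generators, and their
  derivatives may lie anywhere in the algebra. This suits functions whose derivatives are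
  polynomials in one another: sine and cosine, the entries of an inverse matrix, spun functions
  together with the coordinates.\<close>

lemma smooth_on_gen_alg:
  assumes dom: "line_domain C A"
    and G: "\<And>g. g \<in> G \<Longrightarrow> continuous_on A g"
      "\<And>g c. g \<in> G \<Longrightarrow> c \<in> C \<Longrightarrow> \<exists>g'. gen_alg G g' \<and> (\<forall>p\<in>A. has_pderiv A c g (g' p) p)"
    and f: "gen_alg G f"
  shows "smooth_on C A f"
proof (rule smooth_on_coinduct[OF dom, where P = "gen_alg G", OF f])
  show "continuous_on A f" if "gen_alg G f" for f
    using that by induction (auto intro: continuous_on_add continuous_on_mult G(1))
next
  fix f c assume "gen_alg G f" and c: "c \<in> C"
  then show "\<exists>g. gen_alg G g \<and> (\<forall>p\<in>A. has_pderiv A c f (g p) p)"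
  proof induction
    case (gen g)
    then show ?case using G(2) c by blast
  next
    case (const k)
    show ?case by (intro exI[of _ "\<lambda>_. 0"]) (simp add: has_pderiv_const gen_alg.const)
  next
    case (add f g)
    then obtain f' g' where *: "gen_alg G f'" "gen_alg G g'"
      "\<forall>p\<in>A. has_pderiv A c f (f' p) p" "\<forall>p\<in>A. has_pderiv A c g (g' p) p"
      by blast
    then have "\<forall>p\<in>A. has_pderiv A c (\<lambda>p. f p + g p) (f' p + g' p) p"
      by (simp add: has_pderiv_add)
    then show ?case
      using gen_alg.add[OF *(1,2)] by (intro exI[of _ "\<lambda>p. f' p + g' p"]) simp
  next
    case (mult f g)
    then obtain f' g' where *: "gen_alg G f'" "gen_alg G g'"
      "\<forall>p\<in>A. has_pderiv A c f (f' p) p" "\<forall>p\<in>A. has_pderiv A c g (g' p) p"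
      by blast
    then have "\<forall>p\<in>A. has_pderiv A c (\<lambda>p. f p * g p) (f p * g' p + f' p * g p) p"
      by (simp add: has_pderiv_mult line_domainD[OF dom c])
    moreover have "gen_alg G (\<lambda>p. f p * g' p + f' p * g p)"
      using mult.hyps * by (auto intro: gen_alg.add gen_alg.mult)
    ultimately show ?case by (intro exI[of _ "\<lambda>p. f p * g' p + f' p * g p"]) simp
  qed
qed

lemma smooth_on_gen_alg_smooth:
  assumes dom: "line_domain C A" and f: "gen_alg {g. smooth_on C A g} f"
  shows "smooth_on C A f"
proof (rule smooth_on_gen_alg[OF dom _ _ f])
  fix g :: "_ \<Rightarrow> real" and c assume g: "g \<in> {g. smooth_on C A g}" and "c \<in> C"
  then have "smooth_on C A (pderiv_on A c g)" "\<forall>p\<in>A. has_pderiv A c g (pderiv_on A c g p) p"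
    using smooth_on_pderiv_on smooth_on_has_pderiv by auto
  then show "\<exists>g'. gen_alg {g. smooth_on C A g} g' \<and> (\<forall>p\<in>A. has_pderiv A c g (g' p) p)"
    by (intro exI[of _ "pderiv_on A c g"]) (simp add: gen_alg.gen)
qed (auto dest: smooth_on_continuous)

lemma smooth_on_mult:
  fixes f g :: "_ \<Rightarrow> real"
  assumes "line_domain C A" "smooth_on C A f" "smooth_on C A g"
  shows "smooth_on C A (\<lambda>p. f p * g p)"
  by (rule smooth_on_gen_alg_smooth[OF assms(1)]) (use assms in \<open>auto intro: gen_alg.intros\<close>)

lemma smooth_on_const: "line_domain C A \<Longrightarrow> smooth_on C A (\<lambda>_. k)"
  by (rule smooth_on_coinduct[where P = "\<lambda>f. \<exists>k. f = (\<lambda>_. k)"])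
     (auto intro: has_pderiv_const exI[of _ "\<lambda>_. 0"])

text \<open>Reduces maps to real functions, where the algebra of generators is available.\<close>

lemma smooth_on_componentwise:
  fixes f :: "_ \<Rightarrow> 'b::euclidean_space"
  assumes dom: "line_domain C A" and f: "\<And>b. b \<in> Basis \<Longrightarrow> smooth_on C A (\<lambda>p. f p \<bullet> b)"
  shows "smooth_on C A f"
proof -
  let ?P = "\<lambda>f::_ \<Rightarrow> 'b. \<forall>b\<in>Basis. smooth_on C A (\<lambda>p. f p \<bullet> b)"
  show ?thesis
  proof (rule smooth_on_coinduct[OF dom, where P = ?P])
    show "?P f" using f by blast
  next
    fix f assume "?P f"
    then have "continuous_on A (\<lambda>p. f p \<bullet> b)" if "b \<in> Basis" for b
      using that smooth_on_continuous by metis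
    then have "continuous_on A (\<lambda>p. \<Sum>b\<in>Basis. (f p \<bullet> b) *\<^sub>R b)"
      by (intro continuous_on_sum continuous_on_scaleR continuous_on_const)
    then show "continuous_on A f" by (simp add: euclidean_representation)
  next
    fix f c assume P: "?P f" and c: "c \<in> C"
    define g where "g p = (\<Sum>b\<in>Basis. pderiv_on A c (\<lambda>p. f p \<bullet> b) p *\<^sub>R b)" for p
    have "?P g"
      using P c by (auto simp: g_def inner_sum_left inner_Basis if_distrib cong: if_cong
          intro: smooth_on_pderiv_on)
    moreover have "has_pderiv A c f (g p) p" if p: "p \<in> A" for p
    proof -
      have "has_pderiv A c (\<lambda>p. \<Sum>b\<in>Basis. (f p \<bullet> b) *\<^sub>R b) (g p) p"
        unfolding g_def
        by (intro has_pderiv_sum has_pderiv_bounded_linear[OF bounded_linear_scaleR_left]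
            smooth_on_has_pderiv) (use P c p in auto)
      then show ?thesis by (simp add: euclidean_representation)
    qed
    ultimately show "\<exists>g. ?P g \<and> (\<forall>p\<in>A. has_pderiv A c f (g p) p)"
      by (intro exI[of _ g]) simp
  qed
qed

section \<open>Total derivatives and the chain rule\<close>

lemma open_line_vimage:
  fixes p e :: "'a::real_normed_vector"
  assumes "open W"
  shows "open {h::real. p + h *\<^sub>R e \<in> W}"
  using open_vimage[OF assms, of "\<lambda>h::real. p + h *\<^sub>R e"]
  by (simp add: vimage_def continuous_intros)

lemma line_domain_line_open: 
  fixes W :: "'a::real_normed_vector set"
  assumes "open W"
  shows "line_domain (line ` B) W"
  unfolding line_domain_def line_def
  using at_within_open_neq_bot[OF open_line_vimage[OF assms]] by fastforce

text \<open>Moving from \<open>p\<close> to \<open>p + v\<close> one coordinate at a time.\<close>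

lemma partial_increment_bound:
  fixes f :: "'a::euclidean_space \<Rightarrow> 'b::real_normed_vector"
  assumes "finite B" "B \<subseteq> Basis"
    and deriv: "\<And>q e. q \<in> ball p r \<Longrightarrow> e \<in> Basis \<Longrightarrow>
      ((\<lambda>h. f (q + h *\<^sub>R e)) has_vector_derivative g e q) (at 0)"
    and bound: "\<And>q e. q \<in> ball p r \<Longrightarrow> e \<in> Basis \<Longrightarrow> norm (g e q - g e p) \<le> \<epsilon>"
    and v: "norm v < r"
  shows "norm (f (p + (\<Sum>e\<in>B. (v \<bullet> e) *\<^sub>R e)) - f p - (\<Sum>e\<in>B. (v \<bullet> e) *\<^sub>R g e p)) \<le>
    \<epsilon> * (\<Sum>e\<in>B. \<bar>v \<bullet> e\<bar>)"
  using assms(1,2)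
proof (induction B rule: finite_induct)
  case empty
  then show ?case by simp
next
  case (insert e B)
  define w where "w = p + (\<Sum>e\<in>B. (v \<bullet> e) *\<^sub>R e)"
  have e: "e \<in> Basis" using insert by auto
  \<comment> \<open>Subtracting the linear term leaves a function of one variable with derivative
    \<open>g e q - g e p\<close>, which \<open>bound\<close> controls.\<close>
  define \<phi> where "\<phi> s = f (w + s *\<^sub>R e) - s *\<^sub>R g e p" for s
  let ?I = "closed_segment 0 (v \<bullet> e)"
  have in_ball: "w + s *\<^sub>R e \<in> ball p r" if "s \<in> ?I" for s
  proof -
    have s: "\<bar>s\<bar> \<le> \<bar>v \<bullet> e\<bar>" using that by (auto simp: closed_segment_eq_real_ivl split: if_splits)
    define u where "u = (\<Sum>e\<in>B. (v \<bullet> e) *\<^sub>R e) + s *\<^sub>R e"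
    \<comment> \<open>Each coordinate of \<open>u\<close> is dominated by the same coordinate of
      \<open>v\<close>, so the path of coordinate segments stays inside the ball.\<close>
    have "norm u \<le> norm v"
    proof (rule norm_le_componentwise)
      fix b :: 'a assume b: "b \<in> Basis"
      have "(\<Sum>e\<in>B. (v \<bullet> e) *\<^sub>R e) \<bullet> b = (if b \<in> B then v \<bullet> b else 0)"
        using b insert.prems insert.hyps
        by (simp add: inner_sum_left inner_Basis if_distrib[of "(*) _"] subset_iff cong: if_cong sum.cong)
      moreover have "e \<bullet> b = (if e = b then 1 else 0)" using e b by (simp add: inner_Basis)
      ultimately have "u \<bullet> b = (if b \<in> B then v \<bullet> b else 0) + s * (if e = b then 1 else 0)"
        by (simp add: u_def inner_left_distrib)
      then show "\<bar>u \<bullet> b\<bar> \<le> \<bar>v \<bullet> b\<bar>" using s insert.hyps by auto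
    qed
    then have "norm (w + s *\<^sub>R e - p) < r" using v by (simp add: w_def u_def algebra_simps)
    then show ?thesis by (simp add: dist_norm norm_minus_commute)
  qed
  have der: "(\<phi> has_vector_derivative (g e (w + s *\<^sub>R e) - g e p)) (at s within ?I)" if s: "s \<in> ?I" for s
  proof -
    have "((\<lambda>h. f (w + s *\<^sub>R e + h *\<^sub>R e)) has_vector_derivative g e (w + s *\<^sub>R e)) (at (s - s))"
      using deriv[OF in_ball[OF s] e] by simp
    moreover have "((\<lambda>x. x - s) has_real_derivative 1) (at s)"
      by (auto intro!: derivative_eq_intros)
    ultimately have "((\<lambda>h. f (w + s *\<^sub>R e + h *\<^sub>R e)) \<circ> (\<lambda>x. x - s) has_vector_derivative
        1 *\<^sub>R g e (w + s *\<^sub>R e)) (at s)"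
      by (intro vector_diff_chain_at) (auto simp: has_real_derivative_iff_has_vector_derivative)
    then have "((\<lambda>x. f (w + x *\<^sub>R e)) has_vector_derivative g e (w + s *\<^sub>R e)) (at s)"
      by (simp add: o_def algebra_simps)
    then have "(\<phi> has_vector_derivative (g e (w + s *\<^sub>R e) - 1 *\<^sub>R g e p)) (at s)"
      unfolding \<phi>_def
      by (intro has_vector_derivative_diff has_vector_derivative_scaleR[where g = "\<lambda>_. g e p" and g' = 0, simplified]) 
         (auto intro: derivative_eq_intros)
    then show ?thesis by (simp add: has_vector_derivative_at_within)
  qed
  have step: "norm (\<phi> (v \<bullet> e) - \<phi> 0) \<le> \<epsilon> * norm (v \<bullet> e - 0)"
  proof (rule differentiable_bound[where S = ?I and f' = "\<lambda>s h. h *\<^sub>R (g e (w + s *\<^sub>R e) - g e p)"])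
    show "(\<phi> has_derivative (\<lambda>h. h *\<^sub>R (g e (w + x *\<^sub>R e) - g e p))) (at x within ?I)" if "x \<in> ?I" for x
      using der[OF that] by (simp add: has_vector_derivative_def)
    show "onorm (\<lambda>h. h *\<^sub>R (g e (w + x *\<^sub>R e) - g e p)) \<le> \<epsilon>" if "x \<in> ?I" for x
      by (rule onorm_le) (use bound[OF in_ball[OF that] e] in \<open>simp add: mult.commute[of \<epsilon>] mult_left_mono\<close>)
  qed auto
  have "f (p + (\<Sum>e\<in>insert e B. (v \<bullet> e) *\<^sub>R e)) - f p - (\<Sum>e\<in>insert e B. (v \<bullet> e) *\<^sub>R g e p) =
      (f w - f p - (\<Sum>e\<in>B. (v \<bullet> e) *\<^sub>R g e p)) + (\<phi> (v \<bullet> e) - \<phi> 0)"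
    using insert.hyps by (simp add: \<phi>_def w_def algebra_simps)
  also have "norm \<dots> \<le> \<epsilon> * (\<Sum>e\<in>B. \<bar>v \<bullet> e\<bar>) + \<epsilon> * \<bar>v \<bullet> e\<bar>"
    by (rule norm_triangle_le) (use insert step in \<open>auto simp: w_def intro!: add_mono\<close>)
  also have "\<dots> = \<epsilon> * (\<Sum>e\<in>insert e B. \<bar>v \<bullet> e\<bar>)"
    using insert.hyps by (simp add: algebra_simps)
  finally show ?case .
qed

text \<open>Continuity of the partial derivatives makes the increment bound small relative to
  \<open>norm (y - p)\<close>. The resulting Frechet derivative is what composition and the inverse
  function theorem require.\<close>

lemma smooth_on_has_derivative:
  fixes f :: "'a::euclidean_space \<Rightarrow> 'b::real_normed_vector"
  assumes W: "open W" and f: "smooth_on (line ` Basis) W f" and p: "p \<in> W"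
  shows "(f has_derivative (\<lambda>v. \<Sum>e\<in>Basis. (v \<bullet> e) *\<^sub>R pderiv_on W (line e) f p)) (at p)"
proof -
  define g where "g e q = pderiv_on W (line e) f q" for e q
  have deriv: "((\<lambda>h. f (q + h *\<^sub>R e)) has_vector_derivative g e q) (at 0)" if "q \<in> W" "e \<in> Basis" for q e
  proof -
    have "((\<lambda>h. f (line e q h)) has_vector_derivative g e q) (at 0 within {h. line e q h \<in> W})"
      using smooth_on_has_pderiv[OF f _ that(1)] that(2) by (simp add: g_def has_pderiv_def)
    moreover have "open {h. line e q h \<in> W}"
      unfolding line_def by (rule open_line_vimage[OF W])
    then have "at 0 within {h. line e q h \<in> W} = at 0"
      by (intro at_within_open) (use that in \<open>auto simp: line_def\<close>)
    ultimately show ?thesis by (simp add: line_def)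
  qed
  have cont: "isCont (g e) p" if "e \<in> Basis" for e
    using smooth_on_continuous[OF smooth_on_pderiv_on[OF f]] that p W
    unfolding g_def by (metis continuous_on_eq_continuous_at imageI)
  show ?thesis
    unfolding has_derivative_at_alt g_def[symmetric]
  proof (intro conjI allI impI)
    show "bounded_linear (\<lambda>v. \<Sum>e\<in>Basis. (v \<bullet> e) *\<^sub>R g e p)"
      by (intro bounded_linear_sum bounded_linear_scaleR_const bounded_linear_inner_left)
  next
    fix \<epsilon> :: real assume "0 < \<epsilon>"
    \<comment> \<open>The increment bound sums over \<open>DIM('a)\<close> coordinates, each at most
      the norm; hence the division.\<close>
    define \<delta> where "\<delta> = \<epsilon> / real (DIM('a))"
    have \<delta>: "0 < \<delta>" using \<open>0 < \<epsilon>\<close> by (simp add: \<delta>_def)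
    have "\<forall>\<^sub>F q in nhds p. \<forall>e\<in>Basis. dist (g e q) (g e p) < \<delta>"
      using cont \<delta>
      by (intro eventually_ball_finite ballI tendstoD)
         (auto simp: isCont_def tendsto_at_iff_tendsto_nhds)
    then obtain r1 where r1: "0 < r1" "\<And>q e. dist q p < r1 \<Longrightarrow> e \<in> Basis \<Longrightarrow> dist (g e q) (g e p) < \<delta>"
      unfolding eventually_nhds_metric by blast
    obtain r2 where r2: "0 < r2" "ball p r2 \<subseteq> W" using W p open_contains_ball by blast
    define r where "r = min r1 r2"
    have "norm (f y - f p - (\<Sum>e\<in>Basis. ((y - p) \<bullet> e) *\<^sub>R g e p)) \<le> \<epsilon> * norm (y - p)"
      if y: "norm (y - p) < r" for y
    proof -
      have "norm (f (p + (\<Sum>e\<in>Basis. ((y - p) \<bullet> e) *\<^sub>R e)) - f p - (\<Sum>e\<in>Basis. ((y - p) \<bullet> e) *\<^sub>R g e p)) \<le>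
          \<delta> * (\<Sum>e\<in>Basis. \<bar>(y - p) \<bullet> e\<bar>)"
      proof (rule partial_increment_bound[OF _ _ _ _ y])
        show "((\<lambda>h. f (q + h *\<^sub>R e)) has_vector_derivative g e q) (at 0)"
          if "q \<in> ball p r" "e \<in> Basis" for q e
          using deriv[of q e] that r2 by (auto simp: r_def)
        show "norm (g e q - g e p) \<le> \<delta>" if "q \<in> ball p r" "e \<in> Basis" for q e
          using r1(2)[of q e] that by (auto simp: r_def dist_commute dist_norm[symmetric])
      qed auto
      also have "\<dots> \<le> \<delta> * (\<Sum>e\<in>(Basis::'a set). norm (y - p))"
        using \<delta> by (intro mult_left_mono sum_mono Basis_le_norm) auto
      also have "\<dots> = \<epsilon> * norm (y - p)" by (simp add: \<delta>_def)
      finally show ?thesis by (simp add: euclidean_representation)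
    qed
    then show "\<exists>d>0. \<forall>y. norm (y - p) < d \<longrightarrow>
        norm (f y - f p - (\<Sum>e\<in>Basis. ((y - p) \<bullet> e) *\<^sub>R g e p)) \<le> \<epsilon> * norm (y - p)"
      using r1 r2 by (intro exI[of _ r]) (auto simp: r_def)
  qed
qed

lemma smooth_on_compose_real:
  fixes q :: "'e::euclidean_space \<Rightarrow> real"
  assumes dom: "line_domain C A" and V: "open V" and q: "smooth_on (line ` Basis) V q"
    and f: "smooth_on C A f" and sub: "f ` A \<subseteq> V"
  shows "smooth_on C A (\<lambda>p. q (f p))"
proof -
  \<comment> \<open>The chain rule turns \<open>q o f\<close> into a sum of derivatives of
    \<open>q\<close> composed with \<open>f\<close>, multiplied by derivatives of \<open>f\<close>.
    Both kinds of factor belong to \<open>G\<close>, so the algebra is closed.\<close>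
  define G where "G = {(\<lambda>p. q (f p)) | q. smooth_on (line ` Basis) V q} \<union> {g :: _ \<Rightarrow> real. smooth_on C A g}"
  show ?thesis
  proof (rule smooth_on_gen_alg[OF dom, where G = G])
    show "continuous_on A g" if "g \<in> G" for g
      using that unfolding G_def
      by (auto dest: smooth_on_continuous
          intro: continuous_on_compose2[OF smooth_on_continuous smooth_on_continuous[OF f] sub])
  next
    fix g c assume "g \<in> G" and c: "c \<in> C"
    then consider "smooth_on C A g" | q :: "'e \<Rightarrow> real" where "smooth_on (line ` Basis) V q" "g = (\<lambda>p. q (f p))"
      unfolding G_def by blast
    then show "\<exists>g'. gen_alg G g' \<and> (\<forall>p\<in>A. has_pderiv A c g (g' p) p)"
    proof cases
      case 1
      then have "gen_alg G (pderiv_on A c g)"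
        using smooth_on_pderiv_on[OF 1 c] by (auto simp: G_def intro: gen_alg.gen)
      then show ?thesis using smooth_on_has_pderiv[OF 1 c]
        by (intro exI[of _ "pderiv_on A c g"]) simp
    next
      case (2 q)
      define g' where "g' p = (\<Sum>e\<in>Basis. (pderiv_on A c f p \<bullet> e) * pderiv_on V (line e) q (f p))" for p
      have fe: "smooth_on C A (\<lambda>p. pderiv_on A c f p \<bullet> e)" for e
        by (rule smooth_on_bounded_linear[OF dom bounded_linear_inner_left smooth_on_pderiv_on[OF f c]])
      have "smooth_on (line ` Basis) V (pderiv_on V (line e) q)" if "e \<in> Basis" for e
        using smooth_on_pderiv_on[OF 2(1)] that by blast
      then have "gen_alg G g'"
        unfolding g'_def by (intro gen_alg_sum gen_alg.mult gen_alg.gen) (use fe in \<open>auto simp: G_def\<close>)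
      moreover have "has_pderiv A c g (g' p) p" if p: "p \<in> A" for p
      proof -
        have c0: "c p 0 = p" using line_domainD[OF dom c p] by simp
        have "((\<lambda>h. f (c p h)) has_derivative (\<lambda>h. h *\<^sub>R pderiv_on A c f p)) (at 0 within {h. c p h \<in> A})"
          using smooth_on_has_pderiv[OF f c p] by (simp add: has_pderiv_def has_vector_derivative_def)
        moreover have "(q has_derivative (\<lambda>v. \<Sum>e\<in>Basis. (v \<bullet> e) *\<^sub>R pderiv_on V (line e) q (f p)))
            (at (f (c p 0)))"
          using smooth_on_has_derivative[OF V 2(1), of "f p"] p sub c0 by auto
        ultimately have "((\<lambda>h. q (f (c p h))) has_derivative
            (\<lambda>h. \<Sum>e\<in>Basis. ((h *\<^sub>R pderiv_on A c f p) \<bullet> e) *\<^sub>R pderiv_on V (line e) q (f p)))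
            (at 0 within {h. c p h \<in> A})"
          by (rule has_derivative_compose)
        then show ?thesis
          unfolding has_pderiv_def has_vector_derivative_def g'_def 2(2)
          by (simp add: sum_distrib_left mult.assoc)
      qed
      ultimately show ?thesis by (intro exI[of _ g']) simp
    qed
  next
    show "gen_alg G (\<lambda>p. q (f p))" using q by (auto simp: G_def intro: gen_alg.gen)
  qed
qed

lemma smooth_on_compose:
  fixes q :: "'e::euclidean_space \<Rightarrow> 'b::euclidean_space"
  assumes dom: "line_domain C A" and V: "open V" and q: "smooth_on (line ` Basis) V q"
    and f: "smooth_on C A f" and sub: "f ` A \<subseteq> V"
  shows "smooth_on C A (\<lambda>p. q (f p))"
  by (rule smooth_on_componentwise[OF dom], rule smooth_on_compose_real[OF dom V _ f sub])
     (rule smooth_on_bounded_linear[OF line_domain_line_open[OF V] bounded_linear_inner_left q])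

section \<open>The smooth inverse function theorem\<close>

lemma linear_basis_expansion:
  "linear T \<Longrightarrow> T x = (\<Sum>b\<in>Basis. (x \<bullet> b) *\<^sub>R T b)"
  by (metis (no_types, lifting) euclidean_representation linear_scale linear_sum sum.cong)

text \<open>A lower bound \<open>c * norm x \<le> norm (D0 x)\<close> persists with
  \<open>c / 2\<close> for all \<open>D h\<close> close to \<open>D0\<close>, so the inverses are
  eventually uniformly bounded; then \<open>M h (y h) - M0 y0\<close> is \<open>M h\<close> applied
  to \<open>y h - D h (M0 y0)\<close>, which tends to zero. The form with a filter and a moving
  argument serves both continuity and difference quotients.\<close>

lemma tendsto_inverse_apply:
  fixes D M :: "'h \<Rightarrow> 'k::euclidean_space \<Rightarrow> 'k"
  assumes lin: "\<forall>\<^sub>F h in F. linear (D h) \<and> (\<forall>x. M h (D h x) = x) \<and> (\<forall>x. D h (M h x) = x)"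
    and lin0: "linear D0" "\<And>x. M0 (D0 x) = x" "\<And>x. D0 (M0 x) = x"
    and D: "\<And>b. b \<in> Basis \<Longrightarrow> ((\<lambda>h. D h b) \<longlongrightarrow> D0 b) F" and y: "(y \<longlongrightarrow> y0) F"
  shows "((\<lambda>h. M h (y h)) \<longlongrightarrow> M0 y0) F"
proof -
  have "inj D0" using lin0(2) by (metis injI)
  then obtain c where c: "c > 0" "\<And>x. c * norm x \<le> norm (D0 x)"
    using linear_inj_bounded_below_pos[OF lin0(1)] by (metis mult.commute)
  define s where "s h = (\<Sum>b\<in>Basis. norm (D h b - D0 b))" for h
  have "(s \<longlongrightarrow> (\<Sum>b\<in>(Basis::'k set). norm (D0 b - D0 b))) F"
    unfolding s_def by (intro tendsto_intros D)
  then have "(s \<longlongrightarrow> 0) F" by simp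
  then have ev: "\<forall>\<^sub>F h in F. s h < c / 2"
    using c by (intro order_tendstoD) auto
  have Dz: "((\<lambda>h. D h z) \<longlongrightarrow> D0 z) F" for z
  proof -
    have "((\<lambda>h. \<Sum>b\<in>Basis. (z \<bullet> b) *\<^sub>R D h b) \<longlongrightarrow> (\<Sum>b\<in>Basis. (z \<bullet> b) *\<^sub>R D0 b)) F"
      by (intro tendsto_intros D)
    also have "(\<Sum>b\<in>Basis. (z \<bullet> b) *\<^sub>R D0 b) = D0 z"
      by (rule linear_basis_expansion[OF lin0(1), symmetric])
    finally show ?thesis
      by (rule Lim_transform_eventually)
         (use lin in eventually_elim, simp add: linear_basis_expansion[of "D _" z])
  qed
  have le: "\<forall>\<^sub>F h in F. norm (M h (y h) - M0 y0) \<le> (2 / c) * norm (y h - D h (M0 y0))"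
    using lin ev
  proof eventually_elim
    case (elim h)
    define x where "x = M h (y h) - M0 y0"
    have l: "linear (D h)" using elim by simp
    have "norm (D h x - D0 x) = norm (\<Sum>b\<in>Basis. (x \<bullet> b) *\<^sub>R (D h b - D0 b))"
    proof -
      have "D h x = (\<Sum>b\<in>Basis. (x \<bullet> b) *\<^sub>R D h b)" "D0 x = (\<Sum>b\<in>Basis. (x \<bullet> b) *\<^sub>R D0 b)"
        using linear_basis_expansion l lin0(1) by blast+
      then show ?thesis by (simp add: sum_subtractf scaleR_diff_right)
    qed
    also have "\<dots> \<le> (\<Sum>b\<in>Basis. norm x * norm (D h b - D0 b))"
      by (intro sum_norm_le) (auto intro!: mult_right_mono Basis_le_norm)
    also have "\<dots> = norm x * s h" by (simp add: s_def sum_distrib_left)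
    also have "\<dots> \<le> norm x * (c / 2)" using elim by (intro mult_left_mono) auto
    finally have "norm (D h x - D0 x) \<le> norm x * (c / 2)" .
    moreover have "norm (D0 x) \<le> norm (D h x) + norm (D h x - D0 x)"
      by (metis add.commute norm_minus_commute norm_triangle_sub)
    ultimately have "c / 2 * norm x \<le> norm (D h x)" using c(2)[of x] by (simp add: algebra_simps)
    moreover have Dx: "D h x = y h - D h (M0 y0)" using elim l by (simp add: x_def linear_diff)
    ultimately have "c / 2 * norm x \<le> norm (y h - D h (M0 y0))" by simp
    then show ?case using c(1) unfolding x_def[symmetric] by (simp add: field_simps)
  qed
  have "((\<lambda>h. (2 / c) * norm (y h - D h (M0 y0))) \<longlongrightarrow> (2 / c) * norm (y0 - D0 (M0 y0))) F"
    by (intro tendsto_intros y Dz)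
  then have "((\<lambda>h. (2 / c) * norm (y h - D h (M0 y0))) \<longlongrightarrow> 0) F" using lin0(3) by simp
  from Lim_null_comparison[OF le this] show ?thesis by (rule LIM_zero_cancel)
qed

lemma has_pderiv_quotient_tendsto:
  assumes "c p 0 = p" "has_pderiv A c f d p"
  shows "((\<lambda>h. (1 / h) *\<^sub>R (f (c p h) - f p)) \<longlongrightarrow> (d::'b::euclidean_space)) (at 0 within {h. c p h \<in> A})"
proof (subst tendsto_componentwise_iff, intro ballI)
  fix b :: 'b assume "b \<in> Basis"
  have "((\<lambda>h. f (c p h) \<bullet> b) has_vector_derivative d \<bullet> b) (at 0 within {h. c p h \<in> A})"
    using assms(2) unfolding has_pderiv_def
    by (rule bounded_linear.has_vector_derivative[OF bounded_linear_inner_left])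
  then have "((\<lambda>h. (f (c p h) \<bullet> b - f (c p 0) \<bullet> b) / (h - 0)) \<longlongrightarrow> d \<bullet> b) (at 0 within {h. c p h \<in> A})"
    unfolding has_real_derivative_iff_has_vector_derivative[symmetric] has_field_derivative_iff .
  then show "((\<lambda>h. ((1 / h) *\<^sub>R (f (c p h) - f p)) \<bullet> b) \<longlongrightarrow> d \<bullet> b) (at 0 within {h. c p h \<in> A})"
    by (simp add: assms(1) inner_diff_left divide_inverse mult.commute)
qed

text \<open>The derivative of an inverse is \<open>- M D' M\<close>, whose entries are products of
  entries of \<open>M\<close> and of the smooth \<open>D'\<close>. Thus the algebra generated by the
  entries of \<open>M\<close> and the smooth functions is closed under derivatives.\<close>

lemma smooth_on_inverse_apply:
  fixes D M :: "'p::topological_space \<Rightarrow> 'k::euclidean_space \<Rightarrow> 'k"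
  assumes dom: "line_domain C A"
    and lin: "\<And>p. p \<in> A \<Longrightarrow> linear (D p)"
    and inv: "\<And>p x. p \<in> A \<Longrightarrow> M p (D p x) = x" "\<And>p x. p \<in> A \<Longrightarrow> D p (M p x) = x"
    and D: "\<And>i. i \<in> Basis \<Longrightarrow> smooth_on C A (\<lambda>p. D p i)"
  shows "smooth_on C A (\<lambda>p. M p x \<bullet> e)"
proof -
  define G where "G = {(\<lambda>p. M p x \<bullet> e) | x e. True} \<union> {g :: _ \<Rightarrow> real. smooth_on C A g}"
  have linM: "linear (M p)" if p: "p \<in> A" for p
  proof
    show "M p (a + b) = M p a + M p b" for a b
      using inv(1)[OF p, of "M p a + M p b"] linear_add[OF lin[OF p]] inv(2)[OF p] by simp
    show "M p (r *\<^sub>R b) = r *\<^sub>R M p b" for r b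
      using inv(1)[OF p, of "r *\<^sub>R M p b"] linear_scale[OF lin[OF p]] inv(2)[OF p] by simp
  qed
  show ?thesis
  proof (rule smooth_on_gen_alg[OF dom, where G = G])
    fix g assume "g \<in> G"
    then consider x e where "g = (\<lambda>p. M p x \<bullet> e)" | "smooth_on C A g" unfolding G_def by blast
    then show "continuous_on A g"
    proof cases
      case (1 x e)
      have "((\<lambda>q. M q x) \<longlongrightarrow> M p x) (at p within A)" if p: "p \<in> A" for p
      proof (rule tendsto_inverse_apply[where D = D and ?D0.0 = "D p" and M = M and ?M0.0 = "M p" and y = "\<lambda>_. x" and ?y0.0 = x])
        show "\<forall>\<^sub>F q in at p within A. linear (D q) \<and> (\<forall>x. M q (D q x) = x) \<and> (\<forall>x. D q (M q x) = x)"
          using lin inv by (simp add: eventually_at_topological) blast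
        show "((\<lambda>h. D h b) \<longlongrightarrow> D p b) (at p within A)" if "b \<in> Basis" for b
          using smooth_on_continuous[OF D[OF that]] p by (simp add: continuous_on_def)
      qed (use lin inv p in auto)
      then show ?thesis unfolding 1 continuous_on_def by (auto intro: tendsto_inner)
    qed (rule smooth_on_continuous)
  next
    fix g c assume "g \<in> G" and c: "c \<in> C"
    then consider x e where "g = (\<lambda>p. M p x \<bullet> e)" | "smooth_on C A g" unfolding G_def by blast
    then show "\<exists>g'. gen_alg G g' \<and> (\<forall>p\<in>A. has_pderiv A c g (g' p) p)"
    proof cases
      case 2
      then have "gen_alg G (pderiv_on A c g)"
        using smooth_on_pderiv_on[OF 2 c] by (auto simp: G_def intro: gen_alg.gen)
      then show ?thesis using smooth_on_has_pderiv[OF 2 c]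
        by (intro exI[of _ "pderiv_on A c g"]) simp
    next
      case (1 x e)
      define D' where "D' i p = pderiv_on A c (\<lambda>p. D p i) p" for i p
      define g' where "g' p = - (\<Sum>i\<in>Basis. \<Sum>j\<in>Basis. (M p x \<bullet> i) * (D' i p \<bullet> j) * (M p j \<bullet> e))" for p
      have "smooth_on C A (\<lambda>p. D' i p \<bullet> j)" if "i \<in> Basis" for i j
        unfolding D'_def
        by (rule smooth_on_bounded_linear[OF dom bounded_linear_inner_left smooth_on_pderiv_on[OF D[OF that] c]])
      then have "gen_alg G g'"
        unfolding g'_def by (intro gen_alg_uminus gen_alg_sum gen_alg.mult gen_alg.gen) (auto simp: G_def)
      moreover have "has_pderiv A c g (g' p) p" if p: "p \<in> A" for p
      proof -
        have c0: "c p 0 = p" using line_domainD[OF dom c p] by simp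
        let ?F = "at 0 within {h. c p h \<in> A}"
        define z where "z = M p x"
        define d where "d = (\<Sum>i\<in>Basis. (z \<bullet> i) *\<^sub>R D' i p)"
        have Dd: "has_pderiv A c (\<lambda>p. D p i) (D' i p) p" if "i \<in> Basis" for i
          using smooth_on_has_pderiv[OF D[OF that] c p] by (simp add: D'_def)
        have ev: "\<forall>\<^sub>F h in ?F. c p h \<in> A \<and> h \<noteq> 0"
          by (simp add: eventually_at_filter)
        have "has_pderiv A c (\<lambda>q. \<Sum>i\<in>Basis. (z \<bullet> i) *\<^sub>R D q i) d p"
          unfolding d_def
          by (intro has_pderiv_sum has_pderiv_bounded_linear[OF bounded_linear_scaleR_right] Dd)
        then have "has_pderiv A c (\<lambda>q. D q z) d p"
          by (subst has_pderiv_cong[OF dom c p]) (rule linear_basis_expansion[OF lin])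
        from has_pderiv_quotient_tendsto[of c, OF c0 this]
        have q: "((\<lambda>h. (1 / h) *\<^sub>R (D (c p h) z - D p z)) \<longlongrightarrow> d) ?F" .
        have "((\<lambda>h. M (c p h) (- ((1 / h) *\<^sub>R (D (c p h) z - D p z)))) \<longlongrightarrow> M p (- d)) ?F"
        proof (rule tendsto_inverse_apply[where D = "\<lambda>h. D (c p h)" and ?D0.0 = "D p" and M = "\<lambda>h. M (c p h)" and ?M0.0 = "M p"])
          show "\<forall>\<^sub>F h in ?F. linear (D (c p h)) \<and> (\<forall>x. M (c p h) (D (c p h) x) = x) \<and> (\<forall>x. D (c p h) (M (c p h) x) = x)"
            using ev by eventually_elim (simp add: lin inv)
          show "((\<lambda>h. D (c p h) b) \<longlongrightarrow> D p b) ?F" if "b \<in> Basis" for b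
            using has_vector_derivative_continuous[OF Dd[OF that, unfolded has_pderiv_def]] c0
            by (simp add: continuous_within)
        qed (use lin inv p q in \<open>auto intro: tendsto_minus\<close>)
        then have "((\<lambda>h. M (c p h) (- ((1 / h) *\<^sub>R (D (c p h) z - D p z))) \<bullet> e) \<longlongrightarrow> M p (- d) \<bullet> e) ?F"
          by (intro tendsto_intros)
        then have "((\<lambda>h. (M (c p h) x \<bullet> e - M (c p 0) x \<bullet> e) / (h - 0)) \<longlongrightarrow> M p (- d) \<bullet> e) ?F"
        proof (rule Lim_transform_eventually)
          show "\<forall>\<^sub>F h in ?F. M (c p h) (- ((1 / h) *\<^sub>R (D (c p h) z - D p z))) \<bullet> e =
              (M (c p h) x \<bullet> e - M (c p 0) x \<bullet> e) / (h - 0)"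
            using ev
          proof eventually_elim
            case (elim h)
            then have l: "linear (M (c p h))" using linM by simp
            \<comment> \<open>Since \<open>D p z = x\<close>, the difference quotient of
              \<open>M x\<close> is \<open>M (c p h)\<close> applied to minus the difference
              quotient of \<open>D z\<close>. The latter converges, and
              \<open>tendsto_inverse_apply\<close> carries it through the moving inverse.\<close>
            have "M (c p h) (- ((1 / h) *\<^sub>R (D (c p h) z - D p z))) = (1/h) *\<^sub>R (M (c p h) x - z)"
              using elim inv p by (simp add: linear_neg[OF l] linear_scale[OF l] linear_diff[OF l] z_def scaleR_diff_right)
            then show ?case by (simp add: inner_diff_left c0 z_def diff_divide_distrib)
          qed
        qed
        moreover have "M p (- d) \<bullet> e = g' p"
        proof -
          have l: "linear (M p)" using linM[OF p] .
          have "M p (- d) = - (\<Sum>i\<in>Basis. (z \<bullet> i) *\<^sub>R M p (D' i p))"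
            by (simp add: d_def linear_neg[OF l] linear_sum[OF l] linear_scale[OF l])
          then show ?thesis
            by (simp add: g'_def z_def inner_sum_left linear_basis_expansion[OF l, of "D' _ p"] 
                sum_distrib_left mult.assoc)
        qed
        ultimately show ?thesis
          unfolding has_pderiv_def 1 has_real_derivative_iff_has_vector_derivative[symmetric] has_field_derivative_iff
          by simp
      qed
      ultimately show ?thesis by (intro exI[of _ g']) simp
    qed
  next
    show "gen_alg G (\<lambda>p. M p x \<bullet> e)" by (auto simp: G_def intro!: gen_alg.gen)
  qed
qed

lemma smooth_on_bounded_linear_line:
  fixes T :: "'a::euclidean_space \<Rightarrow> 'b::real_normed_vector"
  assumes "open W" "bounded_linear T"
  shows "smooth_on (line ` Basis) W T"
proof (rule smooth_on_coinduct[OF line_domain_line_open[OF assms(1)],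
      where P = "\<lambda>f. bounded_linear f \<or> (\<exists>k. f = (\<lambda>_. k))"])
  fix f :: "'a \<Rightarrow> 'b" assume "bounded_linear f \<or> (\<exists>k. f = (\<lambda>_. k))"
  then show "continuous_on W f" by (auto intro: linear_continuous_on)
next
  fix f :: "'a \<Rightarrow> 'b" and c :: "'a \<Rightarrow> real \<Rightarrow> 'a"
  assume f: "bounded_linear f \<or> (\<exists>k. f = (\<lambda>_. k))" and "c \<in> line ` Basis"
  then obtain e where c: "c = line e" by auto
  show "\<exists>g. (bounded_linear g \<or> (\<exists>k. g = (\<lambda>_. k))) \<and> (\<forall>p\<in>W. has_pderiv W c f (g p) p)"
  proof (cases "bounded_linear f")
    case True
    interpret bounded_linear f by (fact True)
    have "has_pderiv W c f (f e) p" for p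
      unfolding has_pderiv_def c line_def add scaleR by (auto intro!: derivative_eq_intros)
    then show ?thesis by (intro exI[of _ "\<lambda>_. f e"]) auto
  next
    case False
    then obtain k where "f = (\<lambda>_. k)" using f by auto
    then show ?thesis by (intro exI[of _ "\<lambda>_. 0"]) (auto simp: has_pderiv_const)
  qed
qed (use assms in auto)

text \<open>The expression occurring in \<open>param\<close> and \<open>tangent_space\<close>. It is
  linear in \<open>v\<close> for every \<open>\<psi>\<close>, and for smooth \<open>\<psi>\<close>
  on an open \<open>W\<close> it is the Frechet derivative.\<close>

definition dmap :: "'k::euclidean_space set \<Rightarrow> ('k \<Rightarrow> 'a::real_normed_vector) \<Rightarrow> 'k \<Rightarrow> 'k \<Rightarrow> 'a" where
  "dmap W \<psi> w v = (\<Sum>e\<in>Basis. (v \<bullet> e) *\<^sub>R pderiv_on W (line e) \<psi> w)"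

lemma smooth_on_has_derivative_dmap:
  assumes "open W" "smooth_on (line ` Basis) W f" "p \<in> W"
  shows "(f has_derivative dmap W f p) (at p)"
  using smooth_on_has_derivative[OF assms] by (simp add: dmap_def[abs_def])

lemma linear_dmap: "linear (dmap W \<psi> w)"
  unfolding dmap_def[abs_def]
  by (intro bounded_linear.linear bounded_linear_sum bounded_linear_scaleR_const bounded_linear_inner_left)

lemma dmap_Basis: "e \<in> Basis \<Longrightarrow> dmap W \<psi> w e = pderiv_on W (line e) \<psi> w"
proof -
  assume "e \<in> Basis"
  then have "dmap W \<psi> w e = (\<Sum>b\<in>Basis. if e = b then pderiv_on W (line b) \<psi> w else 0)"
    unfolding dmap_def by (intro sum.cong) (auto simp: inner_Basis)
  then show ?thesis using \<open>e \<in> Basis\<close> by simp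
qed

text \<open>The classical theorem supplies a differentiable local inverse with derivative the
  inverse of the differential of \<open>f\<close>; what has to be added is smoothness of
  \<open>g\<close>, a bootstrap through the smooth dependence of the inverse matrix on the
  point.\<close>

lemma smooth_inverse_function:
  fixes f :: "'k::euclidean_space \<Rightarrow> 'k"
  assumes W: "open W" "w0 \<in> W" and f: "smooth_on (line ` Basis) W f"
    and inj: "\<And>v. dmap W f w0 v = 0 \<Longrightarrow> v = 0"
  obtains W0 V g where "open W0" "W0 \<subseteq> W" "w0 \<in> W0" "open V" "homeomorphism W0 V f g"
    "smooth_on (line ` Basis) V g"
proof -
  define f' where "f' w = Blinfun (dmap W f w)" for w
  have f': "blinfun_apply (f' w) = dmap W f w" for w
    unfolding f'_def using linear_dmap linear_conv_bounded_linear by (blast intro: bounded_linear_Blinfun_apply)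
  have pd: "smooth_on (line ` Basis) W (\<lambda>w. dmap W f w e)" if "e \<in> Basis" for e
    using smooth_on_pderiv_on[OF f, of "line e"] that by (simp add: dmap_Basis)
  have "continuous_on W f'"
    by (rule continuous_on_blinfun_componentwise) (simp add: f' smooth_on_continuous[OF pd])
  moreover have "inj (dmap W f w0)"
    using inj linear_injective_0[OF linear_dmap] by blast
  then obtain D where D: "linear D" "\<And>x. D (dmap W f w0 x) = x"
    using linear_injective_left_inverse[OF linear_dmap] by (metis comp_apply id_apply)
  have "Blinfun D o\<^sub>L f' w0 = id_blinfun"
    using D by (intro blinfun_eqI) (simp add: f' bounded_linear_Blinfun_apply linear_conv_bounded_linear)
  ultimately obtain W0 V g g' where *: "open W0" "W0 \<subseteq> W" "w0 \<in> W0" "open V" "f w0 \<in> V" "homeomorphism W0 V f g"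
    "\<And>y. y \<in> V \<Longrightarrow> (g has_derivative (g' y)) (at y)"
    "\<And>y. y \<in> V \<Longrightarrow> g' y = inv (blinfun_apply (f'(g y)))"
    "\<And>y. y \<in> V \<Longrightarrow> bij (blinfun_apply (f'(g y)))"
    using inverse_function_theorem[OF W(1) _ _ W(2), of f f'] smooth_on_has_derivative_dmap[OF W(1) f]
    unfolding f' by metis
  have gV: "g y \<in> W0" if "y \<in> V" for y using *(6) that by (auto simp: homeomorphism_def)
  define M where "M w = inv (dmap W f w)" for w
  have bij: "bij (dmap W f w)" if "w \<in> W0" for w
    using *(9)[of "f w"] that *(6) by (simp add: homeomorphism_def f') blast
  have dom: "line_domain (line ` Basis) W0" by (rule line_domain_line_open[OF *(1)])
  have M: "smooth_on (line ` Basis) W0 (\<lambda>w. M w x \<bullet> e)" for x e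
  proof (rule smooth_on_inverse_apply[OF dom, where D = "dmap W f"])
    show "smooth_on (line ` Basis) W0 (\<lambda>p. dmap W f p i)" if "i \<in> Basis" for i
      by (rule smooth_on_subset[OF dom *(2) pd[OF that]])
  qed (use bij in \<open>auto simp: M_def linear_dmap bij_is_inj bij_is_surj surj_f_inv_f\<close>)
  \<comment> \<open>The class consists of the composites of smooth \<open>q\<close> with
    \<open>g\<close>: the derivative along \<open>e\<close> is again such a composite, with
    \<open>q'\<close> built from the derivatives of \<open>q\<close> and the inverse matrix
    \<open>M\<close>.\<close>
  let ?P = "\<lambda>h. \<exists>q :: 'k \<Rightarrow> real. smooth_on (line ` Basis) W0 q \<and> h = (\<lambda>y. q (g y))"
  have "smooth_on (line ` Basis) V (\<lambda>y. g y \<bullet> b)" for b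
  proof (rule smooth_on_coinduct[OF line_domain_line_open[OF *(4)], where P = ?P])
    show "?P (\<lambda>y. g y \<bullet> b)"
      using smooth_on_bounded_linear_line[OF *(1) bounded_linear_inner_left[of b]] by auto
  next
    fix h :: "'k \<Rightarrow> real" assume "?P h"
    then obtain q where q: "smooth_on (line ` Basis) W0 q" "h = (\<lambda>y. q (g y))" by blast
    have "continuous_on V g" using *(6) by (simp add: homeomorphism_def)
    then show "continuous_on V h"
      unfolding q(2) using continuous_on_compose2[OF smooth_on_continuous[OF q(1)]] gV by blast
  next
    fix h :: "'k \<Rightarrow> real" and c :: "'k \<Rightarrow> real \<Rightarrow> 'k" assume "?P h" "c \<in> line ` Basis"
    then obtain q :: "'k \<Rightarrow> real" and e :: 'k where q: "smooth_on (line ` Basis) W0 q" "h = (\<lambda>y. q (g y))"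
      and e: "e \<in> Basis" "c = line e" by blast
    define q' where "q' w = (\<Sum>k\<in>Basis. (M w e \<bullet> k) * pderiv_on W0 (line k) q w)" for w
    have "smooth_on (line ` Basis) W0 q'"
      unfolding q'_def
      by (rule smooth_on_gen_alg_smooth[OF dom], intro gen_alg_sum gen_alg.mult gen_alg.gen)
         (use M smooth_on_pderiv_on[OF q(1)] in auto)
    moreover have "has_pderiv V c h (q' (g y)) y" if y: "y \<in> V" for y
    proof -
      have g: "(g has_derivative M (g y)) (at y)" using *(7,8)[OF y] by (simp add: f' M_def)
      have lin: "linear (M (g y))" using has_derivative_linear[OF g] .
      have "(q has_derivative dmap W0 q (g y)) (at (g y))"
        by (rule smooth_on_has_derivative_dmap[OF *(1) q(1) gV[OF y]])
      from has_derivative_compose[OF g this]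
      have "(h has_derivative (\<lambda>v. dmap W0 q (g y) (M (g y) v))) (at (y + 0 *\<^sub>R e))"
        by (simp add: q(2))
      moreover have "((\<lambda>s::real. y + s *\<^sub>R e) has_derivative (\<lambda>s. s *\<^sub>R e)) (at 0)"
        by (auto intro!: derivative_eq_intros)
      ultimately have "((\<lambda>s. h (y + s *\<^sub>R e)) has_derivative (\<lambda>s. dmap W0 q (g y) (M (g y) (s *\<^sub>R e)))) (at 0)"
        using has_derivative_compose by fastforce
      then have "((\<lambda>s. h (y + s *\<^sub>R e)) has_vector_derivative q' (g y)) (at 0)"
        unfolding has_vector_derivative_def
        by (simp add: linear_scale[OF lin] linear_scale[OF linear_dmap] q'_def dmap_def sum_distrib_left mult.assoc)
      then show ?thesis
        unfolding has_pderiv_def e line_def by (rule has_vector_derivative_at_within)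
    qed
    ultimately show "\<exists>g. ?P g \<and> (\<forall>p\<in>V. has_pderiv V c h (g p) p)"
      by (intro exI[of _ "\<lambda>y. q' (g y)"] conjI ballI exI[of _ q']) simp_all
  qed
  then have "smooth_on (line ` Basis) V g"
    by (rule smooth_on_componentwise[OF line_domain_line_open[OF *(4)]])
  then show thesis using that[OF *(1-4,6)] by simp
qed

section \<open>Charts and tangent spaces\<close>

lemma line_domain_chart:
  fixes W :: "'k::euclidean_space set"
  assumes "chart_domain W"
  shows "line_domain (line ` Basis) W"
proof (cases "open W")
  case True
  then show ?thesis by (rule line_domain_line_open)
next
  case False
  then obtain e0 where e0: "e0 \<in> Basis" "openin (top_of_set {w. 0 \<le> w \<bullet> e0}) W"
    using assms unfolding chart_domain_def by blast
  then obtain T where T: "open T" "W = {w. 0 \<le> w \<bullet> e0} \<inter> T" unfolding openin_open by blast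
  show ?thesis unfolding line_domain_def
  proof (intro ballI conjI)
    fix c :: "'k \<Rightarrow> real \<Rightarrow> 'k" and p assume "c \<in> line ` Basis" and p: "p \<in> W"
    then obtain e where e: "e \<in> Basis" "c = line e" by blast
    show "c p 0 = p" by (simp add: e line_def)
    have "open {h::real. p + h *\<^sub>R e \<in> T}" by (rule open_line_vimage[OF T(1)])
    moreover have "0 \<in> {h::real. p + h *\<^sub>R e \<in> T}" using p T(2) by simp
    ultimately obtain r where r: "r > 0" "ball 0 r \<subseteq> {h::real. p + h *\<^sub>R e \<in> T}"
      by (rule openE)
    \<comment> \<open>Since \<open>e \<bullet> e0\<close> is 0 or 1, short steps in the positive
      direction never leave the half-space; this already makes the one-sided filter
      nontrivial.\<close>
    have "{0<..<r} \<subseteq> {h. c p h \<in> W}"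
    proof
      fix h assume h: "h \<in> {0<..<r}"
      then have "h \<in> ball 0 r" by (simp add: dist_norm)
      then have "p + h *\<^sub>R e \<in> T" using r(2) by blast
      moreover have "0 \<le> (p + h *\<^sub>R e) \<bullet> e0"
        using p T(2) h e e0 by (auto simp: inner_add_left inner_Basis)
      ultimately show "h \<in> {h. c p h \<in> W}" using T(2) by (simp add: e line_def)
    qed
    moreover have "(0::real) islimpt {0<..<r}" using islimpt_greaterThanLessThan1[OF r(1)] .
    ultimately show "at 0 within {h. c p h \<in> W} \<noteq> bot"
      using islimpt_subset by (metis trivial_limit_within)
  qed
qed

lemma paramD:
  assumes "param S W \<psi>"
  shows "chart_domain W" "smooth_on (line ` Basis) W \<psi>"
    "\<And>w v. w \<in> W \<Longrightarrow> dmap W \<psi> w v = 0 \<Longrightarrow> v = 0"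
    "openin (top_of_set S) (\<psi> ` W)"
    "\<exists>\<phi>. homeomorphism W (\<psi> ` W) \<psi> \<phi>" "\<psi> ` W \<subseteq> S"
proof -
  show "openin (top_of_set S) (\<psi> ` W)" using assms by (simp add: param_def)
  then show "\<psi> ` W \<subseteq> S" by (rule openin_imp_subset)
qed (use assms in \<open>auto simp: param_def dmap_def\<close>)

lemma dmap_bounded_linear:
  assumes W: "chart_domain W" "w \<in> W" and \<psi>: "smooth_on (line ` Basis) W \<psi>" and g: "bounded_linear g"
  shows "dmap W (\<lambda>w. g (\<psi> w)) w v = g (dmap W \<psi> w v)"
proof -
  have "pderiv_on W (line e) (\<lambda>w. g (\<psi> w)) w = g (pderiv_on W (line e) \<psi> w)" if "e \<in> Basis" for e
    using that line_domain_chart[OF W(1)] W(2)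
    by (intro has_pderiv_pderiv_on_eq[where C = "line ` Basis"] has_pderiv_bounded_linear[OF g] smooth_on_has_pderiv[OF \<psi>]) auto
  then show ?thesis
    using bounded_linear.linear[OF g] by (simp add: dmap_def linear_sum linear_scale)
qed

text \<open>The composite of \<open>g\<close> and \<open>\<psi>\<close> maps between spaces of equal
  dimension with injective differential at \<open>w0\<close>, so it has a smooth local inverse
  \<open>k\<close>. Then \<open>\<psi> o k\<close> is a section of \<open>g\<close>, which exhibits
  \<open>S\<close> near \<open>\<psi> w0\<close> as a graph over \<open>V\<close>.\<close>

lemma param_section:
  fixes \<psi> :: "'k::euclidean_space \<Rightarrow> 'a::euclidean_space"
  assumes \<psi>: "param S W \<psi>" and W: "open W" "w0 \<in> W"
    and g: "bounded_linear (g :: 'a \<Rightarrow> 'k)" and inj: "\<And>v. g (dmap W \<psi> w0 v) = 0 \<Longrightarrow> v = 0"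
  obtains V k where "open V" "g (\<psi> w0) \<in> V" "smooth_on (line ` Basis) V k" "k ` V \<subseteq> W"
    "\<And>u. u \<in> V \<Longrightarrow> g (\<psi> (k u)) = u" "k (g (\<psi> w0)) = w0"
    "openin (top_of_set S) ((\<lambda>u. \<psi> (k u)) ` V)"
proof -
  have sm: "smooth_on (line ` Basis) W (\<lambda>w. g (\<psi> w))"
    by (rule smooth_on_bounded_linear[OF line_domain_line_open[OF W(1)] g paramD(2)[OF \<psi>]])
  obtain W0 V k where *: "open W0" "W0 \<subseteq> W" "w0 \<in> W0" "open V"
    "homeomorphism W0 V (\<lambda>w. g (\<psi> w)) k" "smooth_on (line ` Basis) V k"
    using smooth_inverse_function[OF W sm] inj
      dmap_bounded_linear[OF paramD(1)[OF \<psi>] W(2) paramD(2)[OF \<psi>] g] by metis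
  have kV: "k ` V = W0" using *(5) by (simp add: homeomorphism_def)
  obtain \<phi> where \<phi>: "homeomorphism W (\<psi> ` W) \<psi> \<phi>" using paramD(5)[OF \<psi>] by blast
  have "openin (top_of_set (\<psi> ` W)) (\<psi> ` W0)"
    by (rule homeomorphism_imp_open_map[OF \<phi>]) (simp add: *(1,2) open_openin_trans[OF W(1)])
  then have "openin (top_of_set S) (\<psi> ` k ` V)"
    unfolding kV using paramD(4)[OF \<psi>] openin_trans by blast
  then have "openin (top_of_set S) ((\<lambda>u. \<psi> (k u)) ` V)" by (simp only: image_image)
  moreover have "g (\<psi> w0) \<in> V" "k (g (\<psi> w0)) = w0" "\<And>u. u \<in> V \<Longrightarrow> g (\<psi> (k u)) = u"
    using *(3,5) by (auto simp: homeomorphism_def)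
  ultimately show thesis using that[of V k] * kV by simp
qed

text \<open>A left inverse of \<open>G\<close> that is linear up to a constant forces the
  differential to be injective and supplies a continuous inverse of \<open>G\<close>. The constant
  \<open>c\<close> admits affine left inverses, as they occur on a slice
  \<open>t = t1\<close>.\<close>

lemma param_of_section:
  fixes G :: "'k::euclidean_space \<Rightarrow> 'a::euclidean_space"
  assumes V: "open V" and G: "smooth_on (line ` Basis) V G" and g: "bounded_linear g"
    and gG: "\<And>u. u \<in> V \<Longrightarrow> g (G u) = u + c" and op: "openin (top_of_set S) (G ` V)"
  shows "param S V G"
proof -
  have cV: "chart_domain V" using V by (simp add: chart_domain_def)
  have "g (dmap V G u v) = v" if u: "u \<in> V" for u v
  proof -
    have "(G has_derivative dmap V G u) (at u)" by (rule smooth_on_has_derivative_dmap[OF V G u])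
    then have "((\<lambda>u. g (G u)) has_derivative (\<lambda>v. g (dmap V G u v))) (at u)"
      by (rule bounded_linear.has_derivative[OF g])
    then have "((\<lambda>u. u + c) has_derivative (\<lambda>v. g (dmap V G u v))) (at u)"
      by (rule has_derivative_transform_within_open[OF _ V u gG])
    moreover have "((\<lambda>u. u + c) has_derivative (\<lambda>v. v)) (at u)"
      by (auto intro!: derivative_eq_intros)
    ultimately show ?thesis using has_derivative_unique by metis
  qed
  then have "v = 0" if "u \<in> V" "dmap V G u v = 0" for u v
    using that linear_0[OF bounded_linear.linear[OF g]] by metis
  moreover have "homeomorphism V (G ` V) G (\<lambda>x. g x - c)"
    using gG smooth_on_continuous[OF G] linear_continuous_on[OF g]
    by (auto simp: homeomorphism_def image_image intro!: continuous_on_diff)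
  ultimately show ?thesis
    unfolding param_def using cV G op by (auto simp: dmap_def)
qed

text \<open>A curve in \<open>S\<close> differentiable in the ambient space has no evident
  differentiable lift to \<open>W\<close>, as the inverse chart is only continuous. A linear left
  inverse \<open>g\<close> of the differential helps: near \<open>\<psi> w0\<close> the set is a
  graph over the image of \<open>g\<close>, so \<open>k (g (\<gamma> h))\<close> is a lift, and the
  chain rule applies.\<close>

lemma curve_velocity_in_range:
  fixes \<psi> :: "'k::euclidean_space \<Rightarrow> 'a::euclidean_space"
  assumes \<psi>: "param S W \<psi>" and W: "open W" "w0 \<in> W"
    and H: "0 \<in> H" "at 0 within H \<noteq> bot" and \<gamma>: "\<And>h. h \<in> H \<Longrightarrow> \<gamma> h \<in> S" "\<gamma> 0 = \<psi> w0"
    and u: "(\<gamma> has_vector_derivative u) (at 0 within H)"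
  shows "u \<in> range (dmap W \<psi> w0)"
proof -
  have "inj (dmap W \<psi> w0)"
    using paramD(3)[OF \<psi> W(2)] linear_injective_0[OF linear_dmap] by blast
  then obtain g where g: "linear g" "\<And>x. g (dmap W \<psi> w0 x) = x"
    using linear_injective_left_inverse[OF linear_dmap] by (metis comp_apply id_apply)
  then have bg: "bounded_linear g" by (simp add: linear_conv_bounded_linear)
  obtain V k where V: "open V" "g (\<psi> w0) \<in> V" and k: "smooth_on (line ` Basis) V k" "k ` V \<subseteq> W"
    and gk: "\<And>u. u \<in> V \<Longrightarrow> g (\<psi> (k u)) = u" "k (g (\<psi> w0)) = w0"
    and op: "openin (top_of_set S) ((\<lambda>u. \<psi> (k u)) ` V)"
    using param_section[OF \<psi> W bg] g(2) by metis
  obtain U where U: "open U" "(\<lambda>u. \<psi> (k u)) ` V = S \<inter> U" using op unfolding openin_open by blast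
  have eq: "\<gamma> h = \<psi> (k (g (\<gamma> h)))" if "\<gamma> h \<in> U" "h \<in> H" for h
  proof -
    have "\<gamma> h \<in> (\<lambda>u. \<psi> (k u)) ` V" using U(2) that \<gamma>(1) by blast
    then obtain x where "x \<in> V" "\<gamma> h = \<psi> (k x)" by blast
    then show ?thesis using gk(1) by simp
  qed
  have \<gamma>0: "\<gamma> 0 \<in> U" using V(2) U(2) gk(2) \<gamma>(2) by force
  have "((\<gamma>) \<longlongrightarrow> \<gamma> 0) (at 0 within H)"
    using has_vector_derivative_continuous[OF u] by (simp add: continuous_within)
  then have "\<forall>\<^sub>F h in at 0 within H. \<gamma> h \<in> U" using U(1) \<gamma>0 by (rule topological_tendstoD)
  then have ev: "\<forall>\<^sub>F h in at 0 within H. \<psi> (k (g (\<gamma> h))) = \<gamma> h"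
    using eq by (auto simp: eventually_at_filter elim: eventually_mono)
  have "((\<lambda>h. g (\<gamma> h)) has_derivative (\<lambda>s. g (s *\<^sub>R u))) (at 0 within H)"
    using u unfolding has_vector_derivative_def by (rule bounded_linear.has_derivative[OF bg])
  moreover have "(k has_derivative dmap V k (g (\<gamma> 0))) (at (g (\<gamma> 0)))"
    using smooth_on_has_derivative_dmap[OF V(1) k(1)] V(2) \<gamma>(2) by simp
  ultimately have "((\<lambda>h. k (g (\<gamma> h))) has_derivative (\<lambda>s. dmap V k (g (\<gamma> 0)) (g (s *\<^sub>R u)))) (at 0 within H)"
    by (rule has_derivative_compose)
  moreover have "(\<psi> has_derivative dmap W \<psi> w0) (at (k (g (\<gamma> 0))))"
    using smooth_on_has_derivative_dmap[OF W(1) paramD(2)[OF \<psi>] W(2)] gk(2) \<gamma>(2) by simp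
  ultimately have "((\<lambda>h. \<psi> (k (g (\<gamma> h)))) has_derivative
      (\<lambda>s. dmap W \<psi> w0 (dmap V k (g (\<gamma> 0)) (g (s *\<^sub>R u))))) (at 0 within H)"
    by (rule has_derivative_compose)
  then have "(\<gamma> has_derivative (\<lambda>s. dmap W \<psi> w0 (dmap V k (g (\<gamma> 0)) (g (s *\<^sub>R u))))) (at 0 within H)"
    by (rule has_derivative_transform_eventually[OF _ ev _ H(1)]) (use eq[OF \<gamma>0 H(1)] in simp)
  then have "(\<gamma> has_vector_derivative dmap W \<psi> w0 (dmap V k (g (\<gamma> 0)) (g u))) (at 0 within H)"
    unfolding has_vector_derivative_def
    by (simp add: linear_scale[OF g(1)] linear_scale[OF linear_dmap])
  then have "u = dmap W \<psi> w0 (dmap V k (g (\<gamma> 0)) (g u))"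
    by (rule vector_derivative_unique_within[OF H(2) u])
  then show ?thesis by blast
qed

lemma subspace_range_dmap: "subspace (range (dmap W \<psi> w))"
  using linear_subspace_image[OF linear_dmap subspace_UNIV] .

text \<open>The columns of a differential are velocities of coordinate lines, one-sided ones for a
  boundary chart, so the comparison reduces to curves. Allowing \<open>S' \<subseteq> S\<close>
  compares boundary charts of \<open>L\<close> with interior charts of its double.\<close>

lemma dmap_in_range:
  fixes \<psi> :: "'k::euclidean_space \<Rightarrow> 'a::euclidean_space"
  assumes \<psi>: "param S W \<psi>" "open W" "w0 \<in> W" and sub: "S' \<subseteq> S"
    and \<psi>': "param S' W' \<psi>'" "w' \<in> W'" "\<psi>' w' = \<psi> w0"
  shows "range (dmap W' \<psi>' w') \<subseteq> range (dmap W \<psi> w0)"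
proof -
  have dom: "line_domain (line ` Basis) W'" by (rule line_domain_chart[OF paramD(1)[OF \<psi>'(1)]])
  have *: "pderiv_on W' (line e) \<psi>' w' \<in> range (dmap W \<psi> w0)" if e: "e \<in> Basis" for e
  proof (rule curve_velocity_in_range[OF \<psi>])
    show "0 \<in> {h. line e w' h \<in> W'}" using \<psi>'(2) by (simp add: line_def)
    show "at 0 within {h. line e w' h \<in> W'} \<noteq> bot"
      using line_domainD(2)[OF dom _ \<psi>'(2)] e by blast
    show "\<psi>' (line e w' h) \<in> S" if "h \<in> {h. line e w' h \<in> W'}" for h
      using that paramD(6)[OF \<psi>'(1)] sub by blast
    show "\<psi>' (line e w' 0) = \<psi> w0" using \<psi>'(3) by (simp add: line_def)
    show "((\<lambda>h. \<psi>' (line e w' h)) has_vector_derivative pderiv_on W' (line e) \<psi>' w')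
        (at 0 within {h. line e w' h \<in> W'})"
      using smooth_on_has_pderiv[OF paramD(2)[OF \<psi>'(1)] _ \<psi>'(2)] e by (simp add: has_pderiv_def)
  qed
  show ?thesis
  proof
    fix u assume "u \<in> range (dmap W' \<psi>' w')"
    then obtain v where "u = dmap W' \<psi>' w' v" by blast
    then show "u \<in> range (dmap W \<psi> w0)"
      unfolding dmap_def[of W'] by (auto intro!: subspace_sum subspace_mul subspace_range_dmap *)
  qed
qed

lemma range_dmap_subset_tangent_space:
  fixes \<psi> :: "'k::euclidean_space \<Rightarrow> 'a::euclidean_space"
  assumes "param S W \<psi>" "w \<in> W"
  shows "range (dmap W \<psi> w) \<subseteq> tangent_space TYPE('k) S (\<psi> w)"
  using assms unfolding tangent_space_def dmap_def by blast

lemma tangent_space_subset_range_dmap: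
  fixes \<psi> :: "'k::euclidean_space \<Rightarrow> 'a::euclidean_space"
  assumes \<psi>: "param S W \<psi>" "open W" "w \<in> W" and sub: "S' \<subseteq> S"
  shows "tangent_space TYPE('k) S' (\<psi> w) \<subseteq> range (dmap W \<psi> w)"
proof
  fix u assume "u \<in> tangent_space TYPE('k) S' (\<psi> w)"
  then obtain W' \<psi>' w' v where *: "param S' W' (\<psi>' :: 'k \<Rightarrow> 'a)" "w' \<in> W'" "\<psi>' w' = \<psi> w"
    "u = dmap W' \<psi>' w' v"
    unfolding tangent_space_def dmap_def by blast
  then show "u \<in> range (dmap W \<psi> w)" using dmap_in_range[OF \<psi> sub *(1-3)] by blast
qed

lemma tangent_space_eq_range_dmap:
  fixes \<psi> :: "'k::euclidean_space \<Rightarrow> 'a::euclidean_space"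
  assumes "param S W \<psi>" "open W" "w \<in> W"
  shows "tangent_space TYPE('k) S (\<psi> w) = range (dmap W \<psi> w)"
  using range_dmap_subset_tangent_space[OF assms(1,3)]
    tangent_space_subset_range_dmap[OF assms order_refl] by blast

section \<open>Legendrian ends of a Lagrangian\<close>

text \<open>\<open>\<Lambda>\<close> is a rescaled copy of the slice \<open>t = t1\<close>. The ray
  through a point of the slice is transverse to it, so the slice is a submanifold of one dimension
  less; pairing the velocity of the ray with a tangent vector \<open>(0, dx, dz, t1 dy)\<close> of
  the slice gives \<open>dz - y \<bullet> dx\<close>, which vanishes by isotropy.\<close>

lemma legendrian_of_cylinder:
  fixes L :: "(real \<times> (real ^ 'm::finite) \<times> real \<times> (real ^ 'm)) set"
  assumes lag: "lagrangian UNIV L" and I: "open I" "t1 \<in> I" "I \<subseteq> {0<..}"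
    and cyl: "\<And>t x T X. t \<in> I \<Longrightarrow> (t, x, T, X) \<in> L \<longleftrightarrow> (x, (1 / t) *\<^sub>R X, T) \<in> \<Lambda>"
  shows "legendrian UNIV \<Lambda>"
proof -
  have t1: "t1 > 0" using I by auto
  have submfd: "submanifold_with_boundary TYPE(real \<times> (real ^ 'm)) L {}"
  proof -
    obtain B where B: "\<forall>(t, x, T, X)\<in>B. x \<in> frontier UNIV"
      "submanifold_with_boundary TYPE(real \<times> (real ^ 'm)) L B"
      using lag unfolding lagrangian_def by blast
    have "B = {}" using B(1) by auto
    then show ?thesis using B(2) by simp
  qed
  have main: "\<exists>V \<Psi>. open V \<and> param \<Lambda> V (\<Psi> :: real ^ 'm \<Rightarrow> _) \<and> (x, y, z) \<in> \<Psi> ` V \<and>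
      (\<forall>(dx, dy, dz)\<in>tangent_space TYPE(real ^ 'm) \<Lambda> (x, y, z). dz - y \<bullet> dx = 0)"
    if xyz: "(x, y, z) \<in> \<Lambda>" for x y z
  proof -
    define p where "p = (t1, x, z, t1 *\<^sub>R y)"
    have pL: "p \<in> L" using cyl[OF I(2)] xyz t1 by (simp add: p_def)
    obtain W and \<psi> :: "real \<times> (real ^ 'm) \<Rightarrow> _" and w0 where
      W: "open W" "w0 \<in> W" and \<psi>: "param L W \<psi>" "p = \<psi> w0"
      using submfd pL unfolding submanifold_with_boundary_def by blast
    let ?T = "range (dmap W \<psi> w0)"
    \<comment> \<open>The ray \<open>t \<mapsto> (t, x, z, t y)\<close> stays in \<open>L\<close>
      for \<open>t\<close> in \<open>I\<close>, so its velocity is tangent to \<open>L\<close>. This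
      is where an open interval of times is used.\<close>
    have "((\<lambda>h. (t1 + h, x, z, (t1 + h) *\<^sub>R y)) has_vector_derivative (1, 0, 0, y)) (at 0 within {h. t1 + h \<in> I})"
      by (auto intro!: derivative_eq_intros has_vector_derivative_Pair)
    moreover have "open {h. t1 + h \<in> I}"
      using open_line_vimage[OF I(1), of t1 1] by simp
    ultimately have reeb: "(1, 0, 0, y) \<in> ?T"
      by (intro curve_velocity_in_range[OF \<psi>(1) W, where H = "{h. t1 + h \<in> I}"])
         (use I xyz \<psi>(2)[symmetric] in \<open>auto simp: p_def cyl at_within_open_neq_bot\<close>)
    define T0 where "T0 = {v \<in> ?T. fst v = 0}"
    have T0: "subspace T0"
    proof -
      have "subspace {v. fst v = (0::real)}" by (auto simp: subspace_def)
      from subspace_inter[OF subspace_range_dmap this] show ?thesis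
        by (simp add: T0_def Int_def)
    qed
    have "dim T0 < dim ?T"
    proof (rule ccontr)
      assume "\<not> dim T0 < dim ?T"
      then have "T0 = ?T"
        by (intro subspace_dim_equal[OF T0 subspace_range_dmap]) (auto simp: T0_def)
      then have "(1, 0, 0, y) \<in> T0" using reeb by simp
      then show False by (simp add: T0_def)
    qed
    also have "dim ?T \<le> DIM(real \<times> (real ^ 'm))"
      using dim_image_le[OF linear_dmap, of W \<psi> w0 UNIV] by (simp add: dim_UNIV)
    finally have "dim T0 \<le> dim (UNIV :: (real ^ 'm) set)" by (simp add: dim_UNIV)
    \<comment> \<open>The tangent vectors without time component omit the velocity of the ray, so
      \<open>T0\<close> has dimension at most that of \<open>real ^ 'm\<close>. An isometric
      embedding of \<open>T0\<close>, joined with the time, is injective on the whole tangent space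
      and gives graph coordinates \<open>g\<close> adapted to the slice.\<close>
    then obtain lam :: "_ \<Rightarrow> real ^ 'm" where lam: "linear lam" "\<And>v. v \<in> T0 \<Longrightarrow> norm (lam v) = norm v"
      using isometry_subset_subspace[OF T0 subspace_UNIV] by metis
    have blam: "bounded_linear lam" using lam(1) by (simp add: linear_conv_bounded_linear)
    define g where "g q = (fst q, lam q)" for q
    have g: "bounded_linear g"
      unfolding g_def by (intro bounded_linear_Pair bounded_linear_fst blam)
    have g_inj: "v = 0" if "g (dmap W \<psi> w0 v) = 0" for v
    proof -
      have "dmap W \<psi> w0 v \<in> T0" "lam (dmap W \<psi> w0 v) = 0"
        using that by (auto simp: T0_def g_def prod_eq_iff)
      then have "dmap W \<psi> w0 v = 0" using lam(2) by fastforce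
      then show ?thesis using paramD(3)[OF \<psi>(1) W(2)] by blast
    qed
    obtain V k where V: "open V" "g p \<in> V" and k: "smooth_on (line ` Basis) V k" "k ` V \<subseteq> W"
      and gk: "\<And>u. u \<in> V \<Longrightarrow> g (\<psi> (k u)) = u" "k (g p) = w0"
      and op: "openin (top_of_set L) ((\<lambda>u. \<psi> (k u)) ` V)"
      using param_section[OF \<psi>(1) W g g_inj] \<psi>(2) by metis
    define G where "G u = \<psi> (k u)" for u
    have sG: "smooth_on (line ` Basis) V G"
      unfolding G_def by (rule smooth_on_compose[OF line_domain_line_open[OF V(1)] W(1) paramD(2)[OF \<psi>(1)] k])
    have pG: "param L V G"
      by (rule param_of_section[OF V(1) sG g, where c = 0]) (use gk op in \<open>auto simp: G_def\<close>)
    obtain U where U: "open U" "G ` V = L \<inter> U" using op unfolding openin_open G_def by blast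
    define P :: "real \<times> (real ^ 'm) \<times> real \<times> (real ^ 'm) \<Rightarrow> (real ^ 'm) \<times> (real ^ 'm) \<times> real" where "P = (\<lambda>(t::real, x, T, X). (x, (1 / t1) *\<^sub>R X, T))"
    define J :: "(real ^ 'm) \<times> (real ^ 'm) \<times> real \<Rightarrow> real \<times> (real ^ 'm) \<times> real \<times> (real ^ 'm)" where "J = (\<lambda>(x, y, z). (t1, x, z, t1 *\<^sub>R y))"
    have P: "bounded_linear P"
      unfolding P_def case_prod_unfold
      by (intro bounded_linear_Pair bounded_linear_const_scaleR bounded_linear_fst_comp
          bounded_linear_snd_comp bounded_linear_ident bounded_linear_zero)
    have PJ: "P (J q) = q" for q using t1 by (simp add: P_def J_def split: prod.splits)
    have JP: "J (P q) = q" if "fst q = t1" for q using t1 that by (auto simp: P_def J_def split: prod.splits)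
    have J\<Lambda>: "J q \<in> L \<longleftrightarrow> q \<in> \<Lambda>" for q
      using cyl[OF I(2)] t1 by (simp add: J_def split: prod.splits)
    define V1 where "V1 = {b. (t1, b) \<in> V}"
    have V1: "open V1" unfolding V1_def
      using open_vimage[OF V(1), of "\<lambda>b. (t1, b)"] by (simp add: vimage_def continuous_intros)
    define \<Psi> where "\<Psi> b = P (G (t1, b))" for b
    have fG: "fst (G (t1, b)) = t1" "lam (G (t1, b)) = b" if "b \<in> V1" for b
      using gk(1)[of "(t1, b)"] that by (simp_all add: V1_def g_def G_def)
    have dom1: "line_domain (line ` Basis) V1" by (rule line_domain_line_open[OF V1])
    have s\<Psi>: "smooth_on (line ` Basis) V1 \<Psi>"
      unfolding \<Psi>_def
    proof (rule smooth_on_bounded_linear[OF dom1 P], rule smooth_on_pullback[OF dom1 _ _ sG])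
      fix c :: "real ^ 'm \<Rightarrow> real \<Rightarrow> real ^ 'm" assume "c \<in> line ` Basis"
      then obtain e where e: "e \<in> Basis" "c = line e" by blast
      have "line (0::real, e) \<in> line ` Basis" using e by (intro imageI) (simp add: Basis_prod_def)
      moreover have "(t1, c b h) = line (0, e) (t1, b) h" for b h by (simp add: e line_def)
      ultimately show "(\<exists>c'\<in>line ` Basis. \<forall>b\<in>V1. \<forall>h. c b h \<in> V1 \<longrightarrow> (t1, c b h) = c' (t1, b) h) \<or>
          (\<forall>b\<in>V1. \<forall>h. c b h \<in> V1 \<longrightarrow> (t1, c b h) = (t1, b))" by blast
    qed (auto simp: V1_def intro!: continuous_intros)
    \<comment> \<open>The linear part of the affine inclusion \<open>J\<close> of the slice;
      \<open>lam o J0\<close> then inverts \<open>\<Psi>\<close> up to a constant.\<close>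
    define J0 :: "(real ^ 'm) \<times> (real ^ 'm) \<times> real \<Rightarrow> real \<times> (real ^ 'm) \<times> real \<times> (real ^ 'm)" where "J0 = (\<lambda>(x, y, z). (0::real, x, z, t1 *\<^sub>R y))"
    have J0: "bounded_linear J0"
      unfolding J0_def case_prod_unfold
      by (intro bounded_linear_Pair bounded_linear_const_scaleR bounded_linear_fst_comp
          bounded_linear_snd_comp bounded_linear_ident bounded_linear_zero)
    have JJ0: "J q = J0 q + (t1, 0, 0, 0)" for q by (simp add: J_def J0_def split: prod.splits)
    have img: "\<Psi> ` V1 = \<Lambda> \<inter> J -` U"
    proof (intro equalityI subsetI)
      fix q assume "q \<in> \<Psi> ` V1"
      then obtain b where b: "b \<in> V1" "q = \<Psi> b" by blast
      then have "J q = G (t1, b)" using JP[OF fG(1)] by (simp add: \<Psi>_def)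
      moreover have "G (t1, b) \<in> L \<inter> U" using b U(2) by (auto simp: V1_def)
      ultimately show "q \<in> \<Lambda> \<inter> J -` U" using J\<Lambda>[of q] by simp
    next
      fix q assume "q \<in> \<Lambda> \<inter> J -` U"
      then have "J q \<in> G ` V" using J\<Lambda>[of q] U(2) by auto
      then obtain u where u: "u \<in> V" "J q = G u" by blast
      then have "fst u = fst (J q)" using gk(1)[OF u(1)] by (simp add: G_def g_def prod_eq_iff)
      then have "u = (t1, snd u)" by (simp add: J_def prod_eq_iff split: prod.splits)
      then show "q \<in> \<Psi> ` V1"
        using u PJ[of q] unfolding \<Psi>_def V1_def by (metis (mono_tags, lifting) imageI mem_Collect_eq)
    qed
    have "continuous_on UNIV J"
      unfolding J_def case_prod_unfold by (intro continuous_intros)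
    then have "open (J -` U)" by (rule open_vimage[OF U(1)])
    then have op\<Psi>: "openin (top_of_set \<Lambda>) (\<Psi> ` V1)" unfolding img by (simp add: openin_open_Int)
    have p\<Psi>: "param \<Lambda> V1 \<Psi>"
    proof (rule param_of_section[OF V1 s\<Psi> bounded_linear_compose[OF blam J0] _ op\<Psi>])
      show "lam (J0 (\<Psi> b)) = b + (- lam (t1, 0, 0, 0))" if b: "b \<in> V1" for b
      proof -
        have "b = lam (J (\<Psi> b))" using fG[OF b] JP[OF fG(1)[OF b]] by (simp add: \<Psi>_def)
        then have "b = lam (J0 (\<Psi> b)) + lam (t1, 0, 0, 0)" by (simp add: JJ0 linear_add[OF lam(1)])
        from arg_cong[OF this, of "\<lambda>v. v - lam (t1, 0, 0, 0)"] show ?thesis by simp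
      qed
    qed
    define b0 where "b0 = lam p"
    have gp: "g p = (t1, b0)" by (simp add: g_def b0_def p_def)
    have b0: "b0 \<in> V1" using V(2) by (simp add: V1_def gp)
    have Gp: "G (t1, b0) = p" using gk(2) \<psi>(2) by (simp add: G_def gp[symmetric])
    have \<Psi>b0: "\<Psi> b0 = (x, y, z)" using t1 by (simp add: \<Psi>_def Gp p_def P_def)
    have "dz - y \<bullet> dx = 0" if "(dx, dy, dz) \<in> tangent_space TYPE(real ^ 'm) \<Lambda> (x, y, z)" for dx dy dz
    proof -
      have "(dx, dy, dz) \<in> range (dmap V1 \<Psi> b0)"
        using that tangent_space_eq_range_dmap[OF p\<Psi> V1 b0] unfolding \<Psi>b0 by simp
      then obtain v where v: "(dx, dy, dz) = dmap V1 \<Psi> b0 v" by blast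
      define q where "q = dmap V G (t1, b0) (0, v)"
      have G': "(G has_derivative dmap V G (t1, b0)) (at (t1, b0))"
        using smooth_on_has_derivative_dmap[OF V(1) sG] b0 by (simp add: V1_def)
      have "((\<lambda>b. (t1, b)) has_derivative (\<lambda>v. (0, v))) (at b0)"
        by (auto intro!: derivative_eq_intros)
      from has_derivative_compose[OF this G']
      have Gb: "((\<lambda>b. G (t1, b)) has_derivative (\<lambda>v. dmap V G (t1, b0) (0, v))) (at b0)" .
      then have "(\<Psi> has_derivative (\<lambda>v. P (dmap V G (t1, b0) (0, v)))) (at b0)"
        unfolding \<Psi>_def by (rule bounded_linear.has_derivative[OF P])
      then have Pq: "P q = (dx, dy, dz)"
        unfolding v q_def
        using has_derivative_unique[OF smooth_on_has_derivative_dmap[OF V1 s\<Psi> b0]] by metis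
      \<comment> \<open>The time is constant on the slice, so \<open>q\<close> has no time component
        and is determined by its projection \<open>P q\<close>.\<close>
      have "((\<lambda>b. fst (G (t1, b))) has_derivative (\<lambda>v. fst (dmap V G (t1, b0) (0, v)))) (at b0)"
        by (rule has_derivative_fst[OF Gb])
      then have "((\<lambda>b. t1) has_derivative (\<lambda>v. fst (dmap V G (t1, b0) (0, v)))) (at b0)"
        by (rule has_derivative_transform_within_open[OF _ V1 b0]) (simp add: fG)
      then have fq: "fst q = 0"
        unfolding q_def using has_derivative_unique[OF has_derivative_const] by metis
      have q: "q = (0, dx, dz, t1 *\<^sub>R dy)"
        using Pq fq t1 by (cases q) (auto simp: P_def)
      have TL: "tangent_space TYPE(real \<times> (real ^ 'm)) L p = ?T"
        using tangent_space_eq_range_dmap[OF \<psi>(1) W] by (simp add: \<psi>(2))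
      have "(t1, b0) \<in> V" using b0 by (simp add: V1_def)
      from range_dmap_subset_tangent_space[OF pG this]
      have "q \<in> tangent_space TYPE(real \<times> (real ^ 'm)) L p" unfolding Gp q_def by blast
      moreover have "(1, 0, 0, y) \<in> tangent_space TYPE(real \<times> (real ^ 'm)) L p"
        using reeb unfolding TL .
      ultimately have "symp (1, 0, 0, y) q = 0"
        using lag[unfolded lagrangian_def, THEN conjunct2, THEN conjunct2, rule_format, OF pL] by simp
      then show ?thesis by (simp add: q inner_commute)
    qed
    moreover have "(x, y, z) \<in> \<Psi> ` V1" using b0 \<Psi>b0 by (metis imageI)
    ultimately show ?thesis
      using V1 p\<Psi> by (intro exI[of _ V1] exI[of _ \<Psi>]) auto
  qed
  have "submanifold_with_boundary TYPE(real ^ 'm) \<Lambda> {}"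
    unfolding submanifold_with_boundary_def
  proof (intro conjI ballI)
    fix q assume "q \<in> \<Lambda> - {}"
    then show "\<exists>W (\<psi> :: real ^ 'm \<Rightarrow> _). open W \<and> param \<Lambda> W \<psi> \<and> q \<in> \<psi> ` W"
      using main[of "fst q" "fst (snd q)" "snd (snd q)"] by (metis Diff_empty prod.collapse)
  qed auto
  then show ?thesis
    unfolding legendrian_def using main by fastforce
qed

section \<open>Even families\<close>

definition fam_lines :: "nat \<Rightarrow> ('a::euclidean_space \<times> (nat \<Rightarrow> real) \<Rightarrow> real \<Rightarrow> 'a \<times> (nat \<Rightarrow> real)) set" where
  "fam_lines N = base_line ` Basis \<union> fibre_line ` {..<N}"

lemma base_line_mem: "snd p \<in> fibre N \<Longrightarrow> base_line e p h \<in> D \<times> fibre N \<longleftrightarrow> line e (fst p) h \<in> D"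
  by (simp add: base_line_def line_def)

lemma fibre_line_mem: "j < N \<Longrightarrow> p \<in> D \<times> fibre N \<Longrightarrow> fibre_line j p h \<in> D \<times> fibre N"
  by (auto simp: fibre_line_def fibre_def)

lemma fam_linesE:
  assumes "c \<in> fam_lines N"
  obtains e where "e \<in> Basis" "c = base_line e" | j where "j < N" "c = fibre_line j"
  using assms by (auto simp: fam_lines_def)

lemma line_domain_fam_lines:
  fixes D :: "'a::euclidean_space set"
  assumes D: "line_domain (line ` Basis) D"
  shows "line_domain (fam_lines N) (D \<times> fibre N)"
  unfolding line_domain_def
proof (intro ballI)
  fix c :: "'a \<times> (nat \<Rightarrow> real) \<Rightarrow> real \<Rightarrow> 'a \<times> (nat \<Rightarrow> real)" and p
  assume c: "c \<in> fam_lines N" and p: "p \<in> D \<times> fibre N"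
  from c show "c p 0 = p \<and> at 0 within {h. c p h \<in> D \<times> fibre N} \<noteq> bot"
  proof (cases rule: fam_linesE)
    case (1 e)
    have "{h. base_line e p h \<in> D \<times> fibre N} = {h. line e (fst p) h \<in> D}"
      by (intro Collect_cong base_line_mem) (use p in auto)
    then show ?thesis
      using line_domainD(2)[OF D, of "line e" "fst p"] 1 p by (auto simp: base_line_def)
  next
    case (2 j)
    then have "{h. fibre_line j p h \<in> D \<times> fibre N} = UNIV"
      using fibre_line_mem[OF 2(1) p] by auto
    then show ?thesis using 2 by (simp add: fibre_line_def)
  qed
qed

lemma line_domain_family:
  fixes D :: "'a::euclidean_space set"
  shows "open D \<Longrightarrow> line_domain (fam_lines N) (D \<times> fibre N)"
  by (intro line_domain_fam_lines line_domain_line_open)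

lemma smooth_family_iff: "smooth_family D N f \<longleftrightarrow> smooth_on (fam_lines N) (D \<times> fibre N) f"
  by (simp add: smooth_family_def fam_lines_def)

lemma fam_lines_add:
  assumes "c \<in> fam_lines N"
  shows "c (c p h) k = c p (h + k)"
  using assms
  by (cases rule: fam_linesE) (auto simp: base_line_def fibre_line_def algebra_simps)

lemma fam_lines_continuous:
  assumes "c \<in> fam_lines N"
  shows "continuous_on UNIV (c p)"
  using assms
proof (cases rule: fam_linesE)
  case (1 e)
  have "base_line e p = (\<lambda>h. (fst p + h *\<^sub>R e, snd p))" by (auto simp: base_line_def)
  then show ?thesis unfolding 1 by (auto intro!: continuous_intros)
next
  case (2 j)
  have "fibre_line j p = (\<lambda>h. (fst p, \<lambda>i. if i = j then snd p j + h else snd p i))"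
    by (auto simp: fibre_line_def fun_eq_iff)
  moreover have "continuous_on UNIV (\<lambda>h. if i = j then snd p j + h else snd p i)" for i
    by (cases "i = j") (auto intro!: continuous_intros)
  ultimately show ?thesis unfolding 2
    by (auto intro!: continuous_on_Pair continuous_on_const continuous_on_coordinatewise_then_product)
qed

section \<open>Scaling and reflecting one base coordinate\<close>

definition scale_coord :: "'a::euclidean_space \<Rightarrow> real \<Rightarrow> 'a \<times> 'f \<Rightarrow> 'a \<times> 'f" where
  "scale_coord b \<tau> p = (fst p + ((\<tau> - 1) * (fst p \<bullet> b)) *\<^sub>R b, snd p)"

text \<open>\<open>scale_coord b (-1)\<close> is the reflection \<open>x\<^sub>b \<mapsto> -x\<^sub>b\<close>.\<close>

definition line_weight ::
  "'a::euclidean_space \<Rightarrow> ('a \<times> (nat \<Rightarrow> real) \<Rightarrow> real \<Rightarrow> 'a \<times> (nat \<Rightarrow> real)) \<Rightarrow> nat \<Rightarrow> bool" where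
  "line_weight b c n \<longleftrightarrow> (\<forall>\<tau> p h. scale_coord b \<tau> (c p h) = c (scale_coord b \<tau> p) (\<tau> ^ n * h))"

text \<open>The weight tells which power of \<tau> the scaling contributes to the speed along a
  coordinate line: 1 along \<open>b\<close> itself, 0 along all others. It lets Hadamard's integral
  and the parity of derivatives be treated for all directions at once.\<close>

lemma line_weight_base_same: "b \<in> Basis \<Longrightarrow> line_weight b (base_line b) 1"
  by (auto simp: line_weight_def scale_coord_def base_line_def algebra_simps)

lemma line_weight_base_other: "b \<in> Basis \<Longrightarrow> e \<in> Basis \<Longrightarrow> e \<noteq> b \<Longrightarrow> line_weight b (base_line e) 0"
  by (auto simp: line_weight_def scale_coord_def base_line_def algebra_simps inner_Basis)

lemma line_weight_fibre: "line_weight b (fibre_line j) 0"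
  by (auto simp: line_weight_def scale_coord_def fibre_line_def)

lemma line_weight_exists:
  assumes "b \<in> Basis" "c \<in> fam_lines N"
  shows "\<exists>n. line_weight b c n"
  using assms(2)
  by (cases rule: fam_linesE)
     (use assms(1) line_weight_base_same line_weight_base_other line_weight_fibre in metis)+

lemma scale_coord_scale_coord:
  "b \<in> Basis \<Longrightarrow> scale_coord b \<sigma> (scale_coord b \<tau> p) = scale_coord b (\<sigma> * \<tau>) p"
  by (simp add: scale_coord_def inner_add_left add.assoc scaleR_add_left[symmetric])
     (simp add: algebra_simps)

lemma scale_coord_1 [simp]: "scale_coord b 1 p = p"
  by (simp add: scale_coord_def)

text \<open>Convexity together with invariance under the reflection keeps the segment from a point
  to its mirror image inside \<open>D\<close>, as Hadamard's integral requires. Openness makes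
  derivatives two-sided.\<close>

definition reflectible :: "'a::euclidean_space \<Rightarrow> 'a set \<Rightarrow> bool" where
  "reflectible b D \<longleftrightarrow> b \<in> Basis \<and> open D \<and> convex D \<and> (\<forall>x\<in>D. x - (2 * (x \<bullet> b)) *\<^sub>R b \<in> D)"

text \<open>The scaled point is the convex combination of \<open>p\<close> and its mirror image with
  weights \<open>(1 + \<tau>) / 2\<close> and \<open>(1 - \<tau>) / 2\<close>.\<close>

lemma scale_coord_mem:
  assumes D: "reflectible b D" and p: "p \<in> D \<times> F" and \<tau>: "-1 \<le> \<tau>" "\<tau> \<le> 1"
  shows "scale_coord b \<tau> p \<in> D \<times> F"
proof -
  have "((1 + \<tau>) / 2) *\<^sub>R fst p + ((1 - \<tau>) / 2) *\<^sub>R (fst p - (2 * (fst p \<bullet> b)) *\<^sub>R b) \<in> D"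
    using D p \<tau> unfolding reflectible_def by (intro convexD) (auto simp: field_simps)
  also have "((1 + \<tau>) / 2) *\<^sub>R fst p + ((1 - \<tau>) / 2) *\<^sub>R (fst p - (2 * (fst p \<bullet> b)) *\<^sub>R b)
      = (((1 + \<tau>) / 2) + ((1 - \<tau>) / 2)) *\<^sub>R fst p + (- ((1 - \<tau>) / 2) * (2 * (fst p \<bullet> b))) *\<^sub>R b"
    by (simp only: scaleR_add_left scaleR_diff_right scaleR_scaleR algebra_simps) simp
  also have "\<dots> = fst p + ((\<tau> - 1) * (fst p \<bullet> b)) *\<^sub>R b"
  proof -
    have "(1 + \<tau>) / 2 + (1 - \<tau>) / 2 = 1" "- ((1 - \<tau>) / 2) * (2 * (fst p \<bullet> b)) = (\<tau> - 1) * (fst p \<bullet> b)"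
      by (simp_all add: field_simps)
    then show ?thesis by simp
  qed
  finally show ?thesis using p by (auto simp: scale_coord_def)
qed

lemma continuous_scale_coord:
  fixes b :: "'a::euclidean_space"
  shows "continuous_on X (\<lambda>(p :: 'a \<times> (nat \<Rightarrow> real), \<tau>). scale_coord b \<tau> p)"
  unfolding scale_coord_def case_prod_unfold
  by (intro continuous_intros)

text \<open>The scaling turns a coordinate line into a line of the same direction run through at
  speed \<open>\<tau> ^ n\<close>. Values \<tau> between 0 and 1 are used under the integral sign,
  and \<tau> = -1 for parity.\<close>

lemma has_vector_derivative_scale_line:
  fixes q :: "'a::euclidean_space \<times> (nat \<Rightarrow> real) \<Rightarrow> real"
  assumes D: "reflectible b D" and q: "smooth_on (fam_lines N) (D \<times> fibre N) q"
    and c: "c \<in> fam_lines N" "line_weight b c n"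
    and h: "c p h \<in> D \<times> fibre N" and \<tau>: "-1 \<le> \<tau>" "\<tau> \<le> 1"
  shows "((\<lambda>h. q (scale_coord b \<tau> (c p h))) has_vector_derivative
      \<tau> ^ n * pderiv_on (D \<times> fibre N) c q (scale_coord b \<tau> (c p h)))
      (at h within {h. c p h \<in> D \<times> fibre N})"
proof -
  let ?A = "D \<times> fibre N" and ?U = "{h. c p h \<in> D \<times> fibre N}"
  let ?r = "scale_coord b \<tau> (c p h)"
  have r: "?r \<in> ?A" by (rule scale_coord_mem[OF D h \<tau>])
  have eq: "scale_coord b \<tau> (c p k) = c ?r (\<tau> ^ n * (k - h))" for k
    using c(2) fam_lines_add[OF c(1), of p h "k - h"] unfolding line_weight_def
    by (metis add_diff_cancel_left' diff_add_cancel add.commute)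
  have sub: "(\<lambda>k. \<tau> ^ n * (k - h)) ` ?U \<subseteq> {k. c ?r k \<in> ?A}"
  proof (rule image_subsetI, simp only: mem_Collect_eq)
    fix k assume "c p k \<in> ?A"
    then show "c ?r (\<tau> ^ n * (k - h)) \<in> ?A"
      using scale_coord_mem[OF D _ \<tau>] eq[of k] by metis
  qed
  have "((\<lambda>k. \<tau> ^ n * (k - h)) has_vector_derivative \<tau> ^ n) (at h within ?U)"
    by (auto intro!: derivative_eq_intros)
  moreover have "((\<lambda>k. q (c ?r k)) has_vector_derivative pderiv_on ?A c q ?r)
      (at (\<tau> ^ n * (h - h)) within (\<lambda>k. \<tau> ^ n * (k - h)) ` ?U)"
    using smooth_on_has_pderiv[OF q c(1) r] has_vector_derivative_within_subset[OF _ sub]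
    unfolding has_pderiv_def by simp
  ultimately have "((\<lambda>k. q (c ?r k)) \<circ> (\<lambda>k. \<tau> ^ n * (k - h)) has_vector_derivative
      \<tau> ^ n *\<^sub>R pderiv_on ?A c q ?r) (at h within ?U)"
    by (rule vector_diff_chain_within)
  then show ?thesis by (simp only: o_def eq[symmetric] real_scaleR_def)
qed

text \<open>Hadamard's quotient \<open>k / x\<^sub>b = \<integral>\<^sub>0\<^sup>1 (\<partial>\<^sub>b k)(\<dots>, \<tau> x\<^sub>b, \<dots>) d\<tau>\<close>, applied below to \<open>q = \<partial>\<^sub>b k\<close>.\<close>

lemma smooth_family_scale_integral:
  fixes q :: "'a::euclidean_space \<times> (nat \<Rightarrow> real) \<Rightarrow> real"
  assumes D: "reflectible b D" and q: "smooth_on (fam_lines N) (D \<times> fibre N) q"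
  shows "smooth_on (fam_lines N) (D \<times> fibre N) (\<lambda>p. integral (cbox 0 1) (\<lambda>\<tau>. q (scale_coord b \<tau> p)))"
proof -
  let ?A = "D \<times> fibre N"
  \<comment> \<open>Each derivative along \<open>b\<close> brings out a factor \<tau>, so integrals
    weighted with all powers of \<tau> are needed for a closed class; the integral in question has
    \<open>j = 0\<close>.\<close>
  let ?I = "\<lambda>j q p. integral (cbox 0 1) (\<lambda>\<tau>. \<tau> ^ j * q (scale_coord b \<tau> p)) :: real"
  let ?P = "\<lambda>f. \<exists>j q. smooth_on (fam_lines N) ?A q \<and> f = ?I j q"
  have dom: "line_domain (fam_lines N) ?A"
    using D by (intro line_domain_family) (simp add: reflectible_def)
  have cont: "continuous_on (?A \<times> cbox 0 1) (\<lambda>(p, \<tau>). \<tau> ^ j * q (scale_coord b \<tau> p))"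
    if "continuous_on ?A q" for q :: "'a \<times> (nat \<Rightarrow> real) \<Rightarrow> real" and j
  proof -
    have "continuous_on (?A \<times> cbox 0 1) (\<lambda>z. q (case z of (p, \<tau>) \<Rightarrow> scale_coord b \<tau> p))"
    proof (rule continuous_on_compose2[OF that continuous_scale_coord], rule image_subsetI)
      fix z :: "('a \<times> (nat \<Rightarrow> real)) \<times> real" assume "z \<in> ?A \<times> cbox 0 1"
      then have "fst z \<in> ?A" "-1 \<le> snd z" "snd z \<le> 1" by auto
      then show "(case z of (p, \<tau>) \<Rightarrow> scale_coord b \<tau> p) \<in> ?A"
        unfolding case_prod_unfold by (rule scale_coord_mem[OF D])
    qed
    then have "continuous_on (?A \<times> cbox 0 1) (\<lambda>z. snd z ^ j * q (scale_coord b (snd z) (fst z)))"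
      by (intro continuous_intros) (simp add: case_prod_unfold)
    then show ?thesis by (simp add: case_prod_unfold)
  qed
  have "smooth_on (fam_lines N) ?A (?I 0 q)"
  proof (rule smooth_on_coinduct[OF dom, where P = ?P])
    show "?P (?I 0 q)" using q by blast
  next
    fix f assume "?P f"
    then obtain j q where q: "smooth_on (fam_lines N) ?A q" "f = ?I j q" by blast
    show "continuous_on ?A f"
      unfolding q(2) by (rule integral_continuous_on_param[OF cont[OF smooth_on_continuous[OF q(1)]]])
  next
    fix f and c :: "'a \<times> (nat \<Rightarrow> real) \<Rightarrow> real \<Rightarrow> 'a \<times> (nat \<Rightarrow> real)"
    assume "?P f" and c: "c \<in> fam_lines N"
    then obtain j q where q: "smooth_on (fam_lines N) ?A q" "f = ?I j q" by blast
    obtain n where n: "line_weight b c n"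
      using line_weight_exists[OF _ c] D unfolding reflectible_def by blast
    let ?q' = "pderiv_on ?A c q"
    have q': "smooth_on (fam_lines N) ?A ?q'" by (rule smooth_on_pderiv_on[OF q(1) c])
    have "has_pderiv ?A c f (?I (j + n) ?q' p) p" if p: "p \<in> ?A" for p
    proof -
      let ?U = "{h. c p h \<in> ?A}"
      have c0: "c p 0 = p" using line_domainD(1)[OF dom c p] .
      have cc: "continuous_on ?U (c p)" using fam_lines_continuous[OF c] continuous_on_subset by blast
      have "((\<lambda>h. integral (cbox 0 1) (\<lambda>\<tau>. \<tau> ^ j * q (scale_coord b \<tau> (c p h)))) has_vector_derivative
          integral (cbox 0 1) (\<lambda>\<tau>. \<tau> ^ (j + n) * ?q' (scale_coord b \<tau> (c p 0)))) (at 0 within ?U)"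
      proof (rule leibniz_rule_vector_derivative)
        fix h \<tau> :: real assume h: "h \<in> ?U" and \<tau>: "\<tau> \<in> cbox 0 1"
        have "((\<lambda>h. q (scale_coord b \<tau> (c p h))) has_vector_derivative
            \<tau> ^ n * ?q' (scale_coord b \<tau> (c p h))) (at h within ?U)"
          by (rule has_vector_derivative_scale_line[OF D q(1) c n]) (use h \<tau> in auto)
        then have "((\<lambda>h. \<tau> ^ j * q (scale_coord b \<tau> (c p h))) has_vector_derivative
            \<tau> ^ j * (\<tau> ^ n * ?q' (scale_coord b \<tau> (c p h)))) (at h within ?U)"
          by (rule bounded_linear.has_vector_derivative[OF bounded_linear_mult_right])
        then show "((\<lambda>h. \<tau> ^ j * q (scale_coord b \<tau> (c p h))) has_vector_derivative
            \<tau> ^ (j + n) * ?q' (scale_coord b \<tau> (c p h))) (at h within ?U)"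
          by (simp add: power_add mult.assoc)
      next
        fix h assume h: "h \<in> ?U"
        have "continuous_on (cbox 0 1) (\<lambda>\<tau>. case (c p h, \<tau>) of (p, \<tau>) \<Rightarrow> \<tau> ^ j * q (scale_coord b \<tau> p))"
          by (rule continuous_on_compose2[OF cont[OF smooth_on_continuous[OF q(1)]]])
             (use h in \<open>auto intro!: continuous_intros\<close>)
        then show "(\<lambda>\<tau>. \<tau> ^ j * q (scale_coord b \<tau> (c p h))) integrable_on cbox 0 1"
          by (intro integrable_continuous) simp
      next
        have "continuous_on (?U \<times> cbox 0 1)
            (\<lambda>z. case (c p (fst z), snd z) of (p, \<tau>) \<Rightarrow> \<tau> ^ (j + n) * ?q' (scale_coord b \<tau> p))"
          by (rule continuous_on_compose2[OF cont[OF smooth_on_continuous[OF q']]])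
             (auto intro!: continuous_on_Pair continuous_on_compose2[OF cc] continuous_on_fst continuous_on_snd continuous_on_id)
        then show "continuous_on (?U \<times> cbox 0 1) (\<lambda>(h, \<tau>). \<tau> ^ (j + n) * ?q' (scale_coord b \<tau> (c p h)))"
          by (simp add: case_prod_unfold)
      next
        show "0 \<in> ?U" using c0 p by simp
        \<comment> \<open>Differentiation under the integral sign asks for a convex set of
          parameters; here it is a linear preimage of a translate of \<open>D\<close>, or everything
          for a fibre line.\<close>
        have cD: "convex D" using D by (simp add: reflectible_def)
        from c show "convex ?U"
        proof (cases rule: fam_linesE)
          case (1 e)
          have "?U = {h. fst p + h *\<^sub>R e \<in> D}"
            unfolding 1 line_def[symmetric] by (intro Collect_cong base_line_mem) (use p in auto)
          also have "\<dots> = (\<lambda>h. h *\<^sub>R e) -` ((\<lambda>x. x - fst p) ` D)"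
            by (force simp: image_iff algebra_simps)
          also have "convex \<dots>"
            by (intro convex_linear_vimage linear_scaleR_left convex_translation_subtract cD)
          finally show ?thesis .
        next
          case (2 i)
          then have "?U = UNIV" using fibre_line_mem[OF 2(1) p] by auto
          then show ?thesis by simp
        qed
      qed
      then show ?thesis unfolding has_pderiv_def q(2) by (simp only: c0)
    qed
    then show "\<exists>g. ?P g \<and> (\<forall>p\<in>?A. has_pderiv ?A c f (g p) p)"
      using q' by (intro exI[of _ "?I (j + n) ?q'"] conjI exI[of _ "j + n"] exI[of _ ?q']) auto
  qed
  then show ?thesis by simp
qed

text \<open>The fundamental theorem of calculus for \<tau> \<mapsto>
  \<open>k (scale_coord b \<tau> p)\<close> on the unit interval: the chain rule brings out the
  factor \<open>fst p \<bullet> b\<close>, and at \<tau> = 0 the value of \<open>k\<close> is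
  zero.\<close>

lemma scale_integral_eq:
  fixes k :: "'a::euclidean_space \<times> (nat \<Rightarrow> real) \<Rightarrow> real"
  assumes D: "reflectible b D" and k: "smooth_on (fam_lines N) (D \<times> fibre N) k"
    and zero: "\<And>p. p \<in> D \<times> fibre N \<Longrightarrow> fst p \<bullet> b = 0 \<Longrightarrow> k p = 0" and p: "p \<in> D \<times> fibre N"
  shows "(fst p \<bullet> b) * integral (cbox 0 1)
      (\<lambda>\<tau>. pderiv_on (D \<times> fibre N) (base_line b) k (scale_coord b \<tau> p)) = k p"
proof -
  let ?A = "D \<times> fibre N"
  let ?k' = "pderiv_on ?A (base_line b) k" and ?s = "fst p \<bullet> b"
  have b: "b \<in> Basis" using D by (simp add: reflectible_def)
  then have c: "base_line b \<in> fam_lines N" by (simp add: fam_lines_def)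
  have "((\<lambda>\<tau>. ?s * ?k' (scale_coord b \<tau> p)) has_integral
      (k (scale_coord b 1 p) - k (scale_coord b 0 p))) {0..1}"
  proof (rule fundamental_theorem_of_calculus)
    fix \<tau> :: real assume \<tau>: "\<tau> \<in> {0..1}"
    let ?r = "scale_coord b \<tau> p"
    have eq: "scale_coord b \<sigma> p = base_line b ?r ((\<sigma> - \<tau>) * ?s)" for \<sigma>
      by (simp add: scale_coord_def base_line_def algebra_simps)
    have sub: "(\<lambda>\<sigma>. (\<sigma> - \<tau>) * ?s) ` {0..1} \<subseteq> {h. base_line b ?r h \<in> ?A}"
    proof (rule image_subsetI, simp only: mem_Collect_eq)
      fix \<sigma> :: real assume "\<sigma> \<in> {0..1}"
      then show "base_line b ?r ((\<sigma> - \<tau>) * ?s) \<in> ?A"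
        using scale_coord_mem[OF D p, of \<sigma>] eq[of \<sigma>] by simp
    qed
    have r: "?r \<in> ?A" by (rule scale_coord_mem[OF D p]) (use \<tau> in auto)
    have "((\<lambda>\<sigma>. (\<sigma> - \<tau>) * ?s) has_vector_derivative ?s) (at \<tau> within {0..1})"
      by (auto intro!: derivative_eq_intros)
    moreover have "((\<lambda>h. k (base_line b ?r h)) has_vector_derivative ?k' ?r)
        (at ((\<tau> - \<tau>) * ?s) within (\<lambda>\<sigma>. (\<sigma> - \<tau>) * ?s) ` {0..1})"
      using smooth_on_has_pderiv[OF k c r] has_vector_derivative_within_subset[OF _ sub]
      unfolding has_pderiv_def by simp
    ultimately have "((\<lambda>h. k (base_line b ?r h)) \<circ> (\<lambda>\<sigma>. (\<sigma> - \<tau>) * ?s) has_vector_derivative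
        ?s *\<^sub>R ?k' ?r) (at \<tau> within {0..1})"
      by (rule vector_diff_chain_within)
    then show "((\<lambda>\<sigma>. k (scale_coord b \<sigma> p)) has_vector_derivative ?s * ?k' ?r) (at \<tau> within {0..1})"
      by (simp only: o_def eq[symmetric] real_scaleR_def)
  qed simp
  moreover have "k (scale_coord b 0 p) = 0"
    using b by (intro zero scale_coord_mem[OF D p]) (auto simp: scale_coord_def algebra_simps)
  ultimately have "((\<lambda>\<tau>. ?s * ?k' (scale_coord b \<tau> p)) has_integral k p) {0..1}" by simp
  from integral_unique[OF this] show ?thesis by (simp add: integral_mult_right)
qed

section \<open>Even and odd families\<close>

definition parity_family ::
  "nat \<Rightarrow> 'a::euclidean_space \<Rightarrow> 'a set \<Rightarrow> nat \<Rightarrow> ('a \<times> (nat \<Rightarrow> real) \<Rightarrow> real) \<Rightarrow> bool" where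
  "parity_family m b D N f \<longleftrightarrow> smooth_on (fam_lines N) (D \<times> fibre N) f \<and>
    (\<forall>p\<in>D \<times> fibre N. f (scale_coord b (-1) p) = (-1) ^ m * f p)"

text \<open>Differentiating the symmetry of \<open>f\<close> along \<open>c\<close> produces the
  factor \<open>(-1) ^ n\<close> by which the reflection changes the speed. Only the parity of the
  exponent matters, but as a natural number it simply adds the weight of the line.\<close>

lemma parity_family_pderiv:
  fixes f :: "'a::euclidean_space \<times> (nat \<Rightarrow> real) \<Rightarrow> real"
  assumes D: "reflectible b D" and f: "parity_family m b D N f"
    and c: "c \<in> fam_lines N" "line_weight b c n"
  shows "parity_family (m + n) b D N (pderiv_on (D \<times> fibre N) c f)"
  unfolding parity_family_def
proof (intro conjI ballI)
  let ?A = "D \<times> fibre N"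
  have sf: "smooth_on (fam_lines N) ?A f" using f by (simp add: parity_family_def)
  then show "smooth_on (fam_lines N) ?A (pderiv_on ?A c f)" using smooth_on_pderiv_on c(1) by blast
  fix p assume p: "p \<in> ?A"
  have dom: "line_domain (fam_lines N) ?A"
    using D by (intro line_domain_family) (simp add: reflectible_def)
  have c0: "c p 0 = p" using line_domainD(1)[OF dom c(1) p] .
  have "((\<lambda>h. f (scale_coord b (-1) (c p h))) has_vector_derivative
      (-1) ^ n * pderiv_on ?A c f (scale_coord b (-1) (c p 0))) (at 0 within {h. c p h \<in> ?A})"
    by (rule has_vector_derivative_scale_line[OF D sf c]) (use p c0 in auto)
  then have "((\<lambda>h. (-1) ^ m * f (c p h)) has_vector_derivative
      (-1) ^ n * pderiv_on ?A c f (scale_coord b (-1) p)) (at 0 within {h. c p h \<in> ?A})"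
    unfolding c0
    by (rule has_vector_derivative_transform[rotated 2]) (use f p c0 in \<open>auto simp: parity_family_def\<close>)
  then have "has_pderiv ?A c (\<lambda>p. (-1) ^ m * f p) ((-1) ^ n * pderiv_on ?A c f (scale_coord b (-1) p)) p"
    by (simp add: has_pderiv_def)
  moreover have "has_pderiv ?A c (\<lambda>p. (-1) ^ m * f p) ((-1) ^ m * pderiv_on ?A c f p) p"
    by (rule has_pderiv_bounded_linear[OF bounded_linear_mult_right smooth_on_has_pderiv[OF sf c(1) p]])
  ultimately have "(-1) ^ n * pderiv_on ?A c f (scale_coord b (-1) p) = (-1) ^ m * pderiv_on ?A c f p"
    using has_pderiv_pderiv_on_eq[OF dom c(1) p] by metis
  moreover have "(-1) ^ n * (-1) ^ n = (1::real)" by (simp add: power_mult_distrib[symmetric])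
  moreover have "x = (v * u) * y" if "u * x = v * y" "u * u = 1" for u v x y :: real
    using that by algebra
  ultimately show "pderiv_on ?A c f (scale_coord b (-1) p) = (-1) ^ (m + n) * pderiv_on ?A c f p"
    unfolding power_add by blast
qed

lemma odd_family_zero:
  assumes "parity_family 1 b D N f" "p \<in> D \<times> fibre N" "fst p \<bullet> b = 0"
  shows "f p = 0"
proof -
  have "scale_coord b (-1) p = p" using assms(3) by (simp add: scale_coord_def)
  moreover have "f (scale_coord b (-1) p) = (-1) ^ 1 * f p"
    using assms(1)[unfolded parity_family_def, THEN conjunct2] assms(2) by (rule bspec)
  ultimately show ?thesis by simp
qed

text \<open>An odd \<open>k\<close> vanishes on the hyperplane, so Hadamard's formula applies; its
  derivative along \<open>b\<close> is even, hence so is the average of that derivative over the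
  scalings.\<close>

lemma odd_family_quotient:
  fixes k :: "'a::euclidean_space \<times> (nat \<Rightarrow> real) \<Rightarrow> real"
  assumes D: "reflectible b D" and k: "parity_family 1 b D N k"
  obtains h where "parity_family 0 b D N h" "\<And>p. p \<in> D \<times> fibre N \<Longrightarrow> (fst p \<bullet> b) * h p = k p"
proof
  let ?A = "D \<times> fibre N"
  let ?k' = "pderiv_on ?A (base_line b) k"
  let ?h = "\<lambda>p. integral (cbox 0 1) (\<lambda>\<tau>. ?k' (scale_coord b \<tau> p))"
  have b: "b \<in> Basis" using D by (simp add: reflectible_def)
  have k': "parity_family (1 + 1) b D N ?k'"
    by (rule parity_family_pderiv[OF D k _ line_weight_base_same[OF b]]) (simp add: fam_lines_def b)
  show "parity_family 0 b D N ?h"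
    unfolding parity_family_def
  proof (intro conjI ballI)
    show "smooth_on (fam_lines N) ?A ?h"
      using smooth_family_scale_integral[OF D] k' unfolding parity_family_def by blast
    fix p assume p: "p \<in> ?A"
    have "?k' (scale_coord b \<tau> (scale_coord b (-1) p)) = ?k' (scale_coord b \<tau> p)" if "\<tau> \<in> cbox 0 1" for \<tau>
    proof -
      have "scale_coord b \<tau> (scale_coord b (-1) p) = scale_coord b (-1) (scale_coord b \<tau> p)"
        using b by (simp add: scale_coord_scale_coord)
      moreover have "scale_coord b \<tau> p \<in> ?A" using that by (intro scale_coord_mem[OF D p]) auto
      ultimately show ?thesis
        using k'[unfolded parity_family_def, THEN conjunct2, THEN bspec, of "scale_coord b \<tau> p"] by simp
    qed
    then show "?h (scale_coord b (-1) p) = (-1) ^ 0 * ?h p"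
      by (auto intro!: integral_cong)
  qed
  show "(fst p \<bullet> b) * ?h p = k p" if "p \<in> ?A" for p
    by (rule scale_integral_eq[OF D _ odd_family_zero[OF k] that])
       (use k in \<open>simp_all add: parity_family_def\<close>)
qed

section \<open>Spinning even families\<close>

definition spin_radius :: "'n::finite \<Rightarrow> real ^ ('n option) \<Rightarrow> real" where
  "spin_radius l x = sqrt ((x $ Some l)\<^sup>2 + (x $ None)\<^sup>2)"

definition unspin :: "'n::finite \<Rightarrow> real ^ ('n option) \<Rightarrow> real ^ 'n" where
  "unspin l x = (\<chi> j. if j = l then spin_radius l x else x $ Some j)"

definition unspin_pt ::
  "'n::finite \<Rightarrow> (real \<times> (real ^ ('n option))) \<times> 'f \<Rightarrow> (real \<times> (real ^ 'n)) \<times> 'f" where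
  "unspin_pt l p = ((fst (fst p), unspin l (snd (fst p))), snd p)"

text \<open>The basis vector of the coordinate \<open>x_l\<close>, which takes the place of
  \<open>b\<close> in the results on even and odd families.\<close>

definition spin_axis :: "'n::finite \<Rightarrow> real \<times> (real ^ 'n)" where
  "spin_axis l = (0, axis l 1)"

definition spin_base :: "'n::finite \<Rightarrow> (real \<times> (real ^ 'n)) set \<Rightarrow> (real \<times> (real ^ ('n option))) set" where
  "spin_base l D = {q. (fst q, unspin l (snd q)) \<in> D}"

lemma continuous_on_unspin: "continuous_on X (unspin l)"
proof -
  have "continuous_on X (\<lambda>x. if j = l then sqrt ((x $ Some l)\<^sup>2 + (x $ None)\<^sup>2) else x $ Some j)" for j
    by (cases "j = l") (auto intro!: continuous_intros)
  then show ?thesis unfolding unspin_def spin_radius_def by (rule continuous_on_vec_lambda)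
qed

lemma open_spin_base:
  fixes D :: "(real \<times> (real ^ 'n::finite)) set"
  assumes "open D"
  shows "open (spin_base l D)"
proof -
  have "continuous_on UNIV (\<lambda>q. (fst q, unspin l (snd q)) :: real \<times> (real ^ 'n))"
    by (intro continuous_intros continuous_on_compose2[OF continuous_on_unspin[of UNIV]]) auto
  from open_vimage[OF assms this] show ?thesis by (simp add: spin_base_def vimage_def)
qed

lemma continuous_on_unspin_pt: "continuous_on X (unspin_pt l)"
  unfolding unspin_pt_def[abs_def]
  by (intro continuous_intros continuous_on_compose2[OF continuous_on_unspin[of UNIV]]) auto

lemma unspin_pt_mem: "unspin_pt l p \<in> D \<times> F \<longleftrightarrow> p \<in> spin_base l D \<times> F"
  by (cases p) (auto simp: unspin_pt_def spin_base_def)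

lemma unspin_nonneg: "0 \<le> unspin l x $ l"
  by (simp add: unspin_def spin_radius_def)

lemma unspin_spin_vec:
  assumes "0 \<le> x $ l"
  shows "unspin l (spin_vec l \<theta> x) = x"
proof -
  have "(x $ l * cos \<theta>)\<^sup>2 + (x $ l * sin \<theta>)\<^sup>2 = (x $ l)\<^sup>2 * ((cos \<theta>)\<^sup>2 + (sin \<theta>)\<^sup>2)"
    by (simp only: power_mult_distrib distrib_left)
  then show ?thesis
    using assms by (simp add: unspin_def spin_radius_def spin_vec_def vec_eq_iff)
qed

lemma spin_vec_unspin: "\<exists>\<theta>. spin_vec l \<theta> (unspin l x) = x"
proof -
  let ?r = "spin_radius l x"
  obtain \<theta> where \<theta>: "x $ Some l = ?r * cos \<theta>" "x $ None = ?r * sin \<theta>"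
  proof (cases "?r = 0")
    case True
    then have "x $ Some l = 0" "x $ None = 0"
      by (simp_all add: spin_radius_def sum_power2_eq_zero_iff)
    then show thesis using True that by simp
  next
    case False
    have r2: "?r\<^sup>2 = (x $ Some l)\<^sup>2 + (x $ None)\<^sup>2" by (simp add: spin_radius_def)
    have "(x $ Some l / ?r)\<^sup>2 + (x $ None / ?r)\<^sup>2 = 1"
      unfolding power_divide add_divide_distrib[symmetric] r2[symmetric] using False by simp
    from sincos_total_2pi[OF this] obtain \<theta> where "x $ Some l / ?r = cos \<theta>" "x $ None / ?r = sin \<theta>"
      by metis
    then show thesis using False that[of \<theta>] by (simp add: field_simps)
  qed
  have "spin_vec l \<theta> (unspin l x) $ i = x $ i" for i
    using \<theta> by (cases i) (auto simp: spin_vec_def unspin_def)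
  then show ?thesis by (auto simp: vec_eq_iff)
qed

section \<open>Coordinate directions before and after spinning\<close>

lemma Basis_cot_cases:
  assumes "e \<in> (Basis :: (real \<times> (real ^ 'm::finite)) set)"
  obtains "e = (1, 0)" | i where "e = (0, axis i 1)"
  using assms by (auto simp: Basis_prod_def Basis_vec_def)

lemma Basis_cot [simp]:
  "(1, 0) \<in> (Basis :: (real \<times> (real ^ 'm::finite)) set)"
  "(0, axis i 1) \<in> (Basis :: (real \<times> (real ^ 'm::finite)) set)"
  by (auto simp: Basis_prod_def Basis_vec_def)

lemma inner_spin_axis: "q \<bullet> spin_axis l = snd q $ l"
  by (cases q) (simp add: spin_axis_def inner_axis)

text \<open>For the time, the fibre and the unrotated coordinates, unspinning sends lines to lines
  at the same speed, so derivatives in these directions commute with spinning. The two rotated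
  directions have no counterpart of this kind.\<close>

definition line_match ::
  "'n::finite \<Rightarrow> ((real \<times> (real ^ ('n option))) \<times> (nat \<Rightarrow> real) \<Rightarrow> real \<Rightarrow> (real \<times> (real ^ ('n option))) \<times> (nat \<Rightarrow> real)) \<Rightarrow>
   ((real \<times> (real ^ 'n)) \<times> (nat \<Rightarrow> real) \<Rightarrow> real \<Rightarrow> (real \<times> (real ^ 'n)) \<times> (nat \<Rightarrow> real)) \<Rightarrow> bool" where
  "line_match l c' c \<longleftrightarrow> (\<forall>p h. unspin_pt l (c' p h) = c (unspin_pt l p) h)"

lemma line_match_time: "line_match l (base_line (1, 0)) (base_line (1, 0))"
  by (simp add: line_match_def unspin_pt_def base_line_def)

lemma line_match_space:
  assumes "j \<noteq> l"
  shows "line_match l (base_line (0, axis (Some j) 1)) (base_line (0, axis j 1))"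
  using assms
  by (auto simp: line_match_def unspin_pt_def base_line_def unspin_def spin_radius_def vec_eq_iff axis_def)

lemma line_match_fibre: "line_match l (fibre_line j) (fibre_line j)"
  by (simp add: line_match_def unspin_pt_def fibre_line_def)

text \<open>In the matching case the weight 0 is recorded as well: it says that differentiation in
  this direction preserves evenness, so the derivative can be spun again.\<close>

lemma fam_lines_spin_cases:
  fixes l :: "'n::finite"
  assumes "c' \<in> (fam_lines N :: ((real \<times> (real ^ ('n option))) \<times> _ \<Rightarrow> _) set)"
  obtains c where "c \<in> fam_lines N" "line_match l c' c" "line_weight (spin_axis l) c 0"
  | i where "i = Some l \<or> i = None" "c' = base_line (0, axis i 1)"
  using assms
proof (cases rule: fam_linesE)
  case (1 e)
  from 1(1) show ?thesis
  proof (cases rule: Basis_cot_cases)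
    case 1
    show ?thesis
      by (rule that(1)[of "base_line (1, 0)"])
         (auto simp: \<open>c' = base_line e\<close> 1 fam_lines_def line_match_time spin_axis_def intro!: line_weight_base_other)
  next
    case (2 i)
    show ?thesis
    proof (cases "i = Some l \<or> i = None")
      case True
      then show ?thesis using that(2) \<open>c' = base_line e\<close> 2 by blast
    next
      case False
      then obtain j where j: "i = Some j" "j \<noteq> l" by (cases i) auto
      have "axis j (1::real) \<noteq> axis l 1" using j(2) by (simp add: axis_eq_axis)
      then show ?thesis
        by (intro that(1)[of "base_line (0, axis j 1)"])
           (use j in \<open>auto simp: \<open>c' = base_line e\<close> 2 fam_lines_def line_match_space spin_axis_def intro!: line_weight_base_other\<close>)
    qed
  qed
next
  case (2 j)
  show ?thesis
    by (rule that(1)[of "fibre_line j"])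
       (auto simp: 2 fam_lines_def line_match_fibre line_weight_fibre)
qed

context
  fixes l :: "'n::finite" and D :: "(real \<times> (real ^ 'n)) set" and N :: nat
  assumes D: "reflectible (spin_axis l) D"
begin

lemma line_domain_spin: "line_domain (fam_lines N) (spin_base l D \<times> fibre N)"
  using D by (intro line_domain_family open_spin_base) (simp add: reflectible_def)

lemma has_pderiv_spin_match:
  assumes g: "smooth_on (fam_lines N) (D \<times> fibre N) g"
    and c: "c \<in> fam_lines N" "c' \<in> fam_lines N" "line_match l c' c"
    and p: "p \<in> spin_base l D \<times> fibre N"
  shows "has_pderiv (spin_base l D \<times> fibre N) c' (\<lambda>p. g (unspin_pt l p))
    (pderiv_on (D \<times> fibre N) c g (unspin_pt l p)) p"
proof (rule has_pderiv_pullback[where c = c and A = "D \<times> fibre N"])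
  show "has_pderiv (D \<times> fibre N) c g (pderiv_on (D \<times> fibre N) c g (unspin_pt l p)) (unspin_pt l p)"
    by (rule smooth_on_has_pderiv[OF g c(1)]) (use p unspin_pt_mem in blast)
  show "unspin_pt l ` (spin_base l D \<times> fibre N) \<subseteq> D \<times> fibre N"
    using unspin_pt_mem by (intro image_subsetI) blast
  show "c' p 0 = p" by (rule line_domainD(1)[OF line_domain_spin c(2) p])
qed (use c p in \<open>auto simp: line_match_def\<close>)

lemma pderiv_spin_match:
  assumes "smooth_on (fam_lines N) (D \<times> fibre N) g"
    and "c \<in> fam_lines N" "c' \<in> fam_lines N" "line_match l c' c"
    and "p \<in> spin_base l D \<times> fibre N"
  shows "pderiv_on (spin_base l D \<times> fibre N) c' (\<lambda>p. g (unspin_pt l p)) p =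
    pderiv_on (D \<times> fibre N) c g (unspin_pt l p)"
  by (rule has_pderiv_pderiv_on_eq[OF line_domain_spin assms(3,5) has_pderiv_spin_match[OF assms]])

text \<open>At the axis \<open>r = 0\<close> the radius is not differentiable; there evenness replaces \<open>\<bar>h\<bar>\<close> by \<open>h\<close>.\<close>

lemma has_pderiv_spin_axis:
  assumes g: "parity_family 0 (spin_axis l) D N g"
    and i: "i = Some l \<or> i = None" and p: "p \<in> spin_base l D \<times> fibre N"
    and k: "spin_radius l (snd (fst p)) * k =
      pderiv_on (D \<times> fibre N) (base_line (spin_axis l)) g (unspin_pt l p)"
  shows "has_pderiv (spin_base l D \<times> fibre N) (base_line (0, axis i 1)) (\<lambda>p. g (unspin_pt l p))
    (snd (fst p) $ i * k) p"
proof -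
  let ?A = "D \<times> fibre N" and ?A' = "spin_base l D \<times> fibre N" and ?b = "spin_axis l"
  let ?c = "base_line ?b" and ?c' = "base_line (0, axis i (1::real)) :: (real \<times> (real ^ ('n option))) \<times> (nat \<Rightarrow> real) \<Rightarrow> _"
  have sg: "smooth_on (fam_lines N) ?A g" using g by (simp add: parity_family_def)
  have b: "?b \<in> Basis" by (simp add: spin_axis_def)
  have c: "?c \<in> fam_lines N" by (simp add: fam_lines_def b)
  have q: "unspin_pt l p \<in> ?A" using p unspin_pt_mem by blast
  obtain x where x: "x = snd (fst p)" by simp
  define s where "s = spin_radius l x"
  \<comment> \<open>The other one of the two rotated coordinates; the radius treats both
    alike.\<close>
  define i' where "i' = (if i = None then Some l else None)"
  have s_eq: "spin_radius l y = sqrt ((y $ i)\<^sup>2 + (y $ i')\<^sup>2)" for y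
    using i by (auto simp: spin_radius_def i'_def add.commute)
  have ii': "i' \<noteq> i" using i by (auto simp: i'_def)
  define r where "r h = sqrt ((x $ i + h)\<^sup>2 + (x $ i')\<^sup>2)" for h
  have U: "unspin_pt l (?c' p h) = ?c (unspin_pt l p) (r h - s)" for h
  proof -
    have "spin_radius l (x + h *\<^sub>R axis i 1) = r h"
      unfolding s_eq r_def using ii' by (simp add: axis_def)
    moreover have "(x + h *\<^sub>R axis i 1) $ Some j = x $ Some j" if "j \<noteq> l" for j
      using i that by (auto simp: axis_def)
    ultimately show ?thesis
      by (auto simp: unspin_pt_def base_line_def x[symmetric] unspin_def spin_axis_def vec_eq_iff axis_def s_def)
  qed
  let ?S = "{h. ?c' p h \<in> ?A'}"
  have S: "?S = {h. ?c (unspin_pt l p) (r h - s) \<in> ?A}"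
    by (simp only: U[symmetric] unspin_pt_mem)
  let ?d = "pderiv_on ?A ?c g (unspin_pt l p)"
  have gd: "((\<lambda>h. g (?c (unspin_pt l p) h)) has_vector_derivative ?d)
      (at 0 within {h. ?c (unspin_pt l p) h \<in> ?A})"
    using smooth_on_has_pderiv[OF sg c q] by (simp add: has_pderiv_def)
  have r0: "r 0 = s" by (simp add: r_def s_def s_eq)
  show ?thesis
  proof (cases "s = 0")
    case False
    \<comment> \<open>Off the axis the radius is differentiable with derivative
      \<open>x $ i / s\<close>, and the chain rule gives \<open>(x $ i / s) * ?d\<close>; this is
      \<open>x $ i * k\<close> because \<open>?d = s * k\<close>.\<close>
    have spos: "(x $ i)\<^sup>2 + (x $ i')\<^sup>2 > 0"
      using False unfolding s_def s_eq by (metis real_sqrt_eq_zero_cancel_iff sum_power2_ge_zero order_le_less)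
    have "((\<lambda>h. r h - s) has_real_derivative (x $ i / s)) (at 0)"
      unfolding r_def s_def s_eq using spos
      by (auto intro!: derivative_eq_intros simp: field_simps)
    then have "((\<lambda>h. r h - s) has_vector_derivative (x $ i / s)) (at 0 within ?S)"
      by (simp add: has_real_derivative_iff_has_vector_derivative has_vector_derivative_at_within)
    moreover have "((\<lambda>h. g (?c (unspin_pt l p) h)) has_vector_derivative ?d)
        (at (r 0 - s) within (\<lambda>h. r h - s) ` ?S)"
      unfolding r0 using gd
      by (auto intro!: has_vector_derivative_within_subset[OF gd] simp: S)
    ultimately have "((\<lambda>h. g (?c (unspin_pt l p) h)) \<circ> (\<lambda>h. r h - s) has_vector_derivative
        (x $ i / s) *\<^sub>R ?d) (at 0 within ?S)"
      by (rule vector_diff_chain_within)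
    moreover have "(x $ i / s) *\<^sub>R ?d = x $ i * k"
      using k False by (simp add: x[symmetric] s_def[symmetric])
         (metis False nonzero_mult_div_cancel_left times_divide_eq_left times_divide_eq_right)
    ultimately show ?thesis
      unfolding has_pderiv_def by (simp only: o_def U x)
  next
    case True
    have x0: "x $ i = 0" "x $ i' = 0"
      using True unfolding s_def s_eq by (simp_all add: sum_power2_eq_zero_iff)
    \<comment> \<open>At the axis the radius along the line is \<bar>h\<bar>, and the reflection
      turns \<open>h\<close> into \<open>- h\<close> because it fixes the base point.\<close>
    have r: "r h - s = \<bar>h\<bar>" for h by (simp add: r_def x0 True)
    have fix0: "scale_coord ?b (-1) (unspin_pt l p) = unspin_pt l p"
      using True by (simp add: scale_coord_def inner_spin_axis unspin_pt_def unspin_def x[symmetric] s_def)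
    have refl: "scale_coord ?b (-1) (?c (unspin_pt l p) h) = ?c (unspin_pt l p) (- h)" for h
      using line_weight_base_same[OF b, unfolded line_weight_def, rule_format, of "-1" "unspin_pt l p" h]
      unfolding fix0 by simp
    have eq: "?c (unspin_pt l p) h \<in> ?A \<and> g (?c (unspin_pt l p) \<bar>h\<bar>) = g (?c (unspin_pt l p) h)"
      if "h \<in> ?S" for h
    proof (cases "h \<ge> 0")
      case True
      then show ?thesis using that unfolding S r by simp
    next
      case False
      then have m: "?c (unspin_pt l p) (- h) \<in> ?A" using that unfolding S r by simp
      have "?c (unspin_pt l p) h = scale_coord ?b (-1) (?c (unspin_pt l p) (- h))"
        using refl[of "- h"] by simp
      moreover have "scale_coord ?b (-1) (?c (unspin_pt l p) (- h)) \<in> ?A"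
        by (rule scale_coord_mem[OF D m]) auto
      moreover have "g (scale_coord ?b (-1) (?c (unspin_pt l p) (- h))) = (-1) ^ 0 * g (?c (unspin_pt l p) (- h))"
        using g[unfolded parity_family_def, THEN conjunct2] m by (rule bspec)
      ultimately show ?thesis using False by simp
    qed
    \<comment> \<open>Both sides vanish: \<open>?d\<close> equals \<open>s * k\<close> with
      \<open>s = 0\<close>, and the coordinate \<open>x $ i\<close> is zero on the axis.\<close>
    have d0: "?d = x $ i * k" using k True by (simp add: x[symmetric] s_def x0)
    have "?S \<subseteq> {h. ?c (unspin_pt l p) h \<in> ?A}"
    proof
      fix h assume "h \<in> ?S"
      from eq[OF this] show "h \<in> {h. ?c (unspin_pt l p) h \<in> ?A}" by simp
    qed
    from has_vector_derivative_within_subset[OF gd this]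
    have "((\<lambda>h. g (unspin_pt l (?c' p h))) has_vector_derivative ?d) (at 0 within ?S)"
    proof (rule has_vector_derivative_transform[rotated 2])
      show "0 \<in> ?S" using p by (simp add: base_line_def zero_prod_def[symmetric] mem_Times_iff)
      show "g (unspin_pt l (?c' p h)) = g (?c (unspin_pt l p) h)" if "h \<in> ?S" for h
        using eq[OF that] unfolding U r by simp
    qed
    then show ?thesis unfolding has_pderiv_def d0 x .
  qed
qed

lemma pderiv_axis_quotient:
  assumes g: "parity_family 0 (spin_axis l) D N g"
  obtains k where "parity_family 0 (spin_axis l) D N k"
    "\<And>p. p \<in> D \<times> fibre N \<Longrightarrow>
      snd (fst p) $ l * k p = pderiv_on (D \<times> fibre N) (base_line (spin_axis l)) g p"
proof -
  have b: "spin_axis l \<in> Basis" by (simp add: spin_axis_def)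
  have "parity_family (0 + 1) (spin_axis l) D N (pderiv_on (D \<times> fibre N) (base_line (spin_axis l)) g)"
    by (rule parity_family_pderiv[OF D g _ line_weight_base_same[OF b]]) (simp add: fam_lines_def b)
  then have "parity_family 1 (spin_axis l) D N (pderiv_on (D \<times> fibre N) (base_line (spin_axis l)) g)"
    by simp
  from odd_family_quotient[OF D this] that show thesis by (auto simp: inner_spin_axis)
qed

lemma smooth_coordinate:
  fixes A :: "((real \<times> (real ^ 'm::finite)) \<times> (nat \<Rightarrow> real)) set"
  assumes c: "c \<in> fam_lines N"
  shows "\<exists>k. \<forall>p. has_pderiv A c (\<lambda>p. snd (fst p) $ i) k p"
  using c
proof (cases rule: fam_linesE)
  case (1 e)
  have "has_pderiv A c (\<lambda>p. snd (fst p) $ i) (snd e $ i) p" for p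
    unfolding has_pderiv_def 1 base_line_def
    by (auto intro!: derivative_eq_intros simp: has_real_derivative_iff_has_vector_derivative[symmetric])
  then show ?thesis by blast
next
  case (2 j)
  have "has_pderiv A c (\<lambda>p. snd (fst p) $ i) 0 p" for p
    unfolding has_pderiv_def 2 fibre_line_def by (auto intro!: derivative_eq_intros)
  then show ?thesis by blast
qed

theorem smooth_on_spin:
  assumes g: "parity_family 0 (spin_axis l) D N g"
  shows "smooth_on (fam_lines N) (spin_base l D \<times> fibre N) (\<lambda>p. g (unspin_pt l p))"
proof -
  let ?A = "D \<times> fibre N" and ?A' = "spin_base l D \<times> fibre N"
  \<comment> \<open>The spun functions alone are not closed under derivatives: a rotated direction
    yields a coordinate times a spun even function.\<close>
  define G :: "((real \<times> (real ^ ('n option))) \<times> (nat \<Rightarrow> real) \<Rightarrow> real) set"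
    where "G = {(\<lambda>p. g (unspin_pt l p)) | g. parity_family 0 (spin_axis l) D N g} \<union>
      range (\<lambda>i p. snd (fst p) $ i)"
  have GI: "gen_alg G (\<lambda>p. g (unspin_pt l p))" if "parity_family 0 (spin_axis l) D N g" for g
    by (rule gen_alg.gen) (use that in \<open>auto simp: G_def\<close>)
  have GI': "gen_alg G (\<lambda>p. snd (fst p) $ i)" for i
    by (rule gen_alg.gen) (auto simp: G_def)
  have sub: "unspin_pt l ` ?A' \<subseteq> ?A" using unspin_pt_mem by (intro image_subsetI) blast
  show ?thesis
  proof (rule smooth_on_gen_alg[OF line_domain_spin, where G = G])
    fix f assume "f \<in> G"
    then consider g where "parity_family 0 (spin_axis l) D N g" "f = (\<lambda>p. g (unspin_pt l p))"
      | i where "f = (\<lambda>p. snd (fst p) $ i)" unfolding G_def by blast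
    then show "continuous_on ?A' f"
    proof cases
      case (1 g)
      then have "continuous_on ?A g" unfolding parity_family_def using smooth_on_continuous by blast
      then show ?thesis unfolding 1(2)
        by (rule continuous_on_compose2[OF _ continuous_on_unspin_pt sub])
    qed (auto intro!: continuous_intros)
  next
    fix f and c' :: "(real \<times> (real ^ ('n option))) \<times> (nat \<Rightarrow> real) \<Rightarrow> real \<Rightarrow> (real \<times> (real ^ ('n option))) \<times> (nat \<Rightarrow> real)"
    assume "f \<in> G" and c': "c' \<in> fam_lines N"
    then consider g where "parity_family 0 (spin_axis l) D N g" "f = (\<lambda>p. g (unspin_pt l p))"
      | i where "f = (\<lambda>p. snd (fst p) $ i)" unfolding G_def by blast
    then show "\<exists>f'. gen_alg G f' \<and> (\<forall>p\<in>?A'. has_pderiv ?A' c' f (f' p) p)"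
    proof cases
      case (2 i)
      obtain k where "\<forall>p. has_pderiv ?A' c' f k p" using smooth_coordinate[OF c'] 2 by blast
      then show ?thesis using gen_alg.const by blast
    next
      case (1 g)
      have sg: "smooth_on (fam_lines N) ?A g" using 1 by (simp add: parity_family_def)
      from c' show ?thesis
      proof (cases rule: fam_lines_spin_cases[of c' N l])
        case (1 c)
        have "parity_family 0 (spin_axis l) D N (pderiv_on ?A c g)"
          using parity_family_pderiv[OF D \<open>parity_family 0 (spin_axis l) D N g\<close> 1(1,3)] by simp
        then show ?thesis
          using GI has_pderiv_spin_match[OF sg 1(1) c' 1(2)] \<open>f = _\<close>
          by (intro exI[of _ "\<lambda>p. pderiv_on ?A c g (unspin_pt l p)"]) simp
      next
        case (2 i)
        obtain k where k: "parity_family 0 (spin_axis l) D N k"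
          "\<And>p. p \<in> ?A \<Longrightarrow> snd (fst p) $ l * k p = pderiv_on ?A (base_line (spin_axis l)) g p"
          using pderiv_axis_quotient[OF 1(1)] by blast
        have "has_pderiv ?A' c' f (snd (fst p) $ i * k (unspin_pt l p)) p" if p: "p \<in> ?A'" for p
          unfolding 1(2) 2(2)
        proof (rule has_pderiv_spin_axis[OF 1(1) 2(1) p])
          have "unspin_pt l p \<in> ?A" using p sub by blast
          from k(2)[OF this]
          show "spin_radius l (snd (fst p)) * k (unspin_pt l p) =
              pderiv_on ?A (base_line (spin_axis l)) g (unspin_pt l p)"
            by (simp add: unspin_pt_def unspin_def)
        qed
        then show ?thesis
          by (intro exI[of _ "\<lambda>p. snd (fst p) $ i * k (unspin_pt l p)"] conjI gen_alg.mult GI GI' k(1)) simp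
      qed
    qed
  next
    show "gen_alg G (\<lambda>p. g (unspin_pt l p))" by (rule GI[OF g])
  qed
qed

text \<open>At the rotated point the coordinates are \<open>x $ l * cos \<theta>\<close> and
  \<open>x $ l * sin \<theta>\<close>, and \<open>x $ l\<close> times the quotient \<open>k\<close>
  is the normal derivative of \<open>g\<close>. Phrasing it with \<open>k\<close> includes the axis,
  where \<theta> is arbitrary and the normal derivative is zero.\<close>

lemma pderiv_spin_axis:
  assumes g: "parity_family 0 (spin_axis l) D N g"
    and p: "((t, x), \<eta>) \<in> D \<times> fibre N" and x: "0 \<le> x $ l"
  shows "pderiv_on (spin_base l D \<times> fibre N) (base_line (0, axis (Some l) 1)) (\<lambda>p. g (unspin_pt l p))
      ((t, spin_vec l \<theta> x), \<eta>) = cos \<theta> * pderiv_on (D \<times> fibre N) (base_line (0, axis l 1)) g ((t, x), \<eta>)"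
    "pderiv_on (spin_base l D \<times> fibre N) (base_line (0, axis None 1)) (\<lambda>p. g (unspin_pt l p))
      ((t, spin_vec l \<theta> x), \<eta>) = sin \<theta> * pderiv_on (D \<times> fibre N) (base_line (0, axis l 1)) g ((t, x), \<eta>)"
proof -
  let ?p = "((t, spin_vec l \<theta> x), \<eta>)" and ?A = "D \<times> fibre N" and ?A' = "spin_base l D \<times> fibre N"
  let ?d = "pderiv_on ?A (base_line (0, axis l 1)) g ((t, x), \<eta>)"
  have U: "unspin_pt l ?p = ((t, x), \<eta>)" by (simp add: unspin_pt_def unspin_spin_vec[OF x])
  then have p': "?p \<in> ?A'" using unspin_pt_mem[of l ?p] p by simp
  obtain k where k: "\<And>p. p \<in> ?A \<Longrightarrow> snd (fst p) $ l * k p = pderiv_on ?A (base_line (spin_axis l)) g p"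
    using pderiv_axis_quotient[OF g] by blast
  have r: "spin_radius l (spin_vec l \<theta> x) = x $ l"
    using arg_cong[OF unspin_spin_vec[OF x, of \<theta>], of "\<lambda>v. v $ l"] by (simp add: unspin_def)
  have kd: "x $ l * k ((t, x), \<eta>) = ?d" using k[OF p] by (simp add: spin_axis_def)
  have *: "pderiv_on ?A' (base_line (0, axis i 1)) (\<lambda>p. g (unspin_pt l p)) ?p = spin_vec l \<theta> x $ i * k ((t, x), \<eta>)"
    if "i = Some l \<or> i = None" for i
  proof (rule has_pderiv_pderiv_on_eq[OF line_domain_spin _ p'])
    show "has_pderiv ?A' (base_line (0, axis i 1)) (\<lambda>p. g (unspin_pt l p)) (spin_vec l \<theta> x $ i * k ((t, x), \<eta>)) ?p"
      using has_pderiv_spin_axis[OF g that p', of "k ((t, x), \<eta>)"] kd by (simp add: r U spin_axis_def)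
  qed (simp add: fam_lines_def)
  show "pderiv_on ?A' (base_line (0, axis (Some l) 1)) (\<lambda>p. g (unspin_pt l p)) ?p = cos \<theta> * ?d"
    using *[of "Some l"] unfolding kd[symmetric] by (simp add: spin_vec_def)
  show "pderiv_on ?A' (base_line (0, axis None 1)) (\<lambda>p. g (unspin_pt l p)) ?p = sin \<theta> * ?d"
    using *[of None] unfolding kd[symmetric] by (simp add: spin_vec_def)
qed

end

section \<open>The spun generating family\<close>

lemma linear_spin_vec: "linear (spin_vec l \<theta>)"
  by (rule linearI) (auto simp: spin_vec_def vec_eq_iff algebra_simps split: option.splits)

lemma bounded_linear_spin_vec: "bounded_linear (spin_vec l \<theta>)"
  using linear_spin_vec linear_conv_bounded_linear by blast

lemma sum_UNIV_option: "(\<Sum>i\<in>UNIV. f i) = f None + (\<Sum>j\<in>UNIV. f (Some (j :: 'n::finite)))"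
proof -
  have "(\<Sum>i\<in>UNIV. f i) = f None + (\<Sum>i\<in>range Some. f i)"
    unfolding UNIV_option_conv by (subst sum.insert) auto
  also have "(\<Sum>i\<in>range Some. f i) = (\<Sum>j\<in>UNIV. f (Some j))"
    by (subst sum.reindex) auto
  finally show ?thesis .
qed

lemma inner_spin_vec: "spin_vec l \<theta> x \<bullet> spin_vec l \<theta> y = x \<bullet> (y :: real ^ 'n::finite)"
proof -
  let ?g = "\<lambda>j. x $ j * y $ j"
  have "spin_vec l \<theta> x \<bullet> spin_vec l \<theta> y =
      (sin \<theta>)\<^sup>2 * ?g l + (\<Sum>j\<in>UNIV. if j = l then (cos \<theta>)\<^sup>2 * ?g l else ?g j)"
    by (simp add: inner_vec_def sum_UNIV_option spin_vec_def power2_eq_square if_distrib mult_ac cong: if_cong)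
  also have "(\<Sum>j\<in>UNIV. if j = l then (cos \<theta>)\<^sup>2 * ?g l else ?g j) =
      (cos \<theta>)\<^sup>2 * ?g l + (\<Sum>j\<in>UNIV - {l}. ?g j)"
    by (subst sum.remove[of _ l]) auto
  also have "(sin \<theta>)\<^sup>2 * ?g l + \<dots> = ((sin \<theta>)\<^sup>2 + (cos \<theta>)\<^sup>2) * ?g l + (\<Sum>j\<in>UNIV - {l}. ?g j)"
    by (simp only: distrib_right add.assoc)
  also have "\<dots> = (\<Sum>j\<in>UNIV. ?g j)"
    by (subst sum.remove[of UNIV l ?g]) auto
  finally show ?thesis by (simp add: inner_vec_def)
qed

lemma base_gradient_inner:
  "e \<in> Basis \<Longrightarrow> base_gradient D N f p \<bullet> e = pderiv_on (D \<times> fibre N) (base_line e) f p"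
  by (simp add: base_gradient_def inner_sum_left inner_Basis if_distrib cong: if_cong)

lemma base_gradient_components:
  "fst (base_gradient D N f p) = pderiv_on (D \<times> fibre N) (base_line (1, 0)) f p"
  "snd (base_gradient D N f p) $ i = pderiv_on (D \<times> fibre N) (base_line (0, axis i 1)) f p"
  using base_gradient_inner[of "(1, 0)" D N f p] base_gradient_inner[of "(0, axis i 1)" D N f p]
  by (cases "base_gradient D N f p"; simp add: inner_axis)+

lemma sum_inner_pderiv:
  "(\<Sum>e\<in>Basis. (v \<bullet> e) * pderiv_on (D \<times> fibre N) (base_line e) f p) = v \<bullet> base_gradient D N f p"
  by (simp add: base_gradient_def inner_sum_right mult.commute)

lemma pos_times_UNIV_eq: "pos_times UNIV = {q. 0 < fst q}"
  by (auto simp: pos_times_def)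

lemma open_pos_times: "open (pos_times UNIV :: (real \<times> (real ^ 'm::finite)) set)"
  unfolding pos_times_UNIV_eq by (intro open_Collect_less continuous_intros)

lemma reflectible_pos_times: "reflectible (spin_axis l) (pos_times UNIV)"
proof -
  have "convex (pos_times UNIV :: (real \<times> (real ^ 'n)) set)"
    unfolding pos_times_def by (intro convex_Times) (auto simp: convex_real_interval)
  then show ?thesis
    using open_pos_times by (auto simp: reflectible_def pos_times_UNIV_eq spin_axis_def)
qed

lemma spin_base_pos_times: "spin_base l (pos_times UNIV) = pos_times UNIV"
  by (auto simp: spin_base_def pos_times_def)

lemma line_domain_pos_times:
  "line_domain (fam_lines N) ((pos_times UNIV :: (real \<times> (real ^ 'm::finite)) set) \<times> fibre N)"
  by (rule line_domain_family[OF open_pos_times])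

lemma line_domain_pos_times_halfspace:
  "line_domain (fam_lines N) (pos_times (halfspace l) \<times> fibre N)"
proof -
  have "pos_times (halfspace l) = {w. 0 \<le> w \<bullet> (0, axis l 1)} \<inter> pos_times UNIV"
    by (auto simp: pos_times_def halfspace_def inner_axis)
  then have "openin (top_of_set {w. 0 \<le> w \<bullet> (0, axis l 1)}) (pos_times (halfspace l))"
    using openin_open_Int[OF open_pos_times] by metis
  then have "chart_domain (pos_times (halfspace l))"
    unfolding chart_domain_def using Basis_cot(2) by blast
  then show ?thesis
    by (intro line_domain_fam_lines line_domain_chart)
qed

lemma base_gradient_spin:
  assumes g: "parity_family 0 (spin_axis l) (pos_times UNIV) N g"
    and t: "0 < t" "\<eta> \<in> fibre N" and x: "0 \<le> x $ l"
  shows "base_gradient (pos_times UNIV) N (\<lambda>p. g (unspin_pt l p)) ((t, spin_vec l \<theta> x), \<eta>) =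
    (fst (base_gradient (pos_times UNIV) N g ((t, x), \<eta>)),
     spin_vec l \<theta> (snd (base_gradient (pos_times UNIV) N g ((t, x), \<eta>))))"
proof (intro prod_eqI)
  let ?D = "pos_times UNIV" and ?p = "((t, spin_vec l \<theta> x), \<eta>)"
  let ?g' = "\<lambda>p. g (unspin_pt l p)"
  note R = reflectible_pos_times[of l]
  have sg: "smooth_on (fam_lines N) (?D \<times> fibre N) g" using g by (simp add: parity_family_def)
  have p: "((t, x), \<eta>) \<in> ?D \<times> fibre N" using t by (simp add: pos_times_def)
  have p': "?p \<in> spin_base l ?D \<times> fibre N" using t by (simp add: spin_base_pos_times) (simp add: pos_times_def)
  have U: "unspin_pt l ?p = ((t, x), \<eta>)" by (simp add: unspin_pt_def unspin_spin_vec[OF x])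
  have match: "pderiv_on (?D \<times> fibre N) (base_line e') ?g' ?p = pderiv_on (?D \<times> fibre N) (base_line e) g ((t, x), \<eta>)"
    if "e' \<in> Basis" "e \<in> Basis" "line_match l (base_line e') (base_line e)" for e e'
    using pderiv_spin_match[OF R sg _ _ that(3) p'] that(1,2)
    by (simp add: U spin_base_pos_times fam_lines_def)
  show "fst (base_gradient ?D N ?g' ?p) = fst (fst (base_gradient ?D N g ((t, x), \<eta>)),
     spin_vec l \<theta> (snd (base_gradient ?D N g ((t, x), \<eta>))))"
    using match[OF _ _ line_match_time] by (simp add: base_gradient_components)
  show "snd (base_gradient ?D N ?g' ?p) = snd (fst (base_gradient ?D N g ((t, x), \<eta>)),
     spin_vec l \<theta> (snd (base_gradient ?D N g ((t, x), \<eta>))))"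
    unfolding vec_eq_iff
  proof
    fix i :: "'a option"
    consider "i = None" | "i = Some l" | j where "i = Some j" "j \<noteq> l" by (cases i) auto
    then show "snd (base_gradient ?D N ?g' ?p) $ i = snd (fst (base_gradient ?D N g ((t, x), \<eta>)),
       spin_vec l \<theta> (snd (base_gradient ?D N g ((t, x), \<eta>)))) $ i"
    proof cases
      case 1
      then show ?thesis using pderiv_spin_axis(2)[OF R g p x, of \<theta>]
        by (simp add: base_gradient_components spin_base_pos_times spin_vec_def)
    next
      case 2
      then show ?thesis using pderiv_spin_axis(1)[OF R g p x, of \<theta>]
        by (simp add: base_gradient_components spin_base_pos_times spin_vec_def)
    next
      case 3
      then show ?thesis using match[OF _ _ line_match_space[OF 3(2)]]
        by (simp add: base_gradient_components spin_vec_def)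
    qed
  qed
qed

definition reflect_ext ::
  "'n::finite \<Rightarrow> ((real \<times> (real ^ 'n)) \<times> (nat \<Rightarrow> real) \<Rightarrow> real) \<Rightarrow> (real \<times> (real ^ 'n)) \<times> (nat \<Rightarrow> real) \<Rightarrow> real" where
  "reflect_ext l F = (\<lambda>((t, x), \<eta>). if 0 \<le> x $ l then F ((t, x), \<eta>) else F ((t, reflect_vec l x), \<eta>))"

lemma reflect_vec_reflect_vec [simp]: "reflect_vec l (reflect_vec l x) = x"
  by (simp add: reflect_vec_def vec_eq_iff)

lemma reflect_vec_fixed: "x $ l = 0 \<Longrightarrow> reflect_vec l x = x"
  by (simp add: reflect_vec_def vec_eq_iff)

lemma scale_coord_spin_axis: "scale_coord (spin_axis l) (-1) ((t, x), \<eta>) = ((t, reflect_vec l x), \<eta>)"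
  unfolding scale_coord_def inner_spin_axis
  by (auto simp: reflect_vec_def vec_eq_iff spin_axis_def axis_def)

text \<open>Only the family is constrained here. The submanifold structure of \<open>L\<close>
  enters later, for the proof that the spun set is Lagrangian.\<close>

locale spinnable_generating_family =
  fixes l :: "'n::finite" and N :: nat
    and F :: "(real \<times> (real ^ 'n)) \<times> (nat \<Rightarrow> real) \<Rightarrow> real"
    and L :: "(real \<times> (real ^ 'n) \<times> real \<times> (real ^ 'n)) set"
  assumes spinnable: "spinnable_family l N F"
    and generates: "generates_lagrangian (halfspace l) N F L"
begin

abbreviation "F\<^sub>e \<equiv> reflect_ext l F"
abbreviation "F\<^sub>s \<equiv> \<lambda>p. F (unspin_pt l p)"
abbreviation "D\<^sub>H \<equiv> pos_times (halfspace l)"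

text \<open>The radius is nonnegative, so unspinning never reaches the reflected branch of the
  extension. The spun family thus comes from an even family on an open domain.\<close>

lemma spun_eq: "F\<^sub>s = (\<lambda>p. F\<^sub>e (unspin_pt l p))"
  by (auto simp: reflect_ext_def unspin_pt_def unspin_nonneg fun_eq_iff)

lemma even: "parity_family 0 (spin_axis l) (pos_times UNIV) N F\<^sub>e"
  unfolding parity_family_def
proof (intro conjI ballI)
  show "smooth_on (fam_lines N) (pos_times UNIV \<times> fibre N) F\<^sub>e"
    using spinnable by (simp add: spinnable_family_def smooth_family_iff reflect_ext_def)
  fix p :: "(real \<times> (real ^ 'n)) \<times> (nat \<Rightarrow> real)"
  obtain t x \<eta> where p: "p = ((t, x), \<eta>)" by (metis prod.collapse)
  have "x $ l \<ge> 0 \<Longrightarrow> reflect_vec l x $ l \<ge> 0 \<Longrightarrow> reflect_vec l x = x"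
    by (rule reflect_vec_fixed) (simp add: reflect_vec_def)
  moreover have "x $ l < 0 \<Longrightarrow> reflect_vec l x $ l \<ge> 0" by (simp add: reflect_vec_def)
  ultimately show "F\<^sub>e (scale_coord (spin_axis l) (-1) p) = (-1) ^ 0 * F\<^sub>e p"
    by (auto simp: p scale_coord_spin_axis reflect_ext_def not_le)
qed

lemma smooth_ext: "smooth_on (fam_lines N) (pos_times UNIV \<times> fibre N) F\<^sub>e"
  using even by (simp add: parity_family_def)

lemma half_subset: "D\<^sub>H \<times> fibre N \<subseteq> pos_times UNIV \<times> fibre N"
  by (auto simp: pos_times_def)

text \<open>A derivative of the smooth extension restricts to the one-sided derivative on the
  half-space. Criticality, gradient and regularity of \<open>F\<close> thereby become statements
  about the even extension.\<close>

lemma pderiv_half: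
  assumes c: "c \<in> fam_lines N" and p: "p \<in> D\<^sub>H \<times> fibre N"
  shows "pderiv_on (D\<^sub>H \<times> fibre N) c F p = pderiv_on (pos_times UNIV \<times> fibre N) c F\<^sub>e p"
  by (rule pderiv_on_subset[OF line_domain_pos_times_halfspace half_subset smooth_ext _ c p])
     (auto simp: reflect_ext_def pos_times_def halfspace_def)

lemma pderivs_half:
  assumes c: "c \<in> fam_lines N" and j: "j < N" and p: "p \<in> D\<^sub>H \<times> fibre N"
  shows "pderivs_on (D\<^sub>H \<times> fibre N) [c, fibre_line j] F p =
    pderiv_on (pos_times UNIV \<times> fibre N) c (pderiv_on (pos_times UNIV \<times> fibre N) (fibre_line j) F\<^sub>e) p"
proof -
  have f: "fibre_line j \<in> fam_lines N" using j by (simp add: fam_lines_def)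
  show ?thesis
    using pderiv_on_subset[OF line_domain_pos_times_halfspace half_subset smooth_on_pderiv_on[OF smooth_ext f] _ c p,
        of "pderiv_on (D\<^sub>H \<times> fibre N) (fibre_line j) F"] pderiv_half[OF f] by simp
qed

lemma smooth_spun: "smooth_on (fam_lines N) (pos_times UNIV \<times> fibre N) F\<^sub>s"
  unfolding spun_eq
  using smooth_on_spin[OF reflectible_pos_times even] by (simp add: spin_base_pos_times)

lemma unspin_pt_half:
  "unspin_pt l p \<in> D\<^sub>H \<times> fibre N \<longleftrightarrow> p \<in> pos_times UNIV \<times> fibre N"
  by (cases p) (auto simp: unspin_pt_def pos_times_def halfspace_def unspin_nonneg)

lemma even_fibre_pderiv:
  assumes "j < N"
  shows "parity_family 0 (spin_axis l) (pos_times UNIV) N (pderiv_on (pos_times UNIV \<times> fibre N) (fibre_line j) F\<^sub>e)"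
  using parity_family_pderiv[OF reflectible_pos_times even _ line_weight_fibre] assms
  by (simp add: fam_lines_def)

lemma pderiv_fibre_spun:
  assumes "j < N" "p \<in> pos_times UNIV \<times> fibre N"
  shows "pderiv_on (pos_times UNIV \<times> fibre N) (fibre_line j) F\<^sub>s p =
    pderiv_on (pos_times UNIV \<times> fibre N) (fibre_line j) F\<^sub>e (unspin_pt l p)"
  unfolding spun_eq
  using pderiv_spin_match[OF reflectible_pos_times smooth_ext _ _ line_match_fibre] assms
  by (simp add: spin_base_pos_times fam_lines_def)

lemma pderivs_spun:
  assumes c: "c \<in> fam_lines N" and j: "j < N" and p: "p \<in> pos_times UNIV \<times> fibre N"
  shows "pderivs_on (pos_times UNIV \<times> fibre N) [c, fibre_line j] F\<^sub>s p =
    pderiv_on (pos_times UNIV \<times> fibre N) c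
      (\<lambda>p. pderiv_on (pos_times UNIV \<times> fibre N) (fibre_line j) F\<^sub>e (unspin_pt l p)) p"
proof -
  have "smooth_on (fam_lines N) (pos_times UNIV \<times> fibre N)
      (\<lambda>p. pderiv_on (pos_times UNIV \<times> fibre N) (fibre_line j) F\<^sub>e (unspin_pt l p))"
    using smooth_on_spin[OF reflectible_pos_times even_fibre_pderiv[OF j]] by (simp add: spin_base_pos_times)
  from pderiv_on_subset[OF line_domain_pos_times order_refl this pderiv_fibre_spun[OF j] c p]
  show ?thesis by simp
qed

text \<open>The fibre directions are untouched by spinning, so being critical is decided at the
  unspun point.\<close>

lemma critical_spun:
  "p \<in> fibre_critical (pos_times UNIV) N F\<^sub>s \<longleftrightarrow> unspin_pt l p \<in> fibre_critical D\<^sub>H N F"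
proof (cases "p \<in> pos_times UNIV \<times> fibre N")
  case True
  then have "unspin_pt l p \<in> D\<^sub>H \<times> fibre N" by (simp add: unspin_pt_half)
  then have "pderiv_on (pos_times UNIV \<times> fibre N) (fibre_line j) F\<^sub>s p =
      pderiv_on (D\<^sub>H \<times> fibre N) (fibre_line j) F (unspin_pt l p)" if "j < N" for j
    using pderiv_fibre_spun[OF that True] pderiv_half[of "fibre_line j"] that by (simp add: fam_lines_def)
  then show ?thesis
    using True \<open>unspin_pt l p \<in> _\<close> unfolding fibre_critical_def by simp
next
  case False
  then have "unspin_pt l p \<notin> D\<^sub>H \<times> fibre N" by (simp add: unspin_pt_half)
  then show ?thesis using False unfolding fibre_critical_def by blast
qed

lemma gradient_half:
  assumes p: "p \<in> D\<^sub>H \<times> fibre N"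
  shows "base_gradient D\<^sub>H N F p = base_gradient (pos_times UNIV) N F\<^sub>e p"
  unfolding base_gradient_def using pderiv_half[OF _ p] by (auto simp: fam_lines_def intro!: sum.cong)

lemma spun_point:
  obtains t x \<eta> \<theta> where "p = ((t, spin_vec l \<theta> x), \<eta>)" "unspin_pt l p = ((t, x), \<eta>)" "0 \<le> x $ l"
proof -
  obtain t x' \<eta> where p: "p = ((t, x'), \<eta>)" by (metis prod.collapse)
  obtain \<theta> where "spin_vec l \<theta> (unspin l x') = x'" using spin_vec_unspin by blast
  moreover have "0 \<le> unspin l x' $ l" by (rule unspin_nonneg)
  ultimately show thesis using that[of t \<theta> "unspin l x'" \<eta>] by (simp add: p unspin_pt_def)
qed

lemma gradient_spun:
  assumes "((t, x), \<eta>) \<in> D\<^sub>H \<times> fibre N"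
  shows "base_gradient (pos_times UNIV) N F\<^sub>s ((t, spin_vec l \<theta> x), \<eta>) =
    (fst (base_gradient D\<^sub>H N F ((t, x), \<eta>)), spin_vec l \<theta> (snd (base_gradient D\<^sub>H N F ((t, x), \<eta>))))"
  unfolding gradient_half[OF assms] spun_eq
  by (rule base_gradient_spin[OF even]) (use assms in \<open>auto simp: pos_times_def halfspace_def\<close>)

lemma generates_eq:
  "(t, x, T, X) \<in> L \<longleftrightarrow> (\<exists>\<eta>. ((t, x), \<eta>) \<in> fibre_critical D\<^sub>H N F \<and>
    base_gradient D\<^sub>H N F ((t, x), \<eta>) = (T, X))"
proof -
  have L: "L = {(t, x, base_gradient D\<^sub>H N F ((t, x), \<eta>)) | t x \<eta>. ((t, x), \<eta>) \<in> fibre_critical D\<^sub>H N F}"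
    using generates by (simp add: generates_lagrangian_def)
  show ?thesis unfolding L by (auto dest: sym)
qed

lemma spun_set_eq:
  "spin_lagrangian l L = {(t, x, base_gradient (pos_times UNIV) N F\<^sub>s ((t, x), \<eta>)) | t x \<eta>.
           ((t, x), \<eta>) \<in> fibre_critical (pos_times UNIV) N F\<^sub>s}" (is "_ = ?R")
proof (intro equalityI subsetI)
  fix q assume "q \<in> spin_lagrangian l L"
  then obtain t x T X \<theta> where q: "q = (t, spin_vec l \<theta> x, T, spin_vec l \<theta> X)" and m: "(t, x, T, X) \<in> L"
    unfolding spin_lagrangian_def by blast
  obtain \<eta> where \<eta>: "((t, x), \<eta>) \<in> fibre_critical D\<^sub>H N F"
    "base_gradient D\<^sub>H N F ((t, x), \<eta>) = (T, X)" using m generates_eq by blast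
  have mem: "((t, x), \<eta>) \<in> D\<^sub>H \<times> fibre N" using \<eta>(1) by (simp add: fibre_critical_def)
  then have "unspin_pt l ((t, spin_vec l \<theta> x), \<eta>) = ((t, x), \<eta>)"
    by (simp add: unspin_pt_def unspin_spin_vec pos_times_def halfspace_def)
  then have "((t, spin_vec l \<theta> x), \<eta>) \<in> fibre_critical (pos_times UNIV) N F\<^sub>s"
    using critical_spun \<eta>(1) by simp
  moreover have "base_gradient (pos_times UNIV) N F\<^sub>s ((t, spin_vec l \<theta> x), \<eta>) = (T, spin_vec l \<theta> X)"
    using gradient_spun[OF mem] \<eta>(2) by simp
  ultimately show "q \<in> ?R" unfolding q by force
next
  fix q assume "q \<in> ?R"
  then obtain t' x' \<eta>' where q: "q = (t', x', base_gradient (pos_times UNIV) N F\<^sub>s ((t', x'), \<eta>'))"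
    and c: "((t', x'), \<eta>') \<in> fibre_critical (pos_times UNIV) N F\<^sub>s" by blast
  obtain t x \<eta> \<theta> where p: "((t', x'), \<eta>') = ((t, spin_vec l \<theta> x), \<eta>)"
    "unspin_pt l ((t', x'), \<eta>') = ((t, x), \<eta>)" by (rule spun_point)
  have c': "((t, x), \<eta>) \<in> fibre_critical D\<^sub>H N F" using c critical_spun p(2) by metis
  then have "((t, x), \<eta>) \<in> D\<^sub>H \<times> fibre N" by (simp add: fibre_critical_def)
  from gradient_spun[OF this, of \<theta>]
  have "q = (t, spin_vec l \<theta> x, fst (base_gradient D\<^sub>H N F ((t, x), \<eta>)), spin_vec l \<theta> (snd (base_gradient D\<^sub>H N F ((t, x), \<eta>))))"
    using q p(1) by simp
  moreover have "(t, x, fst (base_gradient D\<^sub>H N F ((t, x), \<eta>)), snd (base_gradient D\<^sub>H N F ((t, x), \<eta>))) \<in> L"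
    unfolding generates_eq using c' by (intro exI[of _ \<eta>]) simp
  ultimately show "q \<in> spin_lagrangian l L" unfolding spin_lagrangian_def by blast
qed

lemma regular_spun: "regular_family (pos_times UNIV) N F\<^sub>s"
  unfolding regular_family_def
proof (intro ballI)
  fix p' :: "(real \<times> (real ^ ('n option))) \<times> (nat \<Rightarrow> real)" and \<omega>
  assume c: "p' \<in> fibre_critical (pos_times UNIV) N F\<^sub>s" and \<omega>: "\<omega> \<in> fibre N"
  let ?A = "pos_times UNIV \<times> fibre N"
  obtain t x \<eta> \<theta> where p: "p' = ((t, spin_vec l \<theta> x), \<eta>)" "unspin_pt l p' = ((t, x), \<eta>)" "0 \<le> x $ l"
    by (rule spun_point)
  have c': "((t, x), \<eta>) \<in> fibre_critical D\<^sub>H N F" using c critical_spun p(2) by metis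
  then have mem: "((t, x), \<eta>) \<in> D\<^sub>H \<times> fibre N" by (simp add: fibre_critical_def)
  have p'A: "p' \<in> pos_times UNIV \<times> fibre N" using c by (simp add: fibre_critical_def)
  have "regular_family D\<^sub>H N F" using generates by (simp add: generates_lagrangian_def)
  then obtain v \<nu> where \<nu>: "\<nu> \<in> fibre N" and eq: "\<And>j. j < N \<Longrightarrow>
      (\<Sum>e\<in>Basis. (v \<bullet> e) * pderivs_on (D\<^sub>H \<times> fibre N) [base_line e, fibre_line j] F ((t, x), \<eta>)) +
      (\<Sum>k<N. \<nu> k * pderivs_on (D\<^sub>H \<times> fibre N) [fibre_line k, fibre_line j] F ((t, x), \<eta>)) = \<omega> j"
    using c' \<omega> unfolding regular_family_def by meson
  \<comment> \<open>The rotated base vector pairs with the rotated gradient of each fibre derivative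
    as \<open>v\<close> does with the original one, since rotation preserves inner products; the
    fibre component \<nu> is kept, so \<omega> is attained again.\<close>
  define v' where "v' = (fst v, spin_vec l \<theta> (snd v))"
  have "(\<Sum>e\<in>Basis. (v' \<bullet> e) * pderivs_on ?A [base_line e, fibre_line j] F\<^sub>s p') +
      (\<Sum>k<N. \<nu> k * pderivs_on ?A [fibre_line k, fibre_line j] F\<^sub>s p') = \<omega> j" if j: "j < N" for j
  proof -
    let ?g = "pderiv_on (pos_times UNIV \<times> fibre N) (fibre_line j) F\<^sub>e"
    have "(\<Sum>e\<in>Basis. (v' \<bullet> e) * pderivs_on ?A [base_line e, fibre_line j] F\<^sub>s p') =
        (\<Sum>e\<in>Basis. (v' \<bullet> e) * pderiv_on ?A (base_line e) (\<lambda>p. ?g (unspin_pt l p)) p')"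
      using pderivs_spun[OF _ j p'A] by (intro sum.cong refl) (simp add: fam_lines_def)
    also have "\<dots> = v' \<bullet> base_gradient (pos_times UNIV) N (\<lambda>p. ?g (unspin_pt l p)) p'"
      by (rule sum_inner_pderiv)
    also have "\<dots> = v \<bullet> base_gradient (pos_times UNIV) N ?g ((t, x), \<eta>)"
      unfolding p(1)
      using base_gradient_spin[OF even_fibre_pderiv[OF j] _ _ p(3), of t \<eta> \<theta>] mem
      by (simp add: v'_def inner_spin_vec inner_prod_def pos_times_def)
    also have "\<dots> = (\<Sum>e\<in>Basis. (v \<bullet> e) * pderiv_on (pos_times UNIV \<times> fibre N) (base_line e) ?g ((t, x), \<eta>))"
      by (rule sum_inner_pderiv[symmetric])
    also have "\<dots> = (\<Sum>e\<in>Basis. (v \<bullet> e) * pderivs_on (D\<^sub>H \<times> fibre N) [base_line e, fibre_line j] F ((t, x), \<eta>))"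
      using pderivs_half[OF _ j mem] by (intro sum.cong refl) (simp add: fam_lines_def)
    finally have 1: "(\<Sum>e\<in>Basis. (v' \<bullet> e) * pderivs_on ?A [base_line e, fibre_line j] F\<^sub>s p') = \<dots>" .
    have 2: "pderivs_on ?A [fibre_line k, fibre_line j] F\<^sub>s p' =
        pderivs_on (D\<^sub>H \<times> fibre N) [fibre_line k, fibre_line j] F ((t, x), \<eta>)" if k: "k < N" for k
    proof -
      have sg: "smooth_on (fam_lines N) (pos_times UNIV \<times> fibre N) ?g"
        using even_fibre_pderiv[OF j] by (simp add: parity_family_def)
      have fl: "fibre_line k \<in> fam_lines N" "fibre_line k \<in> fam_lines N" using k by (auto simp: fam_lines_def)
      show ?thesis
        unfolding pderivs_spun[OF fl(1) j p'A] pderivs_half[OF fl(2) j mem]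
        using pderiv_spin_match[OF reflectible_pos_times sg fl(2) fl(1) line_match_fibre] p'A p(2)
        by (simp add: spin_base_pos_times)
    qed
    show ?thesis using eq[OF j] 1 2 by simp
  qed
  then show "\<exists>v. \<exists>\<nu>\<in>fibre N. \<forall>j<N.
       (\<Sum>e\<in>Basis. (v \<bullet> e) * pderivs_on ?A [base_line e, fibre_line j] F\<^sub>s p') +
       (\<Sum>k<N. \<nu> k * pderivs_on ?A [fibre_line k, fibre_line j] F\<^sub>s p') = \<omega> j"
    using \<nu> by blast
qed

theorem generates_spun: "generates_lagrangian UNIV N F\<^sub>s (spin_lagrangian l L)"
  unfolding generates_lagrangian_def smooth_family_iff
  using smooth_spun regular_spun spun_set_eq by blast

text \<open>An even family has vanishing normal derivative.\<close>

lemma normal_momentum_zero: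
  assumes "(t, x, T, X) \<in> L" "x $ l = 0"
  shows "X $ l = 0"
proof -
  obtain \<eta> where \<eta>: "((t, x), \<eta>) \<in> fibre_critical D\<^sub>H N F"
    "base_gradient D\<^sub>H N F ((t, x), \<eta>) = (T, X)" using assms(1) generates_eq by blast
  then have p: "((t, x), \<eta>) \<in> D\<^sub>H \<times> fibre N" by (simp add: fibre_critical_def)
  have b: "spin_axis l \<in> Basis" by (simp add: spin_axis_def)
  have "parity_family (0 + 1) (spin_axis l) (pos_times UNIV) N
      (pderiv_on (pos_times UNIV \<times> fibre N) (base_line (spin_axis l)) F\<^sub>e)"
    by (rule parity_family_pderiv[OF reflectible_pos_times even _ line_weight_base_same[OF b]])
       (simp add: fam_lines_def b)
  then have odd: "parity_family 1 (spin_axis l) (pos_times UNIV) N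
      (pderiv_on (pos_times UNIV \<times> fibre N) (base_line (spin_axis l)) F\<^sub>e)" by simp
  have pA: "((t, x), \<eta>) \<in> pos_times UNIV \<times> fibre N" using p half_subset by blast
  have "pderiv_on (pos_times UNIV \<times> fibre N) (base_line (spin_axis l)) F\<^sub>e ((t, x), \<eta>) = 0"
    by (rule odd_family_zero[OF odd pA]) (simp add: inner_spin_axis assms(2))
  then show ?thesis
    using \<eta>(2) gradient_half[OF p] base_gradient_components(2)[of "pos_times UNIV" N F\<^sub>e "((t, x), \<eta>)" l]
    by (simp add: spin_axis_def)
qed

end

section \<open>Legendrian ends of a generating family\<close>

text \<open>The library's \<open>sum_Basis_prod_eq\<close> requires the summands to lie in the product space itself.\<close>

lemma sum_Basis_prod:
  fixes f :: "'a::euclidean_space \<times> 'b::euclidean_space \<Rightarrow> 'c::comm_monoid_add"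
  shows "sum f Basis = (\<Sum>i\<in>Basis. f (i, 0)) + (\<Sum>i\<in>Basis. f (0, i))"
proof -
  have "inj_on (\<lambda>u. (u :: 'a, 0 :: 'b)) Basis" "inj_on (\<lambda>u. (0 :: 'a, u :: 'b)) Basis"
    by (auto intro!: inj_onI)
  then show ?thesis
    unfolding Basis_prod_def by (subst sum.union_disjoint) (auto simp: sum.reindex)
qed

text \<open>On a slice \<open>G\<close> is \<open>t\<close> times \<open>g\<close>, and lines of the
  slice are lines of the whole space. Applied with a fibre derivative in place of \<open>G\<close>,
  the lemma also yields the second derivatives.\<close>

lemma slice_pderiv:
  fixes G :: "(real \<times> (real ^ 'm::finite)) \<times> (nat \<Rightarrow> real) \<Rightarrow> real"
  assumes t: "0 < t" and G: "smooth_on (fam_lines N) (pos_times UNIV \<times> fibre N) G"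
    and g: "\<And>p. p \<in> UNIV \<times> fibre N \<Longrightarrow> t * g p = G ((t, fst p), snd p)"
    and c: "c \<in> fam_lines N" "c' \<in> fam_lines N" "\<And>p h. ((t, fst (c p h)), snd (c p h)) = c' ((t, fst p), snd p) h"
    and p: "p \<in> UNIV \<times> fibre N"
  shows "t * pderiv_on (UNIV \<times> fibre N) c g p = pderiv_on (pos_times UNIV \<times> fibre N) c' G ((t, fst p), snd p)"
proof -
  let ?\<Phi> = "\<lambda>p. ((t, fst p), snd p)" and ?B = "UNIV \<times> fibre N"
  have dom: "line_domain (fam_lines N) (UNIV \<times> fibre N :: ((real ^ 'm) \<times> (nat \<Rightarrow> real)) set)"
    by (rule line_domain_family[OF open_UNIV])
  have "?\<Phi> p \<in> pos_times UNIV \<times> fibre N" using t p by (auto simp: pos_times_def)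
  from smooth_on_has_pderiv[OF G c(2) this]
  have "has_pderiv ?B c (\<lambda>p. G (?\<Phi> p)) (pderiv_on (pos_times UNIV \<times> fibre N) c' G (?\<Phi> p)) p"
    by (rule has_pderiv_pullback) (use t p c(3) line_domainD(1)[OF dom c(1) p] in \<open>auto simp: pos_times_def\<close>)
  from has_pderiv_bounded_linear[OF bounded_linear_mult_right this, of "1 / t"]
  have "has_pderiv ?B c (\<lambda>p. (1 / t) * G (?\<Phi> p)) ((1 / t) * pderiv_on (pos_times UNIV \<times> fibre N) c' G (?\<Phi> p)) p" .
  moreover have g_eq: "g q = (1 / t) * G (?\<Phi> q)" if "q \<in> ?B" for q
    using g[OF that] t by (simp add: field_simps)
  ultimately have "has_pderiv ?B c g ((1 / t) * pderiv_on (pos_times UNIV \<times> fibre N) c' G (?\<Phi> p)) p"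
    using has_pderiv_cong[OF dom c(1) p g_eq] by simp
  from has_pderiv_pderiv_on_eq[OF dom c(1) p this] show ?thesis using t by simp
qed

text \<open>For \<open>F = t * f\<close> the gradient at time \<open>t\<close> is
  \<open>(f, t * grad f)\<close> and the fibre derivative is \<open>t\<close> times that of
  \<open>f\<close>, so the critical points agree and the cylinder coordinates of the generated point
  are \<open>(x, grad f, f)\<close>. An open interval of times is needed for the time
  derivative.\<close>

theorem generates_legendrian_slice:
  fixes F :: "(real \<times> (real ^ 'm::finite)) \<times> (nat \<Rightarrow> real) \<Rightarrow> real"
  assumes gen: "generates_lagrangian UNIV N F L" and I: "open I" "t1 \<in> I" "I \<subseteq> {0<..}"
    and Ff: "\<And>t x \<eta>. t \<in> I \<Longrightarrow> \<eta> \<in> fibre N \<Longrightarrow> F ((t, x), \<eta>) = t * f (x, \<eta>)"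
    and cyl: "\<And>t x T X. t \<in> I \<Longrightarrow> (t, x, T, X) \<in> L \<longleftrightarrow> (x, (1 / t) *\<^sub>R X, T) \<in> \<Lambda>"
  shows "generates_legendrian UNIV N f \<Lambda>"
proof -
  let ?A = "pos_times UNIV \<times> fibre N" and ?B = "UNIV \<times> fibre N"
  have pos: "0 < t" if "t \<in> I" for t using I(3) that by auto
  note t1 = pos[OF I(2)]
  have sF: "smooth_on (fam_lines N) ?A F" using gen by (simp add: generates_lagrangian_def smooth_family_iff)
  have domB: "line_domain (fam_lines N) (?B :: ((real ^ 'm) \<times> (nat \<Rightarrow> real)) set)"
    by (rule line_domain_family[OF open_UNIV])
  have base: "base_line e \<in> fam_lines N" "base_line (0, e) \<in> fam_lines N" if "e \<in> Basis" for e :: "real ^ 'm"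
    using that by (auto simp: fam_lines_def Basis_prod_def)
  have fib: "fibre_line j \<in> fam_lines N" "fibre_line j \<in> fam_lines N" if "j < N" for j
    using that by (auto simp: fam_lines_def)
  have base_c: "((t, fst (base_line e p h)), snd (base_line e p h)) = base_line (0, e) ((t, fst p), snd p) h"
    for t h :: real and e :: "real ^ 'm" and p :: "(real ^ 'm) \<times> (nat \<Rightarrow> real)"
    by (simp add: base_line_def)
  have fib_c: "((t, fst (fibre_line j p h)), snd (fibre_line j p h)) = fibre_line j ((t, fst p), snd p) h"
    for t h :: real and j and p :: "(real ^ 'm) \<times> (nat \<Rightarrow> real)"
    by (simp add: fibre_line_def)
  have f_eq: "t * f p = F ((t, fst p), snd p)" if "t \<in> I" "p \<in> ?B" for t p
    using Ff[OF that(1), of "snd p" "fst p"] that(2) by (auto simp: mem_Times_iff)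
  have df_base: "t1 * pderiv_on ?B (base_line e) f p = pderiv_on ?A (base_line (0, e)) F ((t1, fst p), snd p)"
    if "e \<in> Basis" "p \<in> ?B" for e p
    by (rule slice_pderiv[OF t1 sF f_eq[OF I(2)] base[OF that(1)] base_c that(2)])
  have df_fib: "t * pderiv_on ?B (fibre_line j) f p = pderiv_on ?A (fibre_line j) F ((t, fst p), snd p)"
    if "t \<in> I" "j < N" "p \<in> ?B" for t j p
    by (rule slice_pderiv[OF pos[OF that(1)] sF f_eq[OF that(1)] fib[OF that(2)] fib_c that(3)])
  let ?F' = "\<lambda>j. pderiv_on ?A (fibre_line j) F"
  have sF': "smooth_on (fam_lines N) ?A (?F' j)" if "j < N" for j
    by (rule smooth_on_pderiv_on[OF sF fib(2)[OF that]])
  have ddf_base: "t1 * pderivs_on ?B [base_line e, fibre_line j] f p =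
      pderivs_on ?A [base_line (0, e), fibre_line j] F ((t1, fst p), snd p)"
    if "e \<in> Basis" "j < N" "p \<in> ?B" for e j p
    using slice_pderiv[OF t1 sF'[OF that(2)] df_fib[OF I(2) that(2)] base[OF that(1)] base_c that(3)] by simp
  have ddf_fib: "t1 * pderivs_on ?B [fibre_line k, fibre_line j] f p =
      pderivs_on ?A [fibre_line k, fibre_line j] F ((t1, fst p), snd p)"
    if "k < N" "j < N" "p \<in> ?B" for k j p
    using slice_pderiv[OF t1 sF'[OF that(2)] df_fib[OF I(2) that(2)] fib[OF that(1)] fib_c that(3)] by simp
  have time: "pderiv_on ?A (base_line (1, 0)) G ((t1, x), \<eta>) = k"
    if G: "\<And>t. t \<in> I \<Longrightarrow> G ((t, x), \<eta>) = t * k" and \<eta>: "\<eta> \<in> fibre N"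
    for G :: "(real \<times> (real ^ 'm)) \<times> (nat \<Rightarrow> real) \<Rightarrow> real" and k x \<eta>
  proof (rule has_pderiv_pderiv_on_eq[OF line_domain_pos_times])
    have "((\<lambda>h. (t1 + h) * k) has_vector_derivative k) (at 0)"
      by (auto intro!: derivative_eq_intros simp: has_real_derivative_iff_has_vector_derivative[symmetric])
    moreover have "open {h. t1 + h \<in> I}" using open_line_vimage[OF I(1), of t1 1] by simp
    ultimately have "((\<lambda>h. G ((t1 + h, x), \<eta>)) has_vector_derivative k) (at 0)"
      by (rule has_vector_derivative_transform_within_open) (use I(2) G in auto)
    then show "has_pderiv ?A (base_line (1, 0)) G k ((t1, x), \<eta>)"
      unfolding has_pderiv_def by (simp add: base_line_def has_vector_derivative_at_within)
    show "base_line (1 :: real, 0 :: real ^ 'm) \<in> fam_lines N" unfolding fam_lines_def by (intro UnI1 imageI Basis_cot)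
    show "((t1, x), \<eta>) \<in> ?A" using t1 \<eta> by (simp add: pos_times_def)
  qed
  have dF_time: "pderiv_on ?A (base_line (1, 0)) F ((t1, fst p), snd p) = f p" if "p \<in> ?B" for p
    by (rule time) (use f_eq that in auto)
  have ddF_time: "pderivs_on ?A [base_line (1, 0), fibre_line j] F ((t1, fst p), snd p) = pderiv_on ?B (fibre_line j) f p"
    if "j < N" "p \<in> ?B" for j p
    by (simp, rule time) (use df_fib[OF _ that] that in auto)
  have crit: "p \<in> fibre_critical UNIV N f \<longleftrightarrow> ((t1, fst p), snd p) \<in> fibre_critical (pos_times UNIV) N F" for p
  proof (cases "p \<in> ?B")
    case True
    then have "((t1, fst p), snd p) \<in> ?A" using t1 by (auto simp: pos_times_def)
    moreover have "pderiv_on ?B (fibre_line j) f p = 0 \<longleftrightarrow> ?F' j ((t1, fst p), snd p) = 0" if "j < N" for j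
      using df_fib[OF I(2) that True] t1 by auto
    ultimately show ?thesis using True by (simp add: fibre_critical_def)
  qed (auto simp: fibre_critical_def mem_Times_iff)
  have grad: "base_gradient (pos_times UNIV) N F ((t1, fst p), snd p) = (f p, t1 *\<^sub>R base_gradient UNIV N f p)"
    if p: "p \<in> ?B" for p
  proof (rule prod_eqI)
    show "fst (base_gradient (pos_times UNIV) N F ((t1, fst p), snd p)) = fst (f p, t1 *\<^sub>R base_gradient UNIV N f p)"
      using dF_time[OF p] by (simp add: base_gradient_components)
    show "snd (base_gradient (pos_times UNIV) N F ((t1, fst p), snd p)) = snd (f p, t1 *\<^sub>R base_gradient UNIV N f p)"
    proof (rule vec_eq_iff[THEN iffD2], rule allI)
      fix i
      have "base_gradient UNIV N f p $ i = pderiv_on ?B (base_line (axis i 1)) f p"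
        using base_gradient_inner[of "axis i 1" UNIV N f p] by (simp add: inner_axis)
      then show "snd (base_gradient (pos_times UNIV) N F ((t1, fst p), snd p)) $ i = snd (f p, t1 *\<^sub>R base_gradient UNIV N f p) $ i"
        using df_base[OF _ p, of "axis i 1"] by (simp add: base_gradient_components)
    qed
  qed
  have smooth: "smooth_on (fam_lines N) ?B f"
  proof (rule smooth_on_cong[OF domB])
    show "smooth_on (fam_lines N) ?B (\<lambda>p. (1 / t1) * F ((t1, fst p), snd p))"
    proof (rule smooth_on_bounded_linear[OF domB bounded_linear_mult_right],
        rule smooth_on_pullback[OF domB _ _ sF])
      show "(\<lambda>p. ((t1, fst p), snd p)) ` ?B \<subseteq> ?A" using t1 by (auto simp: pos_times_def)
      fix c :: "(real ^ 'm) \<times> (nat \<Rightarrow> real) \<Rightarrow> real \<Rightarrow> (real ^ 'm) \<times> (nat \<Rightarrow> real)"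
      assume "c \<in> fam_lines N"
      then have "\<exists>c'\<in>fam_lines N. \<forall>p h. ((t1, fst (c p h)), snd (c p h)) = c' ((t1, fst p), snd p) h"
      proof (cases rule: fam_linesE)
        case (1 e)
        then show ?thesis using base(2)[OF 1(1)] base_c by blast
      next
        case (2 j)
        then show ?thesis using fib(2)[OF 2(1)] fib_c by blast
      qed
      then show "(\<exists>c'\<in>fam_lines N. \<forall>p\<in>?B. \<forall>h. c p h \<in> ?B \<longrightarrow> ((t1, fst (c p h)), snd (c p h)) = c' ((t1, fst p), snd p) h) \<or>
          (\<forall>p\<in>?B. \<forall>h. c p h \<in> ?B \<longrightarrow> ((t1, fst (c p h)), snd (c p h)) = ((t1, fst p), snd p))"
        by blast
    qed (intro continuous_on_Pair continuous_on_const continuous_on_fst continuous_on_snd continuous_on_id)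
    show "(1 / t1) * F ((t1, fst p), snd p) = f p" if "p \<in> ?B" for p
      using f_eq[OF I(2) that] t1 by (simp add: field_simps)
  qed
  have regular: "regular_family UNIV N f"
    unfolding regular_family_def
  proof (intro ballI)
    fix p \<omega> assume p: "p \<in> fibre_critical UNIV N f" and \<omega>: "\<omega> \<in> fibre N"
    have pB: "p \<in> ?B" and zero: "\<And>j. j < N \<Longrightarrow> pderiv_on ?B (fibre_line j) f p = 0"
      using p by (auto simp: fibre_critical_def)
    \<comment> \<open>The second derivatives of \<open>F\<close> on the slice are \<open>t1\<close>
      times those of \<open>f\<close>, so the target is scaled by \<open>t1\<close> before
      regularity of \<open>F\<close> is used.\<close>
    have "(\<lambda>j. t1 * \<omega> j) \<in> fibre N" using \<omega> by (auto simp: fibre_def)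
    then obtain v \<nu> where \<nu>: "\<nu> \<in> fibre N" and eq: "\<And>j. j < N \<Longrightarrow>
        (\<Sum>e\<in>Basis. (v \<bullet> e) * pderivs_on ?A [base_line e, fibre_line j] F ((t1, fst p), snd p)) +
        (\<Sum>k<N. \<nu> k * pderivs_on ?A [fibre_line k, fibre_line j] F ((t1, fst p), snd p)) = t1 * \<omega> j"
      using gen p crit unfolding generates_lagrangian_def regular_family_def by meson
    have "(\<Sum>e\<in>Basis. (snd v \<bullet> e) * pderivs_on ?B [base_line e, fibre_line j] f p) +
        (\<Sum>k<N. \<nu> k * pderivs_on ?B [fibre_line k, fibre_line j] f p) = \<omega> j" if j: "j < N" for j
    proof -
      \<comment> \<open>The time component of \<open>v\<close> contributes nothing: the mixed
        derivative in time and fibre is the fibre derivative of \<open>f\<close>, zero at a critical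
        point. Hence regularity passes to the slice.\<close>
      have "(\<Sum>e\<in>Basis. (v \<bullet> e) * pderivs_on ?A [base_line e, fibre_line j] F ((t1, fst p), snd p)) =
          (\<Sum>e\<in>Basis. (snd v \<bullet> e) * pderivs_on ?A [base_line (0, e), fibre_line j] F ((t1, fst p), snd p))"
        using ddF_time[OF j pB] zero[OF j]
        by (subst sum_Basis_prod) (simp del: pderivs_on.simps add: inner_prod_def)
      also have "\<dots> = t1 * (\<Sum>e\<in>Basis. (snd v \<bullet> e) * pderivs_on ?B [base_line e, fibre_line j] f p)"
        unfolding sum_distrib_left
        by (intro sum.cong refl) (use ddf_base[OF _ j pB] in \<open>simp del: pderivs_on.simps add: mult.left_commute\<close>)
      finally have 1: "(\<Sum>e\<in>Basis. (v \<bullet> e) * pderivs_on ?A [base_line e, fibre_line j] F ((t1, fst p), snd p)) = \<dots>" .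
      have 2: "(\<Sum>k<N. \<nu> k * pderivs_on ?A [fibre_line k, fibre_line j] F ((t1, fst p), snd p)) =
          t1 * (\<Sum>k<N. \<nu> k * pderivs_on ?B [fibre_line k, fibre_line j] f p)"
        unfolding sum_distrib_left
        by (intro sum.cong refl) (use ddf_fib[OF _ j pB] in \<open>simp del: pderivs_on.simps add: mult.left_commute\<close>)
      show ?thesis using eq[OF j] t1 unfolding 1 2 distrib_left[symmetric] by simp
    qed
    then show "\<exists>v. \<exists>\<nu>\<in>fibre N. \<forall>j<N.
        (\<Sum>e\<in>Basis. (v \<bullet> e) * pderivs_on ?B [base_line e, fibre_line j] f p) +
        (\<Sum>k<N. \<nu> k * pderivs_on ?B [fibre_line k, fibre_line j] f p) = \<omega> j"
      using \<nu> by blast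
  qed
  have L: "L = {(t, x, base_gradient (pos_times UNIV) N F ((t, x), \<eta>)) | t x \<eta>.
      ((t, x), \<eta>) \<in> fibre_critical (pos_times UNIV) N F}"
    using gen by (simp add: generates_lagrangian_def)
  have "(x, y, z) \<in> \<Lambda> \<longleftrightarrow> (\<exists>\<eta>. (x, \<eta>) \<in> fibre_critical UNIV N f \<and> y = base_gradient UNIV N f (x, \<eta>) \<and> z = f (x, \<eta>))" for x y z
  proof -
    have "(x, y, z) \<in> \<Lambda> \<longleftrightarrow> (t1, x, z, t1 *\<^sub>R y) \<in> L" using cyl[OF I(2)] t1 by simp
    also have "\<dots> \<longleftrightarrow> (\<exists>\<eta>. ((t1, x), \<eta>) \<in> fibre_critical (pos_times UNIV) N F \<and>
        (z, t1 *\<^sub>R y) = base_gradient (pos_times UNIV) N F ((t1, x), \<eta>))"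
      unfolding L by auto
    also have "\<dots> \<longleftrightarrow> (\<exists>\<eta>. (x, \<eta>) \<in> fibre_critical UNIV N f \<and> (z, t1 *\<^sub>R y) = (f (x, \<eta>), t1 *\<^sub>R base_gradient UNIV N f (x, \<eta>)))"
    proof (rule ex_cong1, rule conj_cong)
      fix \<eta>
      show "((t1, x), \<eta>) \<in> fibre_critical (pos_times UNIV) N F \<longleftrightarrow> (x, \<eta>) \<in> fibre_critical UNIV N f"
        using crit[of "(x, \<eta>)"] by simp
      assume "(x, \<eta>) \<in> fibre_critical UNIV N f"
      then have "(x, \<eta>) \<in> ?B" by (simp add: fibre_critical_def)
      from grad[OF this] show "(z, t1 *\<^sub>R y) = base_gradient (pos_times UNIV) N F ((t1, x), \<eta>) \<longleftrightarrow>
          (z, t1 *\<^sub>R y) = (f (x, \<eta>), t1 *\<^sub>R base_gradient UNIV N f (x, \<eta>))" by simp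
    qed
    finally show ?thesis using t1 by auto
  qed
  then have "\<Lambda> = {(x, base_gradient UNIV N f (x, \<eta>), f (x, \<eta>)) | x \<eta>. (x, \<eta>) \<in> fibre_critical UNIV N f}"
    by auto
  then show ?thesis
    unfolding generates_legendrian_def smooth_family_iff using smooth regular by blast
qed

section \<open>The spun Lagrangian away from the axis\<close>

definition spin_cot ::
  "'n::finite \<Rightarrow> real \<Rightarrow> real \<times> (real ^ 'n) \<times> real \<times> (real ^ 'n) \<Rightarrow>
   real \<times> (real ^ ('n option)) \<times> real \<times> (real ^ ('n option))" where
  "spin_cot l \<theta> q =
    (fst q, spin_vec l \<theta> (fst (snd q)), fst (snd (snd q)), spin_vec l \<theta> (snd (snd (snd q))))"

lemma spin_cot_simp: "spin_cot l \<theta> (t, x, T, X) = (t, spin_vec l \<theta> x, T, spin_vec l \<theta> X)"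
  by (simp add: spin_cot_def)

lemma spin_lagrangian_iff: "q' \<in> spin_lagrangian l L \<longleftrightarrow> (\<exists>\<theta>. \<exists>q\<in>L. q' = spin_cot l \<theta> q)"
proof
  assume "q' \<in> spin_lagrangian l L"
  then obtain t x T X \<theta> where "q' = (t, spin_vec l \<theta> x, T, spin_vec l \<theta> X)" "(t, x, T, X) \<in> L"
    unfolding spin_lagrangian_def by blast
  then show "\<exists>\<theta>. \<exists>q\<in>L. q' = spin_cot l \<theta> q" using spin_cot_simp by metis
next
  assume "\<exists>\<theta>. \<exists>q\<in>L. q' = spin_cot l \<theta> q"
  then obtain \<theta> t x T X where "(t, x, T, X) \<in> L" "q' = spin_cot l \<theta> (t, x, T, X)"
    by (metis prod.collapse)
  then show "q' \<in> spin_lagrangian l L" unfolding spin_lagrangian_def spin_cot_simp by blast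
qed

text \<open>The derivative of \<open>spin_vec l \<theta> x\<close> with respect to \<theta>, that
  is, the direction of rotation.\<close>

definition spin_turn :: "'n::finite \<Rightarrow> real \<Rightarrow> real ^ 'n \<Rightarrow> real ^ ('n option)" where
  "spin_turn l \<theta> x = (x $ l) *\<^sub>R (- sin \<theta> *\<^sub>R axis (Some l) 1 + cos \<theta> *\<^sub>R axis None 1)"

definition turn_cot ::
  "'n::finite \<Rightarrow> real \<Rightarrow> real \<times> (real ^ 'n) \<times> real \<times> (real ^ 'n) \<Rightarrow>
   real \<times> (real ^ ('n option)) \<times> real \<times> (real ^ ('n option))" where
  "turn_cot l \<theta> q = (0, spin_turn l \<theta> (fst (snd q)), 0, spin_turn l \<theta> (snd (snd (snd q))))"

text \<open>Rotation back by \<theta> followed by forgetting the new coordinate. It is a left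
  inverse of \<open>spin_vec l \<theta>\<close> and kills the direction of rotation, so it separates
  the two kinds of tangent vectors of the spun set.\<close>

definition unrot_vec :: "'n::finite \<Rightarrow> real \<Rightarrow> real ^ ('n option) \<Rightarrow> real ^ 'n" where
  "unrot_vec l \<theta> x = (\<chi> j. if j = l then cos \<theta> * x $ Some l + sin \<theta> * x $ None else x $ Some j)"

definition unrot_cot ::
  "'n::finite \<Rightarrow> real \<Rightarrow> real \<times> (real ^ ('n option)) \<times> real \<times> (real ^ ('n option)) \<Rightarrow>
   real \<times> (real ^ 'n) \<times> real \<times> (real ^ 'n)" where
  "unrot_cot l \<theta> q =
    (fst q, unrot_vec l \<theta> (fst (snd q)), fst (snd (snd q)), unrot_vec l \<theta> (snd (snd (snd q))))"

lemma linear_unrot_vec: "linear (unrot_vec l \<theta>)"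
  by (rule linearI) (auto simp: unrot_vec_def vec_eq_iff algebra_simps)

lemma linear_unrot_cot: "linear (unrot_cot l \<theta>)"
  by (rule linearI)
     (simp_all add: unrot_cot_def linear_add[OF linear_unrot_vec] linear_scale[OF linear_unrot_vec])

lemma linear_spin_cot: "linear (spin_cot l \<theta>)"
  by (rule linearI)
     (simp_all add: spin_cot_def linear_add[OF linear_spin_vec] linear_scale[OF linear_spin_vec])

lemma cos_sin_mult: "cos \<theta> * (cos \<theta> * a) + sin \<theta> * (sin \<theta> * a) = (a :: real)"
  using sin_cos_squared_add[of \<theta>] by algebra

lemma unrot_spin_vec: "unrot_vec l \<theta> (spin_vec l \<theta> x) = x"
  using cos_sin_mult[of \<theta> "x $ l"]
  by (auto simp: unrot_vec_def spin_vec_def vec_eq_iff mult.commute[of "x $ l"])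

lemma unrot_spin_turn: "unrot_vec l \<theta> (spin_turn l \<theta> x) = 0"
  by (auto simp: unrot_vec_def spin_turn_def vec_eq_iff axis_def)

lemma unrot_spin_cot: "unrot_cot l \<theta> (spin_cot l \<theta> q) = q"
  by (simp add: unrot_cot_def spin_cot_def unrot_spin_vec)

lemma unrot_turn_cot: "unrot_cot l \<theta> (turn_cot l \<theta> q) = 0"
  by (simp add: unrot_cot_def turn_cot_def unrot_spin_turn zero_prod_def)

lemma spin_turn_eq_0: "spin_turn l \<theta> x = 0 \<longleftrightarrow> x $ l = 0"
proof
  assume z: "spin_turn l \<theta> x = 0"
  have "(x $ l * sin \<theta>)\<^sup>2 + (x $ l * cos \<theta>)\<^sup>2 = (x $ l)\<^sup>2 * ((sin \<theta>)\<^sup>2 + (cos \<theta>)\<^sup>2)"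
    by (simp only: power_mult_distrib distrib_left)
  moreover have "x $ l * sin \<theta> = 0" "x $ l * cos \<theta> = 0"
    using arg_cong[OF z, of "\<lambda>v. v $ Some l"] arg_cong[OF z, of "\<lambda>v. v $ None"]
    by (auto simp: spin_turn_def axis_def)
  ultimately show "x $ l = 0" by simp
qed (simp add: spin_turn_def)

lemma inner_spin_turn:
  "spin_vec l \<theta> x \<bullet> spin_turn l \<theta> y = 0" "spin_turn l \<theta> x \<bullet> spin_vec l \<theta> y = 0"
  "spin_turn l \<theta> x \<bullet> spin_turn l \<theta> y = x $ l * y $ l"
proof -
  show "spin_turn l \<theta> x \<bullet> spin_turn l \<theta> y = x $ l * y $ l"
    unfolding spin_turn_def
    by (simp add: inner_add_left inner_add_right inner_axis_axis cos_sin_mult algebra_simps)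
  have *: "spin_vec l \<theta> x \<bullet> spin_turn l \<theta> y = 0" for x y
    by (simp add: spin_turn_def inner_add_right inner_axis spin_vec_def algebra_simps)
  then show "spin_vec l \<theta> x \<bullet> spin_turn l \<theta> y = 0" .
  show "spin_turn l \<theta> x \<bullet> spin_vec l \<theta> y = 0" using *[of y x] by (simp add: inner_commute)
qed

lemma symp_eq:
  "symp p q = fst p * fst (snd (snd q)) - fst q * fst (snd (snd p)) +
    (fst (snd p) \<bullet> snd (snd (snd q)) - fst (snd q) \<bullet> snd (snd (snd p)))"
  by (cases p; cases q) simp

text \<open>The direction of rotation is orthogonal to all rotated vectors, in position and in
  momentum, which removes the mixed terms. The two rotational terms are multiples of one vector and
  cancel by antisymmetry.\<close>

lemma symp_spin:
  "symp (spin_cot l \<theta> a + r *\<^sub>R turn_cot l \<theta> q) (spin_cot l \<theta> b + s *\<^sub>R turn_cot l \<theta> q) = symp a b"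
  by (simp add: symp_eq spin_cot_def turn_cot_def inner_add_left inner_add_right inner_spin_vec
      inner_spin_turn algebra_simps)

section \<open>Smoothness and derivative of a rotated point\<close>

lemma smooth_on_Pair:
  fixes f :: "_ \<Rightarrow> 'a::euclidean_space" and g :: "_ \<Rightarrow> 'b::euclidean_space"
  assumes dom: "line_domain C A" and f: "smooth_on C A f" and g: "smooth_on C A g"
  shows "smooth_on C A (\<lambda>p. (f p, g p))"
proof (rule smooth_on_componentwise[OF dom])
  fix b :: "'a \<times> 'b" assume "b \<in> Basis"
  then consider u where "b = (u, 0)" | v where "b = (0, v)" by (auto simp: Basis_prod_def)
  then show "smooth_on C A (\<lambda>p. (f p, g p) \<bullet> b)"
    by cases (simp_all add: smooth_on_bounded_linear[OF dom bounded_linear_inner_left] f g)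
qed

lemma smooth_on_vec:
  fixes f :: "_ \<Rightarrow> real ^ 'm::finite"
  assumes dom: "line_domain C A" and f: "\<And>i. smooth_on C A (\<lambda>p. f p $ i)"
  shows "smooth_on C A f"
proof (rule smooth_on_componentwise[OF dom])
  fix b :: "real ^ 'm" assume "b \<in> Basis"
  then obtain i where "b = axis i 1" by (auto simp: Basis_vec_def)
  then show "smooth_on C A (\<lambda>p. f p \<bullet> b)" using f by (simp add: inner_axis)
qed

lemma smooth_on_nth:
  fixes f :: "_ \<Rightarrow> real ^ 'm::finite"
  shows "line_domain C A \<Longrightarrow> smooth_on C A f \<Longrightarrow> smooth_on C A (\<lambda>p. f p $ i)"
  by (rule smooth_on_bounded_linear[OF _ bounded_linear_vec_nth])

lemma smooth_on_sin_cos: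
  assumes dom: "line_domain C A" and f: "smooth_on C A f"
  shows "smooth_on C A (\<lambda>p. sin (f p :: real))" "smooth_on C A (\<lambda>p. cos (f p))"
proof -
  have dU: "line_domain (line ` (Basis :: real set)) UNIV" by (rule line_domain_line_open[OF open_UNIV])
  have "smooth_on (line ` Basis) UNIV h" if "gen_alg {sin, cos :: real \<Rightarrow> real} h" for h
  proof (rule smooth_on_gen_alg[OF dU _ _ that])
    fix g :: "real \<Rightarrow> real" and c :: "real \<Rightarrow> real \<Rightarrow> real"
    assume g: "g \<in> {sin, cos}" and c: "c \<in> line ` Basis"
    then have c_eq: "c = (\<lambda>p h. p + h)" by (auto simp: line_def fun_eq_iff)
    have s: "has_pderiv UNIV c sin (cos p) p" for p
      unfolding has_pderiv_def c_eq has_real_derivative_iff_has_vector_derivative[symmetric]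
      by (auto intro!: derivative_eq_intros)
    have k: "has_pderiv UNIV c cos (- sin p) p" for p
      unfolding has_pderiv_def c_eq has_real_derivative_iff_has_vector_derivative[symmetric]
      by (auto intro!: derivative_eq_intros)
    have "gen_alg {sin, cos :: real \<Rightarrow> real} cos" "gen_alg {sin, cos :: real \<Rightarrow> real} (\<lambda>p. - sin p)"
      by (auto intro: gen_alg.gen gen_alg_uminus)
    then show "\<exists>g'. gen_alg {sin, cos} g' \<and> (\<forall>p\<in>UNIV. has_pderiv UNIV c g (g' p) p)"
      using g s k by auto
  qed (auto intro: continuous_intros)
  then have "smooth_on (line ` Basis) UNIV (sin :: real \<Rightarrow> real)" "smooth_on (line ` Basis) UNIV (cos :: real \<Rightarrow> real)"
    by (auto intro: gen_alg.gen)
  then show "smooth_on C A (\<lambda>p. sin (f p))" "smooth_on C A (\<lambda>p. cos (f p))"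
    by (auto intro: smooth_on_compose_real[OF dom open_UNIV _ f])
qed

lemma smooth_on_spin_vec:
  assumes dom: "line_domain C A" and x: "smooth_on C A x" and \<theta>: "smooth_on C A \<theta>"
  shows "smooth_on C A (\<lambda>p. spin_vec l (\<theta> p) (x p))"
proof (rule smooth_on_vec[OF dom])
  fix i :: "'b option"
  note x' = smooth_on_nth[OF dom x] and sc = smooth_on_sin_cos[OF dom \<theta>]
  consider "i = None" | "i = Some l" | j where "i = Some j" "j \<noteq> l" by (cases i) auto
  then show "smooth_on C A (\<lambda>p. spin_vec l (\<theta> p) (x p) $ i)"
    by cases (simp_all add: spin_vec_def smooth_on_mult[OF dom] x' sc)
qed

text \<open>Isolates the dependence on the angle in two scalar factors, so that the rules for linear
  maps and products give the derivative.\<close>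

lemma spin_vec_eq:
  "spin_vec l \<theta> x = spin_vec l 0 x + (x $ l * (cos \<theta> - 1)) *\<^sub>R axis (Some l) 1 + (x $ l * sin \<theta>) *\<^sub>R axis None 1"
  by (auto simp: vec_eq_iff spin_vec_def axis_def algebra_simps split: option.splits)

lemma has_derivative_spin_vec:
  assumes x: "(x has_derivative dx) (at u)" and \<theta>: "(\<theta> has_derivative d\<theta>) (at u)"
  shows "((\<lambda>u. spin_vec l (\<theta> u) (x u)) has_derivative
    (\<lambda>v. spin_vec l (\<theta> u) (dx v) + d\<theta> v *\<^sub>R spin_turn l (\<theta> u) (x u))) (at u)"
proof -
  have 0: "((\<lambda>u. spin_vec l 0 (x u)) has_derivative (\<lambda>v. spin_vec l 0 (dx v))) (at u)"
    by (rule bounded_linear.has_derivative[OF bounded_linear_spin_vec x])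
  have 1: "((\<lambda>u. x u $ l) has_derivative (\<lambda>v. dx v $ l)) (at u)"
    by (rule bounded_linear.has_derivative[OF bounded_linear_vec_nth x])
  have c: "((\<lambda>u. cos (\<theta> u)) has_derivative (\<lambda>v. d\<theta> v * - sin (\<theta> u))) (at u)"
    by (rule has_derivative_cos[OF \<theta>])
  have c1: "((\<lambda>u. cos (\<theta> u) - 1) has_derivative (\<lambda>v. d\<theta> v * - sin (\<theta> u))) (at u)"
    using has_derivative_diff[OF c has_derivative_const[of 1]] by simp
  have s: "((\<lambda>u. sin (\<theta> u)) has_derivative (\<lambda>v. d\<theta> v * cos (\<theta> u))) (at u)"
    by (rule has_derivative_sin[OF \<theta>])
  have "((\<lambda>u. spin_vec l 0 (x u) + (x u $ l * (cos (\<theta> u) - 1)) *\<^sub>R axis (Some l) 1 + (x u $ l * sin (\<theta> u)) *\<^sub>R axis None 1)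
      has_derivative (\<lambda>v. spin_vec l 0 (dx v) + (x u $ l * (d\<theta> v * - sin (\<theta> u)) + dx v $ l * (cos (\<theta> u) - 1)) *\<^sub>R axis (Some l) 1 +
        (x u $ l * (d\<theta> v * cos (\<theta> u)) + dx v $ l * sin (\<theta> u)) *\<^sub>R axis None 1)) (at u)"
    by (intro has_derivative_add has_derivative_scaleR_left has_derivative_mult 0 1 s c1)
  then show ?thesis
    unfolding spin_vec_eq[of l "\<theta> _" "x _", symmetric]
    by (rule has_derivative_eq_rhs)
       (auto simp: fun_eq_iff spin_vec_eq[of l "\<theta> u" "dx _"] spin_turn_def algebra_simps)
qed

lemma param_restrict:
  fixes \<psi> :: "'k::euclidean_space \<Rightarrow> 'a::euclidean_space"
  assumes \<psi>: "param S W \<psi>" and W: "open W" "open W1" "W1 \<subseteq> W"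
  shows "param S W1 \<psi>" "\<And>w v. w \<in> W1 \<Longrightarrow> dmap W1 \<psi> w v = dmap W \<psi> w v"
proof -
  have dom: "line_domain (line ` Basis) W1" by (rule line_domain_line_open[OF W(2)])
  show d: "dmap W1 \<psi> w v = dmap W \<psi> w v" if "w \<in> W1" for w v
    unfolding dmap_def
    by (intro sum.cong refl) (simp add: pderiv_on_subset[OF dom W(3) paramD(2)[OF \<psi>] refl _ that])
  obtain \<phi> where \<phi>: "homeomorphism W (\<psi> ` W) \<psi> \<phi>" using paramD(5)[OF \<psi>] by blast
  have "openin (top_of_set (\<psi> ` W)) (\<psi> ` W1)"
    by (rule homeomorphism_imp_open_map[OF \<phi>]) (simp add: W open_openin_trans)
  then have "openin (top_of_set S) (\<psi> ` W1)" using paramD(4)[OF \<psi>] openin_trans by blast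
  moreover have "homeomorphism W1 (\<psi> ` W1) \<psi> \<phi>"
    by (rule homeomorphism_of_subsets[OF \<phi>]) (use W in auto)
  moreover have "smooth_on (line ` Basis) W1 \<psi>" by (rule smooth_on_subset[OF dom W(3) paramD(2)[OF \<psi>]])
  moreover have "v = 0" if "w \<in> W1" "dmap W1 \<psi> w v = 0" for w v
    using paramD(3)[OF \<psi>, of w v] that d W(3) by auto
  ultimately show "param S W1 \<psi>"
    unfolding param_def chart_domain_def dmap_def using W(2) by blast
qed

lemma bounded_linear_vec_lambda_nth:
  "bounded_linear (\<lambda>y :: real ^ 'm::finite. \<chi> j :: 'k::finite. y $ f j)"
  unfolding linear_conv_bounded_linear[symmetric] by (rule linearI) (auto simp: vec_eq_iff)

text \<open>The arctangent recovers an angle only from the open interval of radius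
  \<open>pi / 2\<close>; a positive cosine allows a representative there.\<close>

lemma angle_normalize:
  assumes "0 < cos \<delta>"
  obtains \<epsilon> where "\<bar>\<epsilon>\<bar> < pi / 2" "sin \<epsilon> = sin \<delta>" "cos \<epsilon> = cos \<delta>"
proof -
  obtain y where y: "- pi < y" "y \<le> pi" "sin y = sin \<delta>" "cos y = cos \<delta>"
    using sincos_principal_value by blast
  have "\<not> pi / 2 \<le> \<bar>y\<bar>"
  proof
    assume "pi / 2 \<le> \<bar>y\<bar>"
    then have "cos \<bar>y\<bar> \<le> cos (pi / 2)" using y by (intro cos_monotone_0_pi_le) auto
    then show False using assms y(4) by simp
  qed
  then show thesis using that[of y] y by (simp add: not_le)
qed

lemma spin_vec_cong:
  "sin \<theta> = sin \<theta>' \<Longrightarrow> cos \<theta> = cos \<theta>' \<Longrightarrow> spin_vec l \<theta> x = spin_vec l \<theta>' x"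
  by (simp add: spin_vec_def vec_eq_iff split: option.split)

text \<open>Where \<open>x_l\<close> is positive, the angle and the unspun point are continuous
  functions of the spun point on a suitable half-space. This makes the image of the rotated chart
  open and its inverse continuous. The last conclusion describes the tangent vectors in the form
  that \<open>symp_spin\<close> treats.\<close>

proposition spin_chart_interior:
  fixes L :: "(real \<times> (real ^ 'n::finite) \<times> real \<times> (real ^ 'n)) set"
  assumes \<psi>: "param L W (\<psi> :: real \<times> (real ^ 'n) \<Rightarrow> _)" and W: "open W" "w0 \<in> W"
    and pos: "\<And>w. w \<in> W \<Longrightarrow> 0 < fst (snd (\<psi> w)) $ l" and nonneg: "\<And>q. q \<in> L \<Longrightarrow> 0 \<le> fst (snd q) $ l"
  obtains \<Omega> and \<Psi> :: "real \<times> (real ^ ('n option)) \<Rightarrow> _" and u0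
  where "open \<Omega>" "param (spin_lagrangian l L) \<Omega> \<Psi>" "u0 \<in> \<Omega>" "\<Psi> u0 = spin_cot l \<theta>0 (\<psi> w0)"
    "\<And>v. \<exists>v' r. dmap \<Omega> \<Psi> u0 v = spin_cot l \<theta>0 (dmap W \<psi> w0 v') + r *\<^sub>R turn_cot l \<theta>0 (\<psi> w0)"
proof -
  \<comment> \<open>The parameters are repacked: the coordinate with index \<open>None\<close>
    carries the angle, the others are those of the given chart.\<close>
  define pr :: "real \<times> (real ^ ('n option)) \<Rightarrow> real \<times> (real ^ 'n)" where "pr u = (fst u, \<chi> j. snd u $ Some j)" for u
  define ang :: "real \<times> (real ^ ('n option)) \<Rightarrow> real" where "ang u = snd u $ None" for u
  define join :: "real \<times> (real ^ 'n) \<Rightarrow> real \<Rightarrow> real \<times> (real ^ ('n option))"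
    where "join w \<theta> = (fst w, \<chi> i. case i of None \<Rightarrow> \<theta> | Some j \<Rightarrow> snd w $ j)" for w \<theta>
  have join: "pr (join w \<theta>) = w" "ang (join w \<theta>) = \<theta>" for w \<theta>
    by (simp_all add: pr_def ang_def join_def prod_eq_iff vec_eq_iff)
  have join_pr: "join (pr u) (ang u) = u" for u
    by (auto simp: pr_def ang_def join_def prod_eq_iff vec_eq_iff split: option.splits)
  have pr: "bounded_linear pr"
    unfolding pr_def[abs_def]
    by (intro bounded_linear_Pair bounded_linear_fst bounded_linear_compose[OF bounded_linear_vec_lambda_nth bounded_linear_snd])
  have ang: "bounded_linear ang"
    unfolding ang_def[abs_def] by (rule bounded_linear_compose[OF bounded_linear_vec_nth bounded_linear_snd])
  define \<Omega> where "\<Omega> = {u. pr u \<in> W \<and> \<bar>ang u - \<theta>0\<bar> < pi / 2}"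
  define \<Psi> where "\<Psi> u = spin_cot l (ang u) (\<psi> (pr u))" for u
  have \<Omega>: "open \<Omega>"
  proof -
    have "open (pr -` W)" by (rule open_vimage[OF W(1) linear_continuous_on[OF pr]])
    moreover have "open {u. \<bar>ang u - \<theta>0\<bar> < pi / 2}"
      by (intro open_Collect_less continuous_intros linear_continuous_on[OF ang])
    ultimately show ?thesis unfolding \<Omega>_def by (simp add: vimage_def open_Collect_conj)
  qed
  have dom: "line_domain (line ` Basis) \<Omega>" by (rule line_domain_line_open[OF \<Omega>])
  have s_pr: "smooth_on (line ` Basis) \<Omega> (\<lambda>u. \<psi> (pr u))"
    by (rule smooth_on_compose[OF dom W(1) paramD(2)[OF \<psi>] smooth_on_bounded_linear_line[OF \<Omega> pr]])
       (auto simp: \<Omega>_def)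
  note s_ang = smooth_on_bounded_linear_line[OF \<Omega> ang]
  have s\<Psi>: "smooth_on (line ` Basis) \<Omega> \<Psi>"
    unfolding \<Psi>_def[abs_def] spin_cot_def
    by (intro smooth_on_Pair[OF dom] smooth_on_spin_vec[OF dom] s_ang
        smooth_on_bounded_linear[OF dom bounded_linear_fst] smooth_on_bounded_linear[OF dom bounded_linear_snd] s_pr)
  have d\<Psi>: "dmap \<Omega> \<Psi> u v = spin_cot l (ang u) (dmap W \<psi> (pr u) (pr v)) + ang v *\<^sub>R turn_cot l (ang u) (\<psi> (pr u))"
    if u: "u \<in> \<Omega>" for u v
  proof -
    have "(\<psi> has_derivative dmap W \<psi> (pr u)) (at (pr u))"
      by (rule smooth_on_has_derivative_dmap[OF W(1) paramD(2)[OF \<psi>]]) (use u in \<open>simp add: \<Omega>_def\<close>)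
    from has_derivative_compose[OF bounded_linear_imp_has_derivative[OF pr] this]
    have d: "((\<lambda>u. \<psi> (pr u)) has_derivative (\<lambda>v. dmap W \<psi> (pr u) (pr v))) (at u)" .
    have "(\<Psi> has_derivative (\<lambda>v. (fst (dmap W \<psi> (pr u) (pr v)),
        spin_vec l (ang u) (fst (snd (dmap W \<psi> (pr u) (pr v)))) + ang v *\<^sub>R spin_turn l (ang u) (fst (snd (\<psi> (pr u)))),
        fst (snd (snd (dmap W \<psi> (pr u) (pr v)))),
        spin_vec l (ang u) (snd (snd (snd (dmap W \<psi> (pr u) (pr v))))) + ang v *\<^sub>R spin_turn l (ang u) (snd (snd (snd (\<psi> (pr u))))))))
        (at u)"
      unfolding \<Psi>_def[abs_def] spin_cot_def
      by (intro has_derivative_Pair has_derivative_spin_vec has_derivative_fst has_derivative_snd d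
          bounded_linear_imp_has_derivative[OF ang])
    from fun_cong[OF has_derivative_unique[OF smooth_on_has_derivative_dmap[OF \<Omega> s\<Psi> u] this], of v]
    show ?thesis by (simp add: spin_cot_def turn_cot_def)
  qed
  have inj: "v = 0" if u: "u \<in> \<Omega>" and z: "dmap \<Omega> \<Psi> u v = 0" for u v
  proof -
    have wu: "pr u \<in> W" using u by (simp add: \<Omega>_def)
    \<comment> \<open>Rotating back removes the rotational part and leaves the differential of
      \<psi>, which is injective. The remaining multiple of the rotational vector is zero only for a
      zero coefficient, because \<open>x_l\<close> is positive.\<close>
    have "unrot_cot l (ang u) (dmap \<Omega> \<Psi> u v) = dmap W \<psi> (pr u) (pr v)"
      unfolding d\<Psi>[OF u]
      by (simp add: linear_add[OF linear_unrot_cot] linear_scale[OF linear_unrot_cot] unrot_spin_cot unrot_turn_cot)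
    then have "dmap W \<psi> (pr u) (pr v) = 0" using z linear_0[OF linear_unrot_cot] by metis
    then have p0: "pr v = 0" "dmap W \<psi> (pr u) (pr v) = 0" using paramD(3)[OF \<psi> wu] by auto
    then have "ang v *\<^sub>R turn_cot l (ang u) (\<psi> (pr u)) = 0"
      using d\<Psi>[OF u, of v] z by (simp add: linear_0[OF linear_spin_cot])
    moreover have "turn_cot l (ang u) (\<psi> (pr u)) \<noteq> 0"
      using pos[OF wu] by (simp add: turn_cot_def spin_turn_eq_0 zero_prod_def)
    ultimately have "ang v = 0" by simp
    then have "v = join 0 0" using join_pr[of v] p0 by simp
    also have "\<dots> = 0" by (auto simp: join_def prod_eq_iff vec_eq_iff split: option.splits)
    finally show ?thesis .
  qed
  obtain \<phi> where \<phi>: "homeomorphism W (\<psi> ` W) \<psi> \<phi>" using paramD(5)[OF \<psi>] by blast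
  obtain U where U: "open U" "\<psi> ` W = L \<inter> U" using paramD(4)[OF \<psi>] unfolding openin_open by blast
  \<comment> \<open>\<open>den\<close> and \<open>num\<close> are the two rotated coordinates seen
    in the frame turned by \<theta>0, so \<open>num / den\<close> is the tangent of the angle
    relative to \<theta>0. On the half-space \<open>HP\<close> the denominator is positive.\<close>
  define den where "den q = cos \<theta>0 * fst (snd q) $ Some l + sin \<theta>0 * fst (snd q) $ None"
    for q :: "real \<times> (real ^ ('n option)) \<times> real \<times> (real ^ ('n option))"
  define num where "num q = cos \<theta>0 * fst (snd q) $ None - sin \<theta>0 * fst (snd q) $ Some l"
    for q :: "real \<times> (real ^ ('n option)) \<times> real \<times> (real ^ ('n option))"
  define \<alpha> where "\<alpha> q = \<theta>0 + arctan (num q / den q)" for q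
  define un where "un q = unrot_cot l (\<alpha> q) q" for q
  define HP where "HP = {q. 0 < den q}"
  have HP: "open HP" unfolding HP_def den_def by (intro open_Collect_less continuous_intros)
  have c\<alpha>: "continuous_on HP \<alpha>"
    unfolding \<alpha>_def num_def den_def HP_def by (auto intro!: continuous_intros)
  have c_un: "continuous_on HP un"
  proof -
    have rot: "continuous_on HP (\<lambda>q. unrot_vec l (\<alpha> q) (f q))" if "continuous_on HP f" for f
      unfolding unrot_vec_def
    proof (rule continuous_on_vec_lambda)
      show "continuous_on HP (\<lambda>q. if j = l then cos (\<alpha> q) * f q $ Some l + sin (\<alpha> q) * f q $ None else f q $ Some j)" for j
        by (cases "j = l") (auto intro!: continuous_intros c\<alpha> that)
    qed
    show ?thesis
      unfolding un_def[abs_def] unrot_cot_def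
      by (intro continuous_on_Pair continuous_on_fst continuous_on_snd continuous_on_id rot)
  qed
  have spin_HP: "spin_cot l \<theta> q \<in> HP \<longleftrightarrow> 0 < fst (snd q) $ l * cos (\<theta> - \<theta>0)" for \<theta> q
    by (simp add: HP_def den_def spin_cot_def spin_vec_def cos_diff algebra_simps)
  have spin_\<alpha>: "\<alpha> (spin_cot l \<theta> q) = \<theta>" if "0 < fst (snd q) $ l" "\<bar>\<theta> - \<theta>0\<bar> < pi / 2" for \<theta> q
  proof -
    have "den (spin_cot l \<theta> q) = fst (snd q) $ l * cos (\<theta> - \<theta>0)"
      by (simp add: den_def spin_cot_def spin_vec_def cos_diff algebra_simps)
    moreover have "num (spin_cot l \<theta> q) = fst (snd q) $ l * sin (\<theta> - \<theta>0)"
      by (simp add: num_def spin_cot_def spin_vec_def sin_diff algebra_simps)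
    ultimately have "num (spin_cot l \<theta> q) / den (spin_cot l \<theta> q) = tan (\<theta> - \<theta>0)"
      using that(1) by (simp add: tan_def)
    moreover have "arctan (tan (\<theta> - \<theta>0)) = \<theta> - \<theta>0" using that(2) by (intro arctan_tan) linarith+
    ultimately show ?thesis by (simp add: \<alpha>_def)
  qed
  have \<Psi>_inv: "\<Psi> u \<in> HP" "\<alpha> (\<Psi> u) = ang u" "un (\<Psi> u) = \<psi> (pr u)" if "u \<in> \<Omega>" for u
  proof -
    have u: "0 < fst (snd (\<psi> (pr u))) $ l" "\<bar>ang u - \<theta>0\<bar> < pi / 2"
      using that pos by (auto simp: \<Omega>_def)
    then have "0 < cos (ang u - \<theta>0)" by (intro cos_gt_zero_pi) linarith+
    then show "\<Psi> u \<in> HP" using u unfolding \<Psi>_def spin_HP by simp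
    show "\<alpha> (\<Psi> u) = ang u" using spin_\<alpha>[OF u] by (simp add: \<Psi>_def)
    then show "un (\<Psi> u) = \<psi> (pr u)" unfolding un_def by (simp add: \<Psi>_def unrot_spin_cot)
  qed
  have img: "\<Psi> ` \<Omega> = spin_lagrangian l L \<inter> (HP \<inter> un -` U)"
  proof (intro equalityI subsetI)
    fix q' assume "q' \<in> \<Psi> ` \<Omega>"
    then obtain u where u: "u \<in> \<Omega>" "q' = \<Psi> u" by blast
    have "\<psi> (pr u) \<in> L \<inter> U" using U(2) u(1) by (auto simp: \<Omega>_def)
    moreover from this have "\<Psi> u \<in> spin_lagrangian l L"
      unfolding spin_lagrangian_iff \<Psi>_def by blast
    ultimately show "q' \<in> spin_lagrangian l L \<inter> (HP \<inter> un -` U)"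
      using \<Psi>_inv[OF u(1)] u(2) by simp
  next
    fix q' assume q': "q' \<in> spin_lagrangian l L \<inter> (HP \<inter> un -` U)"
    then have "q' \<in> spin_lagrangian l L" by blast
    then obtain \<theta> q where q: "q \<in> L" "q' = spin_cot l \<theta> q" unfolding spin_lagrangian_iff by blast
    have "0 < fst (snd q) $ l * cos (\<theta> - \<theta>0)" using q' q(2) spin_HP by blast
    then have ql: "0 < fst (snd q) $ l" and "0 < cos (\<theta> - \<theta>0)"
      using nonneg[OF q(1)] by (auto simp: zero_less_mult_iff)
    then obtain \<epsilon> where \<epsilon>: "\<bar>\<epsilon>\<bar> < pi / 2" "sin \<epsilon> = sin (\<theta> - \<theta>0)" "cos \<epsilon> = cos (\<theta> - \<theta>0)"
      using angle_normalize by blast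
    \<comment> \<open>A point of the spun set may be presented with any angle; it is replaced by an
      equivalent one near \<theta>0, where the arctangent is correct.\<close>
    have "sin (\<theta>0 + \<epsilon>) = sin (\<theta>0 + (\<theta> - \<theta>0))" "cos (\<theta>0 + \<epsilon>) = cos (\<theta>0 + (\<theta> - \<theta>0))"
      unfolding sin_add cos_add \<epsilon> by simp_all
    then have "spin_vec l (\<theta>0 + \<epsilon>) x = spin_vec l \<theta> x" for x by (intro spin_vec_cong) simp_all
    then have q2: "q' = spin_cot l (\<theta>0 + \<epsilon>) q" unfolding q(2) spin_cot_def by simp
    have "\<alpha> q' = \<theta>0 + \<epsilon>" unfolding q2 by (rule spin_\<alpha>[OF ql]) (use \<epsilon> in simp)
    then have "un q' = q" unfolding un_def q2 by (simp add: unrot_spin_cot)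
    then have "q \<in> \<psi> ` W" using q' q(1) U(2) by auto
    then obtain w where w: "w \<in> W" "q = \<psi> w" by blast
    have "join w (\<theta>0 + \<epsilon>) \<in> \<Omega>" using w \<epsilon> by (simp add: \<Omega>_def join)
    moreover have "q' = \<Psi> (join w (\<theta>0 + \<epsilon>))" unfolding q2 w(2) \<Psi>_def join ..
    ultimately show "q' \<in> \<Psi> ` \<Omega>" by blast
  qed
  have "open (HP \<inter> un -` U)" by (rule continuous_open_preimage[OF c_un HP U(1)])
  then have op: "openin (top_of_set (spin_lagrangian l L)) (\<Psi> ` \<Omega>)"
    unfolding img by (rule openin_open_Int)
  have hom: "homeomorphism \<Omega> (\<Psi> ` \<Omega>) \<Psi> (\<lambda>q. join (\<phi> (un q)) (\<alpha> q))"
  proof (rule homeomorphismI)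
    show "continuous_on \<Omega> \<Psi>" by (rule smooth_on_continuous[OF s\<Psi>])
    have sub: "\<Psi> ` \<Omega> \<subseteq> HP" using \<Psi>_inv(1) by blast
    have "continuous_on (\<Psi> ` \<Omega>) (\<lambda>q. \<phi> (un q))"
    proof (rule continuous_on_compose2[OF _ continuous_on_subset[OF c_un sub]])
      show "continuous_on (\<psi> ` W) \<phi>" using \<phi> by (simp add: homeomorphism_def)
      show "un ` \<Psi> ` \<Omega> \<subseteq> \<psi> ` W" using \<Psi>_inv(3) by (auto simp: \<Omega>_def)
    qed
    moreover have "continuous_on (\<Psi> ` \<Omega>) \<alpha>" by (rule continuous_on_subset[OF c\<alpha> sub])
    moreover have "continuous_on X (\<lambda>q. join (f q) (g q))" if "continuous_on X f" "continuous_on X g"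
      for X :: "(real \<times> (real ^ ('n option)) \<times> real \<times> (real ^ ('n option))) set" and f g
    proof -
      have "continuous_on X (\<lambda>q. case i of None \<Rightarrow> g q | Some j \<Rightarrow> snd (f q) $ j)" for i
        by (cases i) (auto intro!: continuous_intros that)
      then show ?thesis unfolding join_def
        by (intro continuous_on_Pair continuous_on_fst that continuous_on_vec_lambda)
    qed
    ultimately show "continuous_on (\<Psi> ` \<Omega>) (\<lambda>q. join (\<phi> (un q)) (\<alpha> q))" by blast
    have R: "join (\<phi> (un (\<Psi> u))) (\<alpha> (\<Psi> u)) = u" if "u \<in> \<Omega>" for u
    proof -
      have "pr u \<in> W" using that by (simp add: \<Omega>_def)
      then have "\<phi> (\<psi> (pr u)) = pr u" using \<phi> by (simp add: homeomorphism_def)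
      then show ?thesis using \<Psi>_inv[OF that] join_pr by simp
    qed
    then show "(\<lambda>q. join (\<phi> (un q)) (\<alpha> q)) ` \<Psi> ` \<Omega> \<subseteq> \<Omega>" by auto
    show "join (\<phi> (un (\<Psi> u))) (\<alpha> (\<Psi> u)) = u" if "u \<in> \<Omega>" for u by (rule R[OF that])
    show "\<Psi> (join (\<phi> (un q)) (\<alpha> q)) = q" if "q \<in> \<Psi> ` \<Omega>" for q using that R by auto
  qed simp
  have "param (spin_lagrangian l L) \<Omega> \<Psi>"
    unfolding param_def dmap_def[symmetric] chart_domain_def
    using \<Omega> s\<Psi> inj op hom by blast
  moreover have "join w0 \<theta>0 \<in> \<Omega>" using W(2) by (simp add: \<Omega>_def join)
  moreover have "\<Psi> (join w0 \<theta>0) = spin_cot l \<theta>0 (\<psi> w0)" by (simp add: \<Psi>_def join)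
  moreover have "\<exists>v' r. dmap \<Omega> \<Psi> (join w0 \<theta>0) v = spin_cot l \<theta>0 (dmap W \<psi> w0 v') + r *\<^sub>R turn_cot l \<theta>0 (\<psi> w0)" for v
    using d\<Psi>[OF \<open>join w0 \<theta>0 \<in> \<Omega>\<close>] unfolding join by blast
  ultimately show thesis using that \<Omega> by blast
qed

section \<open>The spun Lagrangian at the axis\<close>

lemma reflect_cot_eq:
  "reflect_cot l q = (fst q, reflect_vec l (fst (snd q)), fst (snd (snd q)), reflect_vec l (snd (snd (snd q))))"
  by (simp add: reflect_cot_def case_prod_unfold)

lemma linear_reflect_vec: "linear (reflect_vec l)"
  by (rule linearI) (auto simp: reflect_vec_def vec_eq_iff)

lemma linear_reflect_cot: "linear (reflect_cot l)"
  by (rule linearI)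
     (simp_all add: reflect_cot_eq linear_add[OF linear_reflect_vec] linear_scale[OF linear_reflect_vec])

lemma bounded_linear_reflect_cot: "bounded_linear (reflect_cot l)"
  using linear_reflect_cot linear_conv_bounded_linear by blast

lemma reflect_cot_reflect_cot [simp]: "reflect_cot l (reflect_cot l q) = q"
  by (simp add: reflect_cot_eq)

lemma dim_range_dmap:
  fixes \<psi> :: "'k::euclidean_space \<Rightarrow> 'a::euclidean_space"
  assumes "param S W \<psi>" "w \<in> W"
  shows "dim (range (dmap W \<psi> w)) = DIM('k)"
proof -
  have "inj (dmap W \<psi> w)" using paramD(3)[OF assms] linear_injective_0[OF linear_dmap] by blast
  then show ?thesis using dim_image_eq[OF linear_dmap, of W \<psi> w UNIV] by (simp add: dim_UNIV)
qed

lemma chart_curve: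
  assumes W: "open W" "w0 \<in> W" and \<psi>: "smooth_on (line ` Basis) W \<psi>"
  shows "((\<lambda>h. \<psi> (w0 + h *\<^sub>R v)) has_vector_derivative dmap W \<psi> w0 v) (at 0 within X)"
proof -
  have "((\<lambda>h::real. w0 + h *\<^sub>R v) has_derivative (\<lambda>h. h *\<^sub>R v)) (at 0)"
    by (auto intro!: derivative_eq_intros)
  moreover have "(\<psi> has_derivative dmap W \<psi> w0) (at (w0 + 0 *\<^sub>R v))"
    using smooth_on_has_derivative_dmap[OF W(1) \<psi> W(2)] by simp
  ultimately have "((\<lambda>h. \<psi> (w0 + h *\<^sub>R v)) has_derivative (\<lambda>h. dmap W \<psi> w0 (h *\<^sub>R v))) (at 0)"
    by (rule has_derivative_compose)
  then show ?thesis
    by (simp add: has_vector_derivative_def linear_scale[OF linear_dmap] has_derivative_at_withinI)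
qed

locale spinnable_lagrangian_family = spinnable_generating_family l N F L
  for l :: "'n::finite" and N F L +
  assumes lag: "lagrangian (halfspace l) L"
    and boundary: "submanifold_with_boundary TYPE(real \<times> (real ^ 'n)) L {q \<in> L. fst (snd q) $ l = 0}"
    and transverse: "\<And>q. q \<in> L \<Longrightarrow> fst (snd q) $ l = 0 \<Longrightarrow>
      \<exists>a\<in>tangent_space TYPE(real \<times> (real ^ 'n)) L q. fst (snd a) $ l \<noteq> 0"
    and double: "submanifold_with_boundary TYPE(real \<times> (real ^ 'n)) (L \<union> reflect_cot l ` L) {}"
begin

abbreviation "L2 \<equiv> L \<union> reflect_cot l ` L"

lemma nonneg: "q \<in> L \<Longrightarrow> 0 \<le> fst (snd q) $ l"
  using lag unfolding lagrangian_def halfspace_def by (cases q) auto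

lemma isotropic:
  assumes "q \<in> L" "a \<in> tangent_space TYPE(real \<times> (real ^ 'n)) L q" "b \<in> tangent_space TYPE(real \<times> (real ^ 'n)) L q"
  shows "symp a b = 0"
  using lag[unfolded lagrangian_def, THEN conjunct2, THEN conjunct2] assms by blast

lemma axis_fixed:
  assumes "q \<in> L" "fst (snd q) $ l = 0"
  shows "reflect_cot l q = q" "snd (snd (snd q)) $ l = 0"
proof -
  show "snd (snd (snd q)) $ l = 0"
    using normal_momentum_zero[of "fst q" "fst (snd q)" "fst (snd (snd q))" "snd (snd (snd q))"] assms by simp
  then show "reflect_cot l q = q"
    by (simp add: reflect_cot_eq reflect_vec_fixed assms(2))
qed

lemma reflect_L2: "q \<in> L2 \<Longrightarrow> reflect_cot l q \<in> L2"
  by auto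

text \<open>A mirror image of a point of \<open>L\<close> has \<open>x_l\<close> at most zero, so
  with \<open>x_l\<close> nonnegative it lies on the axis and is its own mirror image.\<close>

lemma L2_nonneg:
  assumes q: "q \<in> L2" "0 \<le> fst (snd q) $ l"
  shows "q \<in> L"
proof (rule ccontr)
  assume "q \<notin> L"
  then obtain q' where q': "q' \<in> L" "q = reflect_cot l q'" using q(1) by blast
  have "fst (snd q) $ l = - (fst (snd q') $ l)" by (simp add: q'(2) reflect_cot_eq reflect_vec_def)
  then have "fst (snd q') $ l = 0" using nonneg[OF q'(1)] q(2) by simp
  then have "q = q'" using axis_fixed(1)[OF q'(1)] q'(2) by simp
  then show False using q'(1) \<open>q \<notin> L\<close> by simp
qed

text \<open>A boundary chart of \<open>L\<close> already spans a tangent space of full dimension, so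
  at the axis \<open>L\<close> and its double have the same tangent vectors; isotropy and
  transversality pass to the double. Invariance under the reflection comes from reflecting curves in
  the double.\<close>

lemma double_chart_tangent:
  assumes \<psi>: "param L2 W (\<psi> :: real \<times> (real ^ 'n) \<Rightarrow> _)" and W: "open W" "w0 \<in> W"
    and p: "\<psi> w0 \<in> L" "fst (snd (\<psi> w0)) $ l = 0"
  shows "\<And>a b. a \<in> range (dmap W \<psi> w0) \<Longrightarrow> b \<in> range (dmap W \<psi> w0) \<Longrightarrow> symp a b = 0"
    "\<exists>a\<in>range (dmap W \<psi> w0). fst (snd a) $ l \<noteq> 0"
    "\<And>a. a \<in> range (dmap W \<psi> w0) \<Longrightarrow> reflect_cot l a \<in> range (dmap W \<psi> w0)"
proof -
  let ?T = "range (dmap W \<psi> w0)"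
  have "\<psi> w0 \<in> {q \<in> L. fst (snd q) $ l = 0}" using p by simp
  then obtain W' and \<psi>' :: "real \<times> (real ^ 'n) \<Rightarrow> _" and w' where
    \<psi>': "param L W' \<psi>'" "w' \<in> W'" "\<psi>' w' = \<psi> w0"
    using boundary unfolding submanifold_with_boundary_def by meson
  have "range (dmap W' \<psi>' w') \<subseteq> ?T"
    by (rule dmap_in_range[OF \<psi> W _ \<psi>']) simp
  moreover have "dim ?T \<le> dim (range (dmap W' \<psi>' w'))"
    unfolding dim_range_dmap[OF \<psi> W(2)] dim_range_dmap[OF \<psi>'(1,2)] by simp
  ultimately have T: "range (dmap W' \<psi>' w') = ?T"
    by (intro subspace_dim_equal subspace_range_dmap)
  have "?T \<subseteq> tangent_space TYPE(real \<times> (real ^ 'n)) L (\<psi> w0)"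
    using range_dmap_subset_tangent_space[OF \<psi>'(1,2)] unfolding T \<psi>'(3) .
  then show "symp a b = 0" if "a \<in> ?T" "b \<in> ?T" for a b
    using isotropic[OF p(1)] that by blast
  have "tangent_space TYPE(real \<times> (real ^ 'n)) L (\<psi> w0) \<subseteq> ?T"
    by (rule tangent_space_subset_range_dmap[OF \<psi> W]) simp
  then show "\<exists>a\<in>?T. fst (snd a) $ l \<noteq> 0" using transverse[OF p] by blast
  fix a assume "a \<in> ?T"
  then obtain v where v: "a = dmap W \<psi> w0 v" by blast
  have op: "open {h::real. w0 + h *\<^sub>R v \<in> W}" by (rule open_line_vimage[OF W(1)])
  show "reflect_cot l a \<in> ?T"
  proof (rule curve_velocity_in_range[OF \<psi> W])
    show "0 \<in> {h::real. w0 + h *\<^sub>R v \<in> W}" using W(2) by simp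
    then show "at (0::real) within {h::real. w0 + h *\<^sub>R v \<in> W} \<noteq> bot"
      by (rule at_within_open_neq_bot[OF op])
    show "reflect_cot l (\<psi> (w0 + h *\<^sub>R v)) \<in> L2" if "h \<in> {h. w0 + h *\<^sub>R v \<in> W}" for h
      using that paramD(6)[OF \<psi>] by (intro reflect_L2) blast
    show "reflect_cot l (\<psi> (w0 + 0 *\<^sub>R v)) = \<psi> w0" using axis_fixed(1)[OF p] by simp
    show "((\<lambda>h. reflect_cot l (\<psi> (w0 + h *\<^sub>R v))) has_vector_derivative reflect_cot l a)
        (at 0 within {h. w0 + h *\<^sub>R v \<in> W})"
      unfolding v
      by (rule bounded_linear.has_vector_derivative[OF bounded_linear_reflect_cot chart_curve[OF W paramD(2)[OF \<psi>]]])
  qed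
qed

text \<open>
  At an axis point the double of \<open>L\<close> is the graph of an equivariant map \<open>G\<close> over its tangent space,
  in linear coordinates \<open>g = (\<dots>, x\<^sub>l)\<close> whose remaining entries do not involve \<open>x\<^sub>l\<close> and \<open>X\<^sub>l\<close>.
\<close>

proposition equivariant_graph:
  assumes p: "p \<in> L" "fst (snd p) $ l = 0"
  obtains g :: "real \<times> (real ^ 'n) \<times> real \<times> (real ^ 'n) \<Rightarrow> real \<times> (real ^ 'n)" and D G U
  where "bounded_linear g" "\<forall>q. snd (g q) $ l = fst (snd q) $ l"
    "\<forall>q q'. fst q = fst q' \<and> fst (snd (snd q)) = fst (snd (snd q')) \<and>
      (\<forall>j. j \<noteq> l \<longrightarrow> fst (snd q) $ j = fst (snd q') $ j \<and> snd (snd (snd q)) $ j = snd (snd (snd q')) $ j) \<longrightarrow>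
      fst (g q) = fst (g q') \<and> (\<forall>j. j \<noteq> l \<longrightarrow> snd (g q) $ j = snd (g q') $ j)"
    "reflectible (spin_axis l) D" "smooth_on (line ` Basis) D G" "\<forall>u\<in>D. g (G u) = u"
    "g p \<in> D" "G (g p) = p" "G ` D \<subseteq> L2"
    "\<forall>u\<in>D. G (u - (2 * (u \<bullet> spin_axis l)) *\<^sub>R spin_axis l) = reflect_cot l (G u)"
    "open U" "p \<in> U" "L2 \<inter> U \<subseteq> G ` D"
proof -
  let ?b = "spin_axis l" and ?r = "reflect_cot l"
  have b: "?b \<in> Basis" by (simp add: spin_axis_def)
  have bb: "?b \<bullet> ?b = 1" using b by simp
  obtain W and \<psi> :: "real \<times> (real ^ 'n) \<Rightarrow> _" and w0 where
    W: "open W" "w0 \<in> W" and \<psi>: "param L2 W \<psi>" "p = \<psi> w0"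
    using double p(1) unfolding submanifold_with_boundary_def by blast
  let ?T = "range (dmap W \<psi> w0)"
  have rp: "?r p = p" by (rule axis_fixed(1)[OF p])
  note T = double_chart_tangent[OF \<psi>(1) W p[unfolded \<psi>(2)]]
  \<comment> \<open>The projection to the part fixed by the reflection; it erases exactly the
    components \<open>x_l\<close> and \<open>X_l\<close>.\<close>
  define Z where "Z q = (1 / 2) *\<^sub>R (q + ?r q)" for q
  have Z: "linear Z"
    unfolding Z_def by (rule linearI) (simp_all add: linear_add[OF linear_reflect_cot] linear_scale[OF linear_reflect_cot] algebra_simps)
  have Zr: "Z (?r q) = Z q" for q by (simp add: Z_def add.commute)
  have Zl: "fst (snd (Z q)) $ l = 0" "snd (snd (snd (Z q))) $ l = 0" for q
    by (simp_all add: Z_def reflect_cot_eq reflect_vec_def)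
  define T0 where "T0 = ?T \<inter> {q. fst (snd q) $ l = 0 \<and> snd (snd (snd q)) $ l = 0}"
  have T0: "subspace T0"
    unfolding T0_def by (intro subspace_inter subspace_range_dmap) (auto simp: subspace_def)
  have "dim T0 < dim ?T"
  proof (rule ccontr)
    assume "\<not> dim T0 < dim ?T"
    then have "T0 = ?T"
      by (intro subspace_dim_equal[OF T0 subspace_range_dmap]) (auto simp: T0_def)
    then show False using T(2) by (auto simp: T0_def)
  qed
  then have "dim T0 < DIM(real \<times> (real ^ 'n))" unfolding dim_range_dmap[OF \<psi>(1) W(2)] .
  \<comment> \<open>The transverse tangent vector makes \<open>T0\<close> a proper subspace, so it
    fits isometrically into the hyperplane orthogonal to \<open>?b\<close>. The direction
    \<open>?b\<close> stays free for \<open>x_l\<close>.\<close>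
  moreover have "dim {w. ?b \<bullet> w = 0} = DIM(real \<times> (real ^ 'n)) - 1"
    using dim_hyperplane[of ?b] bb by (metis inner_zero_left zero_neq_one)
  ultimately have "dim T0 \<le> dim {w. ?b \<bullet> w = 0}" by simp
  then obtain lam where lam: "linear lam" "lam \<in> T0 \<rightarrow> {w. ?b \<bullet> w = 0}" "\<And>v. v \<in> T0 \<Longrightarrow> norm (lam v) = norm v"
    using isometry_subset_subspace[OF T0 subspace_hyperplane] by metis
  define P where "P w = w - (w \<bullet> ?b) *\<^sub>R ?b" for w
  have Pb: "P w \<bullet> ?b = 0" for w by (simp add: P_def inner_diff_left bb)
  \<comment> \<open>Invariant coordinates from the even part, and \<open>x_l\<close> as the only odd
    one. Hence \<open>g\<close> intertwines the reflections, and its components other than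
    \<open>x_l\<close> ignore \<open>x_l\<close> and \<open>X_l\<close>.\<close>
  define g where "g q = P (lam (Z q)) + (fst (snd q) $ l) *\<^sub>R ?b" for q
  have "linear g"
    unfolding g_def P_def
    by (rule linearI) (simp_all add: linear_add[OF Z] linear_scale[OF Z] linear_add[OF lam(1)] linear_scale[OF lam(1)] algebra_simps)
  then have g: "bounded_linear g" by (simp add: linear_conv_bounded_linear)
  have gb: "g q \<bullet> ?b = fst (snd q) $ l" for q
    by (simp add: g_def inner_add_left Pb bb)
  have gr: "g (?r q) = g q - (2 * (g q \<bullet> ?b)) *\<^sub>R ?b" for q
  proof -
    have "fst (snd (?r q)) $ l = - (fst (snd q) $ l)" by (simp add: reflect_cot_eq reflect_vec_def)
    moreover have "(2 * x) *\<^sub>R ?b = x *\<^sub>R ?b + x *\<^sub>R ?b" for x :: real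
      by (simp only: mult_2 scaleR_add_left)
    ultimately show ?thesis unfolding gb by (simp add: g_def Zr)
  qed
  have g_inj: "v = 0" if z: "g (dmap W \<psi> w0 v) = 0" for v
  proof -
    define q where "q = dmap W \<psi> w0 v"
    have q: "q \<in> ?T" by (simp add: q_def)
    have ql: "fst (snd q) $ l = 0" using gb[of q] z by (simp add: q_def)
    have "Z q \<in> ?T"
      unfolding Z_def by (intro subspace_mul subspace_add subspace_range_dmap T(3) q)
    then have Zq: "Z q \<in> T0" using Zl by (simp add: T0_def)
    then have "lam (Z q) \<bullet> ?b = 0" using lam(2) by (auto simp: inner_commute)
    then have "lam (Z q) = g q" by (simp add: g_def P_def ql)
    then have "Z q = 0" using lam(3)[OF Zq] z by (simp add: q_def)
    then have "q + ?r q = 0" by (simp add: Z_def)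
    then have sum0: "fst (q + ?r q) = 0" "fst (snd (snd (q + ?r q))) = 0"
      "fst (snd (q + ?r q)) $ j = 0" "snd (snd (snd (q + ?r q))) $ j = 0" for j
      by simp_all
    have "fst (snd q) $ j = 0 \<and> snd (snd (snd q)) $ j = 0" if "j \<noteq> l" for j
      using sum0(3)[of j] sum0(4)[of j] that by (simp add: reflect_cot_eq reflect_vec_def)
    moreover have "fst q = 0" "fst (snd (snd q)) = 0"
      using sum0(1,2) by (simp_all add: reflect_cot_eq)
    ultimately have comps: "fst q = 0" "fst (snd (snd q)) = 0" "\<And>j. j \<noteq> l \<Longrightarrow> fst (snd q) $ j = 0"
      "\<And>j. j \<noteq> l \<Longrightarrow> snd (snd (snd q)) $ j = 0"
      by blast+
    \<comment> \<open>A vector in the kernel has at most the component \<open>X_l\<close> left. Its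
      pairing with the transverse \<open>a\<close> is, up to sign, that component times the nonzero
      \<open>x_l\<close> component of \<open>a\<close>, and it vanishes by isotropy.\<close>
    obtain a where a: "a \<in> ?T" "fst (snd a) $ l \<noteq> 0" using T(2) by blast
    have x0: "fst (snd q) = 0" using comps(3) ql by (metis vec_eq_iff zero_index)
    define c where "c = snd (snd (snd q)) $ l"
    have X: "snd (snd (snd q)) = c *\<^sub>R axis l 1"
      using comps(4) by (auto simp: vec_eq_iff axis_def c_def)
    have "symp q a = 0" by (rule T(1)[OF q a(1)])
    then have "fst (snd a) \<bullet> snd (snd (snd q)) = 0" by (simp add: symp_eq comps(1,2) x0)
    then have "c * (fst (snd a) $ l) = 0" unfolding X by (simp add: inner_axis)
    then have "snd (snd (snd q)) = 0" using a(2) unfolding X by simp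
    then have "q = 0" using comps(1,2) x0 by (simp add: prod_eq_iff)
    then show ?thesis using paramD(3)[OF \<psi>(1) W(2)] by (simp add: q_def)
  qed
  obtain V k where V: "open V" "g p \<in> V" and k: "smooth_on (line ` Basis) V k" "k ` V \<subseteq> W"
    and gk: "\<And>u. u \<in> V \<Longrightarrow> g (\<psi> (k u)) = u" "k (g p) = w0"
    and op: "openin (top_of_set L2) ((\<lambda>u. \<psi> (k u)) ` V)"
    using param_section[OF \<psi>(1) W g g_inj] \<psi>(2) by metis
  define G where "G u = \<psi> (k u)" for u
  have sG: "smooth_on (line ` Basis) V G"
    unfolding G_def by (rule smooth_on_compose[OF line_domain_line_open[OF V(1)] W(1) paramD(2)[OF \<psi>(1)] k])
  have gG: "g (G u) = u" if "u \<in> V" for u using gk(1)[OF that] by (simp add: G_def)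
  have Gp: "G (g p) = p" using gk(2) \<psi>(2) by (simp add: G_def)
  obtain U0 where U0: "open U0" "G ` V = L2 \<inter> U0" using op unfolding openin_open G_def by blast
  let ?\<rho> = "\<lambda>u. u - (2 * (u \<bullet> ?b)) *\<^sub>R ?b"
  \<comment> \<open>The domain is shrunk so that the mirror images \<open>?r (G u)\<close> remain in
    the open set cut out by the graph.\<close>
  have "continuous_on V (\<lambda>u. ?r (G u))"
    by (rule bounded_linear.continuous_on[OF bounded_linear_reflect_cot smooth_on_continuous[OF sG]])
  then have "open (V \<inter> (\<lambda>u. ?r (G u)) -` U0)" by (rule continuous_open_preimage[OF _ V(1) U0(1)])
  moreover have "p \<in> G ` V" using Gp V(2) by (metis imageI)
  then have "p \<in> U0" using U0(2) by blast
  then have "g p \<in> V \<inter> (\<lambda>u. ?r (G u)) -` U0" using V(2) Gp rp by simp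
  ultimately obtain \<epsilon> where \<epsilon>: "0 < \<epsilon>" "ball (g p) \<epsilon> \<subseteq> V \<inter> (\<lambda>u. ?r (G u)) -` U0"
    by (rule openE)
  define D where "D = ball (g p) \<epsilon>"
  have DV: "D \<subseteq> V" using \<epsilon> by (auto simp: D_def)
  \<comment> \<open>The reflection is an isometry fixing \<open>g p\<close>, so a ball about
    \<open>g p\<close> is a reflectible domain.\<close>
  have norm_\<rho>: "norm (?\<rho> u) = norm u" for u
  proof -
    have "?\<rho> u \<bullet> ?\<rho> u = u \<bullet> u"
      by (simp add: inner_diff_left inner_diff_right bb inner_commute algebra_simps)
    then show ?thesis by (simp add: norm_eq_sqrt_inner)
  qed
  have "g p \<bullet> ?b = 0" using gb[of p] p(2) by simp
  then have "dist (g p) (?\<rho> u) = dist (g p) u" for u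
    using norm_\<rho>[of "g p - u"] by (simp add: dist_norm inner_diff_left algebra_simps)
  then have refl: "reflectible ?b D"
    unfolding reflectible_def D_def using b by auto
  have sGD: "smooth_on (line ` Basis) D G"
    by (rule smooth_on_subset[OF line_domain_line_open DV sG]) (simp add: D_def)
  \<comment> \<open>The mirror image is again a point of the graph, and \<open>g\<close> determines
    its parameter, which is the reflected one.\<close>
  have equi: "G (?\<rho> u) = ?r (G u)" if u: "u \<in> D" for u
  proof -
    have "G u \<in> L2" using U0(2) DV u by blast
    moreover have "?r (G u) \<in> U0" using \<epsilon>(2) u by (auto simp: D_def)
    ultimately have "?r (G u) \<in> G ` V" using U0(2) reflect_L2 by blast
    then obtain u' where u': "u' \<in> V" "?r (G u) = G u'" by blast
    then have "u' = g (?r (G u))" using gG by simp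
    also have "\<dots> = ?\<rho> u" using gr[of "G u"] gG[of u] DV u by auto
    finally show ?thesis using u'(2) by simp
  qed
  have "continuous_on UNIV g" by (rule linear_continuous_on[OF g])
  then have U: "open (U0 \<inter> g -` D)"
    using open_vimage[of D g] U0(1) by (auto simp: D_def)
  have sub: "L2 \<inter> (U0 \<inter> g -` D) \<subseteq> G ` D"
  proof
    fix q assume q: "q \<in> L2 \<inter> (U0 \<inter> g -` D)"
    then have "q \<in> G ` V" using U0(2) by blast
    then obtain u where u: "u \<in> V" "q = G u" by blast
    then have "g q = u" using gG by simp
    then show "q \<in> G ` D" using q u by auto
  qed
  have indep: "fst (g q) = fst (g q') \<and> (\<forall>j. j \<noteq> l \<longrightarrow> snd (g q) $ j = snd (g q') $ j)"
    if "fst q = fst q'" "fst (snd (snd q)) = fst (snd (snd q'))"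
      "\<And>j. j \<noteq> l \<Longrightarrow> fst (snd q) $ j = fst (snd q') $ j \<and> snd (snd (snd q)) $ j = snd (snd (snd q')) $ j" for q q'
  proof -
    have "Z q = Z q'"
      using that by (auto simp: Z_def reflect_cot_eq reflect_vec_def prod_eq_iff vec_eq_iff)
    then show ?thesis by (simp add: g_def spin_axis_def axis_def)
  qed
  show thesis
  proof (rule that[OF g _ _ refl sGD _ _ Gp _ _ U _ sub])
    show "\<forall>q. snd (g q) $ l = fst (snd q) $ l" using gb by (simp add: inner_spin_axis)
    show "\<forall>u\<in>D. g (G u) = u" using gG DV by blast
    show "g p \<in> D" using \<epsilon>(1) by (simp add: D_def)
    then show "p \<in> U0 \<inter> g -` D" using \<open>p \<in> U0\<close> by simp
    show "G ` D \<subseteq> L2" using U0(2) DV by blast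
  qed (use indep equi in blast)+
qed

end

section \<open>Rotations as isometries, and families without fibre variables\<close>

lemma norm_spin_vec: "norm (spin_vec l \<theta> x) = norm x"
  by (simp add: norm_eq_sqrt_inner inner_spin_vec)

lemma norm_spin_cot: "norm (spin_cot l \<theta> q) = norm q"
  by (cases q) (simp add: spin_cot_simp norm_prod_def norm_spin_vec)

lemma dist_spin_cot: "dist (spin_cot l \<theta> p) (spin_cot l \<theta> q) = dist p q"
  by (simp add: dist_norm linear_diff[OF linear_spin_cot, symmetric] norm_spin_cot)

lemma continuous_on_symp:
  assumes "continuous_on A f" "continuous_on A g"
  shows "continuous_on A (\<lambda>u. symp (f u) (g u))"
  unfolding symp_eq by (intro continuous_intros assms)

lemma continuous_on_dmap:
  assumes "smooth_on (line ` Basis) W \<psi>"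
  shows "continuous_on W (\<lambda>w. dmap W \<psi> w v)"
proof -
  have "continuous_on W (pderiv_on W (line e) \<psi>)" if "e \<in> Basis" for e
    using smooth_on_continuous[OF smooth_on_pderiv_on[OF assms]] that by blast
  then show ?thesis
    unfolding dmap_def by (intro continuous_on_sum continuous_on_scaleR continuous_on_const)
qed

text \<open>With \<open>N = 0\<close> the fibre is a single point. A function on the base is then a
  family, and the results on even families apply to the components of a graph.\<close>

lemma smooth_on_line_family:
  fixes f :: "'a::euclidean_space \<Rightarrow> real"
  assumes D: "open D" and f: "smooth_on (line ` Basis) D f"
  shows "smooth_on (fam_lines 0) (D \<times> fibre 0) (\<lambda>p. f (fst p))"
proof (rule smooth_on_pullback[OF line_domain_family[OF D] _ _ f])
  fix c :: "'a \<times> (nat \<Rightarrow> real) \<Rightarrow> real \<Rightarrow> 'a \<times> (nat \<Rightarrow> real)" assume "c \<in> fam_lines 0"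
  then obtain e where e: "e \<in> Basis" "c = base_line e" by (auto simp: fam_lines_def)
  have "fst (c p h) = line e (fst p) h" for p h by (simp add: e base_line_def line_def)
  then show "(\<exists>c'\<in>line ` Basis. \<forall>p\<in>D \<times> fibre 0. \<forall>h. c p h \<in> D \<times> fibre 0 \<longrightarrow> fst (c p h) = c' (fst p) h) \<or>
      (\<forall>p\<in>D \<times> fibre 0. \<forall>h. c p h \<in> D \<times> fibre 0 \<longrightarrow> fst (c p h) = fst p)"
    using e(1) by blast
qed (auto intro!: continuous_on_fst continuous_on_id)

lemma smooth_on_family_line:
  fixes f :: "'a::euclidean_space \<times> (nat \<Rightarrow> real) \<Rightarrow> real"
  assumes D: "open D" and f: "smooth_on (fam_lines 0) (D \<times> fibre 0) f"
  shows "smooth_on (line ` Basis) D (\<lambda>u. f (u, \<lambda>_. 0))"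
proof (rule smooth_on_pullback[OF line_domain_line_open[OF D] _ _ f])
  show "(\<lambda>u. (u, \<lambda>_. 0)) ` D \<subseteq> D \<times> fibre 0" by (auto simp: fibre_def)
  fix c :: "'a \<Rightarrow> real \<Rightarrow> 'a" assume "c \<in> line ` Basis"
  then obtain e where e: "e \<in> Basis" "c = line e" by blast
  have "(c u h, \<lambda>_. 0) = base_line e (u, \<lambda>_. 0) h" for u h by (simp add: e base_line_def line_def)
  moreover have "base_line e \<in> fam_lines 0" using e(1) by (simp add: fam_lines_def)
  ultimately show "(\<exists>c'\<in>fam_lines 0. \<forall>p\<in>D. \<forall>h. c p h \<in> D \<longrightarrow> (c p h, \<lambda>_. 0) = c' (p, \<lambda>_. 0) h) \<or>
      (\<forall>p\<in>D. \<forall>h. c p h \<in> D \<longrightarrow> (c p h, \<lambda>_. 0) = (p, \<lambda>_. 0))"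
    by blast
qed (intro continuous_on_Pair continuous_on_id continuous_on_const)

section \<open>Charts and isotropy of the spun Lagrangian\<close>

context spinnable_lagrangian_family
begin

abbreviation "L' \<equiv> spin_lagrangian l L"

text \<open>An interior chart of \<open>L\<close> is restricted to the region where
  \<open>x_l\<close> is positive and then rotated. Tangent vectors are rotated tangent vectors of
  \<open>L\<close> plus multiples of one rotational vector, so isotropy is inherited from
  \<open>L\<close>.\<close>

lemma interior_chart:
  assumes q: "q \<in> L" "0 < fst (snd q) $ l"
  shows "\<exists>\<Omega> (\<Psi> :: real \<times> (real ^ ('n option)) \<Rightarrow> _). open \<Omega> \<and> param L' \<Omega> \<Psi> \<and> spin_cot l \<theta> q \<in> \<Psi> ` \<Omega>"
    "\<And>a b. a \<in> tangent_space TYPE(real \<times> (real ^ ('n option))) L' (spin_cot l \<theta> q) \<Longrightarrow>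
      b \<in> tangent_space TYPE(real \<times> (real ^ ('n option))) L' (spin_cot l \<theta> q) \<Longrightarrow> symp a b = 0"
proof -
  have "q \<in> L - {q \<in> L. fst (snd q) $ l = 0}" using q by simp
  then obtain W and \<psi> :: "real \<times> (real ^ 'n) \<Rightarrow> _" where
    W: "open W" and \<psi>: "param L W \<psi>" and qW: "q \<in> \<psi> ` W"
    using boundary unfolding submanifold_with_boundary_def by meson
  obtain w0 where w0: "w0 \<in> W" "q = \<psi> w0" using qW by blast
  define W1 where "W1 = W \<inter> (\<lambda>w. fst (snd (\<psi> w)) $ l) -` {0<..}"
  have "continuous_on W (\<lambda>w. fst (snd (\<psi> w)) $ l)"
    by (intro continuous_intros smooth_on_continuous[OF paramD(2)[OF \<psi>]])
  then have W1: "open W1" unfolding W1_def by (rule continuous_open_preimage[OF _ W]) simp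
  have w01: "w0 \<in> W1" using w0 q by (simp add: W1_def)
  have \<psi>1: "param L W1 \<psi>" by (rule param_restrict[OF \<psi> W W1]) (simp add: W1_def)
  have pos: "0 < fst (snd (\<psi> w)) $ l" if "w \<in> W1" for w using that by (simp add: W1_def)
  obtain \<Omega> and \<Psi> :: "real \<times> (real ^ ('n option)) \<Rightarrow> _" and u0 where
    \<Omega>: "open \<Omega>" "u0 \<in> \<Omega>" and \<Psi>: "param L' \<Omega> \<Psi>" "\<Psi> u0 = spin_cot l \<theta> (\<psi> w0)"
    and d: "\<And>v. \<exists>v' r. dmap \<Omega> \<Psi> u0 v = spin_cot l \<theta> (dmap W1 \<psi> w0 v') + r *\<^sub>R turn_cot l \<theta> (\<psi> w0)"
    using spin_chart_interior[OF \<psi>1 W1 w01 pos nonneg, of \<theta>] by metis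
  show "\<exists>\<Omega> (\<Psi> :: real \<times> (real ^ ('n option)) \<Rightarrow> _). open \<Omega> \<and> param L' \<Omega> \<Psi> \<and> spin_cot l \<theta> q \<in> \<Psi> ` \<Omega>"
  proof (intro exI conjI)
    show "open \<Omega>" "param L' \<Omega> \<Psi>" by fact+
    show "spin_cot l \<theta> q \<in> \<Psi> ` \<Omega>" unfolding w0(2) \<Psi>(2)[symmetric] by (rule imageI[OF \<Omega>(2)])
  qed
  fix a b
  assume ab: "a \<in> tangent_space TYPE(real \<times> (real ^ ('n option))) L' (spin_cot l \<theta> q)"
    "b \<in> tangent_space TYPE(real \<times> (real ^ ('n option))) L' (spin_cot l \<theta> q)"
  have "tangent_space TYPE(real \<times> (real ^ ('n option))) L' (spin_cot l \<theta> q) = range (dmap \<Omega> \<Psi> u0)"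
    using tangent_space_eq_range_dmap[OF \<Psi>(1) \<Omega>] unfolding \<Psi>(2) w0(2) .
  then obtain v v' where "a = dmap \<Omega> \<Psi> u0 v" "b = dmap \<Omega> \<Psi> u0 v'" using ab by blast
  then obtain v1 r v2 s where
    "a = spin_cot l \<theta> (dmap W1 \<psi> w0 v1) + r *\<^sub>R turn_cot l \<theta> (\<psi> w0)"
    "b = spin_cot l \<theta> (dmap W1 \<psi> w0 v2) + s *\<^sub>R turn_cot l \<theta> (\<psi> w0)"
    using d by metis
  then have "symp a b = symp (dmap W1 \<psi> w0 v1) (dmap W1 \<psi> w0 v2)" by (simp only: symp_spin)
  also have "\<dots> = 0"
  proof (rule isotropic[OF q(1)])
    have sub: "range (dmap W1 \<psi> w0) \<subseteq> tangent_space TYPE(real \<times> (real ^ 'n)) L q"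
      using range_dmap_subset_tangent_space[OF \<psi>1 w01] unfolding w0(2)[symmetric] .
    show "dmap W1 \<psi> w0 v1 \<in> tangent_space TYPE(real \<times> (real ^ 'n)) L q"
      "dmap W1 \<psi> w0 v2 \<in> tangent_space TYPE(real \<times> (real ^ 'n)) L q"
      using sub by blast+
  qed
  finally show "symp a b = 0" .
qed

text \<open>
  Rotating the equivariant graph gives a graph over \<open>\<real> \<times> \<real>\<^sup>n\<^sup>+\<^sup>1\<close>: the even components are spun as they are,
  and the odd component \<open>X\<^sub>l = x\<^sub>l h\<close> becomes \<open>h\<close> times the two new coordinates.
\<close>

lemma axis_chart:
  assumes p: "p \<in> L" "fst (snd p) $ l = 0"
  shows "\<exists>\<Omega> (\<Psi> :: real \<times> (real ^ ('n option)) \<Rightarrow> _). open \<Omega> \<and> param L' \<Omega> \<Psi> \<and> spin_cot l \<theta>0 p \<in> \<Psi> ` \<Omega>"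
    "\<And>a b. a \<in> tangent_space TYPE(real \<times> (real ^ ('n option))) L' (spin_cot l \<theta>0 p) \<Longrightarrow>
      b \<in> tangent_space TYPE(real \<times> (real ^ ('n option))) L' (spin_cot l \<theta>0 p) \<Longrightarrow> symp a b = 0"
proof -
  let ?b = "spin_axis l"
  obtain g :: "real \<times> (real ^ 'n) \<times> real \<times> (real ^ 'n) \<Rightarrow> real \<times> (real ^ 'n)" and D G U
    where g: "bounded_linear g" and gl: "\<forall>q. snd (g q) $ l = fst (snd q) $ l"
    and indep: "\<forall>q q'. fst q = fst q' \<and> fst (snd (snd q)) = fst (snd (snd q')) \<and>
      (\<forall>j. j \<noteq> l \<longrightarrow> fst (snd q) $ j = fst (snd q') $ j \<and> snd (snd (snd q)) $ j = snd (snd (snd q')) $ j) \<longrightarrow>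
      fst (g q) = fst (g q') \<and> (\<forall>j. j \<noteq> l \<longrightarrow> snd (g q) $ j = snd (g q') $ j)"
    and D: "reflectible ?b D" and sG: "smooth_on (line ` Basis) D G" and gG: "\<forall>u\<in>D. g (G u) = u"
    and gp: "g p \<in> D" "G (g p) = p" and GL2: "G ` D \<subseteq> L2"
    and equi: "\<forall>u\<in>D. G (u - (2 * (u \<bullet> ?b)) *\<^sub>R ?b) = reflect_cot l (G u)"
    and U: "open U" "p \<in> U" "L2 \<inter> U \<subseteq> G ` D"
    by (rule equivariant_graph[OF p])
  have openD: "open D" using D by (simp add: reflectible_def)
  have domD: "line_domain (line ` Basis) D" by (rule line_domain_line_open[OF openD])
  have xl: "fst (snd (G u)) $ l = snd u $ l" if "u \<in> D" for u using gl gG that by metis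
  \<comment> \<open>A linear functional that is even or odd under the reflection becomes an even or
    odd function of \<open>u\<close> along the equivariant map \<open>G\<close>.\<close>
  have parity: "parity_family m ?b D 0 (\<lambda>p. \<kappa> (G (fst p)))"
    if \<kappa>: "bounded_linear \<kappa>" "\<And>q. \<kappa> (reflect_cot l q) = (-1) ^ m * \<kappa> q" for \<kappa> :: "_ \<Rightarrow> real" and m
    unfolding parity_family_def
  proof (intro conjI ballI)
    show "smooth_on (fam_lines 0) (D \<times> fibre 0) (\<lambda>p. \<kappa> (G (fst p)))"
      by (rule smooth_on_line_family[OF openD smooth_on_bounded_linear[OF domD \<kappa>(1) sG]])
    fix p :: "(real \<times> (real ^ 'n)) \<times> (nat \<Rightarrow> real)" assume "p \<in> D \<times> fibre 0"
    then have "fst p \<in> D" by auto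
    moreover have "fst (scale_coord ?b (-1) p) = fst p - (2 * (fst p \<bullet> ?b)) *\<^sub>R ?b"
      by (simp add: scale_coord_def)
    ultimately show "\<kappa> (G (fst (scale_coord ?b (-1) p))) = (-1) ^ m * \<kappa> (G (fst p))"
      using equi \<kappa>(2) by simp
  qed
  define D' where "D' = spin_base l D"
  have openD': "open D'" unfolding D'_def by (rule open_spin_base[OF openD])
  have domD': "line_domain (line ` Basis) D'" by (rule line_domain_line_open[OF openD'])
  define un where "un u = (fst u, unspin l (snd u))" for u :: "real \<times> (real ^ ('n option))"
  have un_mem: "un u \<in> D" if "u \<in> D'" for u using that by (simp add: D'_def spin_base_def un_def)
  have spun: "smooth_on (line ` Basis) D' (\<lambda>u. f (un u, \<lambda>_. 0))" if "parity_family 0 ?b D 0 f" for f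
  proof -
    have "unspin_pt l (u, \<lambda>_ :: nat. 0 :: real) = (un u, \<lambda>_. 0)" for u by (simp add: unspin_pt_def un_def)
    then show ?thesis
      using smooth_on_family_line[OF openD' smooth_on_spin[OF D that, folded D'_def]] by simp
  qed
  have even: "smooth_on (line ` Basis) D' (\<lambda>u. \<kappa> (G (un u)))"
    if "bounded_linear \<kappa>" "\<And>q. \<kappa> (reflect_cot l q) = \<kappa> q" for \<kappa> :: "_ \<Rightarrow> real"
    using spun[OF parity[OF that(1), of 0]] that(2) by simp
  have odd: "parity_family 1 ?b D 0 (\<lambda>p. snd (snd (snd (G (fst p)))) $ l)"
    by (rule parity)
       (auto simp: reflect_cot_eq reflect_vec_def intro!: bounded_linear_compose[OF bounded_linear_vec_nth] bounded_linear_snd_comp bounded_linear_ident)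
  obtain h where h: "parity_family 0 ?b D 0 h"
    "\<And>p. p \<in> D \<times> fibre 0 \<Longrightarrow> (fst p \<bullet> ?b) * h p = snd (snd (snd (G (fst p)))) $ l"
    using odd_family_quotient[OF D odd] by blast
  define H where "H u = h (un u, \<lambda>_. 0)" for u
  have sH: "smooth_on (line ` Basis) D' H" unfolding H_def[abs_def] by (rule spun[OF h(1)])
  have Hl: "snd (un u) $ l * H u = snd (snd (snd (G (un u)))) $ l" if "u \<in> D'" for u
    using h(2)[of "(un u, \<lambda>_. 0)"] un_mem[OF that] by (simp add: H_def inner_spin_axis fibre_def)
  \<comment> \<open>The unrotated coordinates come from \<open>y\<close>, the rotated ones are
    \<open>c\<close> times those of \<open>x\<close>. If \<open>c\<close> is the ratio of the two
    \<open>l\<close>-components, this is the rotation of the unspun vector, with no angle or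
    division in the formula.\<close>
  define spread :: "real ^ 'n \<Rightarrow> real \<Rightarrow> real ^ ('n option) \<Rightarrow> real ^ ('n option)" where
    "spread y c x = (\<chi> i. case i of None \<Rightarrow> c * x $ None | Some j \<Rightarrow> if j = l then c * x $ Some l else y $ j)" for y c x
  have spread_spin: "spread z c (spin_vec l \<theta> y) = spin_vec l \<theta> z" if "y $ l * c = z $ l" for z y c \<theta>
  proof -
    have "c * (y $ l * d) = z $ l * d" for d using that by (metis mult.assoc mult.commute)
    then show ?thesis by (auto simp: spread_def spin_vec_def vec_eq_iff split: option.split)
  qed
  \<comment> \<open>For the position the ratio is 1, since \<open>G\<close> preserves
    \<open>x_l\<close>; for the momentum it is \<open>H\<close>, the spun Hadamard quotient of
    \<open>X_l\<close> by \<open>x_l\<close>.\<close>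
  define G' where "G' u = (fst (G (un u)), spread (fst (snd (G (un u)))) 1 (snd u),
      fst (snd (snd (G (un u)))), spread (snd (snd (snd (G (un u))))) (H u) (snd u))" for u
  have s_coord: "smooth_on (line ` Basis) D' (\<lambda>u. snd u $ i)" for i
    by (rule smooth_on_bounded_linear_line[OF openD'])
       (intro bounded_linear_compose[OF bounded_linear_vec_nth] bounded_linear_snd)
  have s_spread: "smooth_on (line ` Basis) D' (\<lambda>u. spread (y u) (c u) (snd u))"
    if "smooth_on (line ` Basis) D' c" "\<And>j. j \<noteq> l \<Longrightarrow> smooth_on (line ` Basis) D' (\<lambda>u. y u $ j)" for y c
  proof (rule smooth_on_vec[OF domD'])
    fix i :: "'n option"
    consider "i = None" | "i = Some l" | j where "i = Some j" "j \<noteq> l" by (cases i) auto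
    then show "smooth_on (line ` Basis) D' (\<lambda>u. spread (y u) (c u) (snd u) $ i)"
      by cases (simp_all add: spread_def smooth_on_mult[OF domD'] s_coord that)
  qed
  have sG': "smooth_on (line ` Basis) D' G'"
    unfolding G'_def[abs_def]
  proof (intro smooth_on_Pair[OF domD'] s_spread sH)
    show "smooth_on (line ` Basis) D' (\<lambda>u. fst (G (un u)))"
      by (rule even) (auto simp: reflect_cot_eq intro: bounded_linear_fst)
    show "smooth_on (line ` Basis) D' (\<lambda>u. fst (snd (snd (G (un u)))))"
      by (rule even) (auto simp: reflect_cot_eq intro!: bounded_linear_fst_comp bounded_linear_snd_comp bounded_linear_ident)
    show "smooth_on (line ` Basis) D' (\<lambda>u. fst (snd (G (un u))) $ j)" if "j \<noteq> l" for j
      by (rule even)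
         (use that in \<open>auto simp: reflect_cot_eq reflect_vec_def intro!: bounded_linear_compose[OF bounded_linear_vec_nth]
           bounded_linear_fst_comp bounded_linear_snd_comp bounded_linear_ident\<close>)
    show "smooth_on (line ` Basis) D' (\<lambda>u. snd (snd (snd (G (un u)))) $ j)" if "j \<noteq> l" for j
      by (rule even)
         (use that in \<open>auto simp: reflect_cot_eq reflect_vec_def intro!: bounded_linear_compose[OF bounded_linear_vec_nth]
           bounded_linear_fst_comp bounded_linear_snd_comp bounded_linear_ident\<close>)
    show "smooth_on (line ` Basis) D' (\<lambda>u. 1)" by (rule smooth_on_const[OF domD'])
  qed
  have G'_spin: "G' (a, spin_vec l \<theta> y) = spin_cot l \<theta> (G (a, y))" "(a, spin_vec l \<theta> y) \<in> D'"
    if ay: "(a, y) \<in> D" "0 \<le> y $ l" for a y \<theta>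
  proof -
    have u: "un (a, spin_vec l \<theta> y) = (a, y)" by (simp add: un_def unspin_spin_vec[OF ay(2)])
    then show m: "(a, spin_vec l \<theta> y) \<in> D'" using ay(1) by (simp add: D'_def spin_base_def un_def)
    have "y $ l * H (a, spin_vec l \<theta> y) = snd (snd (snd (G (a, y)))) $ l" using Hl[OF m] by (simp add: u)
    then have "spread (snd (snd (snd (G (a, y))))) (H (a, spin_vec l \<theta> y)) (spin_vec l \<theta> y) =
        spin_vec l \<theta> (snd (snd (snd (G (a, y)))))"
      by (rule spread_spin)
    moreover have "spread (fst (snd (G (a, y)))) 1 (spin_vec l \<theta> y) = spin_vec l \<theta> (fst (snd (G (a, y))))"
      by (rule spread_spin) (use xl[OF ay(1)] in simp)
    ultimately show "G' (a, spin_vec l \<theta> y) = spin_cot l \<theta> (G (a, y))"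
      by (simp add: G'_def u spin_cot_def)
  qed
  have D'_cases: "\<exists>\<theta> a y. u = (a, spin_vec l \<theta> y) \<and> (a, y) \<in> D \<and> y = unspin l (snd u) \<and> 0 \<le> y $ l" if "u \<in> D'" for u
  proof -
    obtain \<theta> where "spin_vec l \<theta> (unspin l (snd u)) = snd u" using spin_vec_unspin by blast
    then have "u = (fst u, spin_vec l \<theta> (unspin l (snd u)))" by (simp add: prod_eq_iff)
    then show ?thesis using un_mem[OF that] unspin_nonneg unfolding un_def by blast
  qed
  define drop :: "real ^ ('n option) \<Rightarrow> real ^ 'n" where "drop x = (\<chi> j. x $ Some j)" for x
  define dc :: "real \<times> (real ^ ('n option)) \<times> real \<times> (real ^ ('n option)) \<Rightarrow> real \<times> (real ^ 'n) \<times> real \<times> (real ^ 'n)"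
    where "dc q = (fst q, drop (fst (snd q)), fst (snd (snd q)), drop (snd (snd (snd q))))" for q
  \<comment> \<open>A linear left inverse of \<open>G'\<close>: the two rotated coordinates are read
    off directly, the others through \<open>g\<close>, which by \<open>indep\<close> is insensitive
    to the components altered by the rotation.\<close>
  define g' where "g' q = (fst (g (dc q)), \<chi> i. case i of None \<Rightarrow> fst (snd q) $ None
      | Some j \<Rightarrow> if j = l then fst (snd q) $ Some l else snd (g (dc q)) $ j)" for q
  have "linear drop" by (rule linearI) (simp_all add: drop_def vec_eq_iff)
  then have "linear dc"
    by (intro linearI) (simp_all add: dc_def linear_add linear_scale)
  moreover have "linear g" using g by (rule bounded_linear.linear)
  ultimately have "linear g'"
    by (intro linearI) (auto simp: g'_def linear_add linear_scale vec_eq_iff split: option.split)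
  then have bg': "bounded_linear g'" by (simp add: linear_conv_bounded_linear)
  have g'G': "g' (G' u) = u + 0" if u: "u \<in> D'" for u
  proof -
    have "fst (g (dc (G' u))) = fst (g (G (un u))) \<and> (\<forall>j. j \<noteq> l \<longrightarrow> snd (g (dc (G' u))) $ j = snd (g (G (un u))) $ j)"
      by (rule indep[rule_format]) (auto simp: dc_def drop_def G'_def spread_def)
    then show ?thesis
      unfolding gG[rule_format, OF un_mem[OF u]] g'_def
      by (auto simp: G'_def spread_def un_def unspin_def prod_eq_iff vec_eq_iff split: option.split)
  qed
  obtain \<epsilon> where \<epsilon>: "0 < \<epsilon>" "ball p \<epsilon> \<subseteq> U" using U(1,2) by (rule openE)
  define p' where "p' = spin_cot l \<theta>0 p"
  \<comment> \<open>Position and momentum of \<open>p\<close> have zero \<open>l\<close>-component,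
    so every rotation sends \<open>p\<close> to the same point.\<close>
  have spin_p: "spin_cot l \<theta> p = p'" for \<theta>
  proof -
    have "spin_vec l \<theta> x = spin_vec l \<theta>0 x" if "x $ l = 0" for x
      using that by (simp add: spin_vec_def vec_eq_iff split: option.split)
    then show ?thesis using p(2) axis_fixed(2)[OF p] by (simp add: p'_def spin_cot_def)
  qed
  \<comment> \<open>\<open>spin_cot\<close> preserves distances and sends \<open>p\<close> to
    \<open>p'\<close> for every angle. A single ball about \<open>p'\<close> therefore controls all
    rotated points at once, which identifies the image of the graph with an open part of
    \<open>L'\<close>.\<close>
  define \<Omega> where "\<Omega> = D' \<inter> G' -` ball p' \<epsilon>"
  have \<Omega>: "open \<Omega>" unfolding \<Omega>_def
    by (rule continuous_open_preimage[OF smooth_on_continuous[OF sG'] openD' open_ball])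
  have img: "G' ` \<Omega> = L' \<inter> ball p' \<epsilon>"
  proof (intro equalityI subsetI)
    fix q' assume "q' \<in> G' ` \<Omega>"
    then obtain u where u: "u \<in> D'" "q' = G' u" "q' \<in> ball p' \<epsilon>" by (auto simp: \<Omega>_def)
    obtain \<theta> a y where uy: "u = (a, spin_vec l \<theta> y)" "(a, y) \<in> D" "0 \<le> y $ l" using D'_cases[OF u(1)] by blast
    have "G (a, y) \<in> L" using GL2 uy(2) xl[OF uy(2)] uy(3) by (intro L2_nonneg) auto
    then have "q' \<in> L'" unfolding u(2) uy(1) G'_spin(1)[OF uy(2,3)] spin_lagrangian_iff by blast
    then show "q' \<in> L' \<inter> ball p' \<epsilon>" using u(3) by blast
  next
    fix q' assume q': "q' \<in> L' \<inter> ball p' \<epsilon>"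
    then have "q' \<in> L'" by blast
    then obtain \<theta> q where q: "q \<in> L" "q' = spin_cot l \<theta> q" unfolding spin_lagrangian_iff by blast
    have "dist p q = dist p' q'" unfolding q(2) spin_p[of \<theta>, symmetric] by (rule dist_spin_cot[symmetric])
    then have "q \<in> U" using q' \<epsilon>(2) by auto
    then have "q \<in> G ` D" using U(3) q(1) by blast
    then obtain u where u: "u \<in> D" "q = G u" by blast
    obtain a y where ay: "u = (a, y)" by (cases u)
    have yl: "0 \<le> y $ l" using nonneg[OF q(1)] xl[OF u(1)] by (simp add: u(2) ay)
    have "q' = G' (a, spin_vec l \<theta> y)" using G'_spin(1)[of a y \<theta>] u yl q(2) by (simp add: ay)
    moreover have "(a, spin_vec l \<theta> y) \<in> D'" using G'_spin(2) u yl by (simp add: ay)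
    ultimately show "q' \<in> G' ` \<Omega>" using q' by (auto simp: \<Omega>_def)
  qed
  have s\<Omega>: "smooth_on (line ` Basis) \<Omega> G'"
    by (rule smooth_on_subset[OF line_domain_line_open[OF \<Omega>] _ sG']) (simp add: \<Omega>_def)
  have par: "param L' \<Omega> G'"
  proof (rule param_of_section[OF \<Omega> s\<Omega> bg'])
    show "g' (G' u) = u + 0" if "u \<in> \<Omega>" for u using g'G' that by (simp add: \<Omega>_def)
    show "openin (top_of_set L') (G' ` \<Omega>)" unfolding img by (rule openin_open_Int[OF open_ball])
  qed
  have "p' \<in> L'" unfolding p'_def spin_lagrangian_iff using p(1) by blast
  then have "p' \<in> G' ` \<Omega>" unfolding img using \<epsilon>(1) by simp
  then obtain u0 where u0: "u0 \<in> \<Omega>" "G' u0 = p'" by blast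
  show "\<exists>\<Omega> (\<Psi> :: real \<times> (real ^ ('n option)) \<Rightarrow> _). open \<Omega> \<and> param L' \<Omega> \<Psi> \<and> spin_cot l \<theta>0 p \<in> \<Psi> ` \<Omega>"
    using \<Omega> par \<open>p' \<in> G' ` \<Omega>\<close> unfolding p'_def by blast
  fix a b
  assume ab: "a \<in> tangent_space TYPE(real \<times> (real ^ ('n option))) L' (spin_cot l \<theta>0 p)"
    "b \<in> tangent_space TYPE(real \<times> (real ^ ('n option))) L' (spin_cot l \<theta>0 p)"
  have "tangent_space TYPE(real \<times> (real ^ ('n option))) L' p' = range (dmap \<Omega> G' u0)"
    using tangent_space_eq_range_dmap[OF par \<Omega> u0(1)] unfolding u0(2) .
  then obtain v w where vw: "a = dmap \<Omega> G' u0 v" "b = dmap \<Omega> G' u0 w" using ab p'_def by blast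
  let ?\<sigma> = "\<lambda>u. symp (dmap \<Omega> G' u v) (dmap \<Omega> G' u w)"
  have c\<sigma>: "continuous_on \<Omega> ?\<sigma>" by (intro continuous_on_symp continuous_on_dmap s\<Omega>)
  \<comment> \<open>Away from the axis the tangent vectors of this chart are tangent to
    \<open>L'\<close> at an interior point, where isotropy is known.\<close>
  have off_axis: "?\<sigma> u = 0" if u: "u \<in> \<Omega>" "unspin l (snd u) $ l \<noteq> 0" for u
  proof -
    have uD: "u \<in> D'" using u(1) by (simp add: \<Omega>_def)
    obtain \<theta> a y where uy: "u = (a, spin_vec l \<theta> y)" "(a, y) \<in> D" "y = unspin l (snd u)" "0 \<le> y $ l"
      using D'_cases[OF uD] by blast
    have yl: "0 < y $ l" using u(2) uy(3,4) by simp
    have "G (a, y) \<in> L" using GL2 uy(2) xl[OF uy(2)] uy(4) by (intro L2_nonneg) auto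
    moreover have "0 < fst (snd (G (a, y))) $ l" using xl[OF uy(2)] yl by simp
    moreover have G'u: "G' u = spin_cot l \<theta> (G (a, y))" unfolding uy(1) by (rule G'_spin(1)[OF uy(2,4)])
    ultimately show ?thesis
      using interior_chart(2)[of "G (a, y)" _ \<theta>] range_dmap_subset_tangent_space[OF par u(1)]
      unfolding G'u by blast
  qed
  \<comment> \<open>Moving in a rotated direction leaves the axis at once, with radius
    \<bar>h\<bar>. So \<open>u0\<close> is a limit of parameters off the axis, and the continuous
    pairing vanishes there too.\<close>
  let ?e = "(0, axis None 1) :: real \<times> (real ^ ('n option))"
  let ?\<gamma> = "\<lambda>h::real. u0 + h *\<^sub>R ?e"
  have "unspin l (snd u0) $ l = 0"
  proof -
    have uD: "u0 \<in> D'" using u0(1) by (simp add: \<Omega>_def)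
    obtain \<theta> a y where uy: "u0 = (a, spin_vec l \<theta> y)" "(a, y) \<in> D" "y = unspin l (snd u0)" "0 \<le> y $ l"
      using D'_cases[OF uD] by blast
    have "spin_cot l \<theta> (G (a, y)) = spin_cot l \<theta> p"
      using G'_spin(1)[OF uy(2,4), of \<theta>] u0(2) spin_p[of \<theta>] uy(1) by simp
    then have "G (a, y) = p" by (metis unrot_spin_cot)
    then show ?thesis using xl[OF uy(2)] p(2) uy(3) by simp
  qed
  then have "snd u0 $ Some l = 0" "snd u0 $ None = 0"
    by (simp_all add: unspin_def spin_radius_def sum_power2_eq_zero_iff)
  then have rad: "unspin l (snd (?\<gamma> h)) $ l = \<bar>h\<bar>" for h
    by (simp add: unspin_def spin_radius_def axis_def)
  have "isCont ?\<sigma> u0" using c\<sigma> u0(1) \<Omega> by (simp add: continuous_on_eq_continuous_at)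
  moreover have \<gamma>0: "?\<gamma> 0 = u0" by (simp only: scaleR_zero_left add_0_right)
  moreover have "(?\<gamma> \<longlongrightarrow> ?\<gamma> 0) (at 0)" by (intro tendsto_intros)
  ultimately have "isCont ?\<sigma> (?\<gamma> 0)" "(?\<gamma> \<longlongrightarrow> ?\<gamma> 0) (at 0)" by (simp_all only:)
  from isCont_tendsto_compose[OF this]
  have lim: "((\<lambda>h. ?\<sigma> (?\<gamma> h)) \<longlongrightarrow> ?\<sigma> u0) (at 0)" unfolding \<gamma>0 .
  have "open {h. ?\<gamma> h \<in> \<Omega>}" by (rule open_line_vimage[OF \<Omega>])
  moreover have "0 \<in> {h. ?\<gamma> h \<in> \<Omega>}" using u0(1) unfolding mem_Collect_eq \<gamma>0 .
  ultimately have "\<forall>\<^sub>F h in at 0. h \<in> {h. ?\<gamma> h \<in> \<Omega>}"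
    by (rule eventually_at_in_open')
  then have "\<forall>\<^sub>F h in at 0. ?\<sigma> (?\<gamma> h) = 0"
    using eventually_neq_at_within[of 0 0 UNIV]
  proof eventually_elim
    case (elim h)
    then show ?case using off_axis[of "?\<gamma> h"] rad[of h] by simp
  qed
  then have "((\<lambda>h. ?\<sigma> (?\<gamma> h)) \<longlongrightarrow> 0) (at 0)" by (rule tendsto_eventually)
  from tendsto_unique[OF _ lim this] show "symp a b = 0" unfolding vw by simp
qed

theorem lagrangian_spun: "lagrangian UNIV L'"
  unfolding lagrangian_def
proof (intro conjI)
  show "\<forall>(t, x, T, X)\<in>L'. 0 < t \<and> x \<in> UNIV"
    using lag unfolding lagrangian_def spin_lagrangian_def by fastforce
  have cases: "(\<exists>\<theta> q. q \<in> L \<and> 0 < fst (snd q) $ l \<and> q' = spin_cot l \<theta> q) \<or>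
      (\<exists>\<theta> q. q \<in> L \<and> fst (snd q) $ l = 0 \<and> q' = spin_cot l \<theta> q)" if q': "q' \<in> L'" for q'
  proof -
    obtain \<theta> q where "q \<in> L" "q' = spin_cot l \<theta> q" using q' unfolding spin_lagrangian_iff by blast
    then show ?thesis using nonneg[of q] by (metis order_le_less)
  qed
  have "submanifold_with_boundary TYPE(real \<times> (real ^ ('n option))) L' {}"
    unfolding submanifold_with_boundary_def
    using cases interior_chart(1) axis_chart(1) by (metis Diff_empty empty_iff empty_subsetI)
  then show "\<exists>B. (\<forall>(t, x, T, X)\<in>B. x \<in> frontier UNIV) \<and>
         submanifold_with_boundary TYPE(real \<times> (real ^ ('n option))) L' B"
    by (intro exI[of _ "{}"]) simp
  show "\<forall>p\<in>L'. \<forall>u\<in>tangent_space TYPE(real \<times> (real ^ ('n option))) L' p.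
       \<forall>v\<in>tangent_space TYPE(real \<times> (real ^ ('n option))) L' p. symp u v = 0"
    using cases interior_chart(2) axis_chart(2) by metis
qed

end

section \<open>The spun cobordism\<close>

lemma continuous_spin_vec: "continuous_on UNIV (\<lambda>(\<theta>, x). spin_vec l \<theta> x)"
proof -
  have "continuous_on UNIV (\<lambda>z. spin_vec l (fst z) (snd z) $ i)" for i
  proof -
    consider "i = None" | "i = Some l" | j where "i = Some j" "j \<noteq> l" by (cases i) auto
    then show ?thesis by cases (auto simp: spin_vec_def intro!: continuous_intros)
  qed
  then show ?thesis
    unfolding case_prod_unfold using continuous_on_vec_lambda[of UNIV "\<lambda>i z. spin_vec l (fst z) (snd z) $ i"] by simp
qed

lemma spin_vec_angle_bounded: "\<exists>\<theta>'\<in>{-pi..pi}. sin \<theta>' = sin \<theta> \<and> cos \<theta>' = cos \<theta>"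
  using sincos_principal_value[of \<theta>] by force

text \<open>All rotations are already obtained from the compact interval of angles between
  \<open>-pi\<close> and \<open>pi\<close>.\<close>

lemma compact_spin_cot:
  assumes "compact K"
  shows "compact {spin_cot l \<theta> q | \<theta> q. q \<in> K}"
proof -
  have c: "continuous_on UNIV (\<lambda>z. spin_vec l (f z) (k z))" if "continuous_on UNIV f" "continuous_on UNIV k"
    for f :: "real \<times> (real \<times> (real ^ 'a) \<times> real \<times> (real ^ 'a)) \<Rightarrow> real" and k
    using continuous_on_compose2[OF continuous_spin_vec continuous_on_Pair[OF that]] by simp
  have "{spin_cot l \<theta> q | \<theta> q. q \<in> K} = (\<lambda>(\<theta>, q). spin_cot l \<theta> q) ` ({-pi..pi} \<times> K)"
  proof (intro equalityI subsetI)
    fix q' assume "q' \<in> {spin_cot l \<theta> q | \<theta> q. q \<in> K}"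
    then obtain \<theta> q where q: "q' = spin_cot l \<theta> q" "q \<in> K" by blast
    obtain \<theta>' where \<theta>': "\<theta>' \<in> {-pi..pi}" "sin \<theta>' = sin \<theta>" "cos \<theta>' = cos \<theta>"
      using spin_vec_angle_bounded by blast
    have "q' = spin_cot l \<theta>' q" using \<theta>' by (simp add: q(1) spin_cot_def spin_vec_cong[of \<theta>' \<theta>])
    then show "q' \<in> (\<lambda>(\<theta>, q). spin_cot l \<theta> q) ` ({-pi..pi} \<times> K)" using \<theta>'(1) q(2) by force
  next
    fix q' assume "q' \<in> (\<lambda>(\<theta>, q). spin_cot l \<theta> q) ` ({-pi..pi} \<times> K)"
    then obtain \<theta> q where "q' = spin_cot l \<theta> q" "q \<in> K" by auto
    then show "q' \<in> {spin_cot l \<theta> q | \<theta> q. q \<in> K}" by blast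
  qed
  moreover have "continuous_on UNIV (\<lambda>(\<theta>, q). spin_cot l \<theta> q)"
    unfolding case_prod_unfold spin_cot_def
    by (intro continuous_on_Pair c continuous_on_fst continuous_on_snd continuous_on_id)
  then have "compact ((\<lambda>(\<theta>, q). spin_cot l \<theta> q) ` ({-pi..pi} \<times> K))"
    by (intro compact_continuous_image compact_Times compact_Icc assms) (rule continuous_on_subset, auto)
  ultimately show ?thesis by simp
qed

text \<open>The linear function depends on \<eta> alone, so its coefficients survive; the
  exceptional set is the union of all rotations of \<open>K\<close>, compact as a continuous
  image.\<close>

lemma linear_at_infinity_spin:
  assumes "linear_at_infinity (halfspace l) N f a"
  shows "linear_at_infinity UNIV N (\<lambda>(x, \<eta>). f (unspin l x, \<eta>)) a"
proof -
  obtain K where K: "compact K" "K \<subseteq> halfspace l \<times> fibre N"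
    "\<And>x \<eta>. (x, \<eta>) \<in> halfspace l \<times> fibre N - K \<Longrightarrow> f (x, \<eta>) = (\<Sum>j<N. a j * \<eta> j)"
    using assms unfolding linear_at_infinity_def by blast
  let ?s = "\<lambda>z :: real \<times> (real ^ 'a) \<times> (nat \<Rightarrow> real). (spin_vec l (fst z) (fst (snd z)), snd (snd z))"
  have "continuous_on UNIV (\<lambda>z :: real \<times> (real ^ 'a) \<times> (nat \<Rightarrow> real). spin_vec l (fst z) (fst (snd z)))"
    using continuous_on_compose2[OF continuous_spin_vec continuous_on_Pair[OF
        continuous_on_fst[OF continuous_on_id] continuous_on_fst[OF continuous_on_snd[OF continuous_on_id]]]] by simp
  then have "continuous_on UNIV ?s"
    by (intro continuous_on_Pair continuous_on_snd continuous_on_id)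
  then have "compact (?s ` ({-pi..pi} \<times> K))"
    by (intro compact_continuous_image compact_Times compact_Icc K(1)) (rule continuous_on_subset, auto)
  moreover have "?s ` ({-pi..pi} \<times> K) \<subseteq> UNIV \<times> fibre N" using K(2) by auto
  moreover have "f (unspin l x, \<eta>) = (\<Sum>j<N. a j * \<eta> j)"
    if "(x, \<eta>) \<in> UNIV \<times> fibre N - ?s ` ({-pi..pi} \<times> K)" for x \<eta>
  proof (rule K(3))
    have "(unspin l x, \<eta>) \<notin> K"
    proof
      assume m: "(unspin l x, \<eta>) \<in> K"
      obtain \<theta> where \<theta>: "spin_vec l \<theta> (unspin l x) = x" using spin_vec_unspin by blast
      obtain \<theta>' where \<theta>': "\<theta>' \<in> {-pi..pi}" "sin \<theta>' = sin \<theta>" "cos \<theta>' = cos \<theta>"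
        using spin_vec_angle_bounded by blast
      have "(x, \<eta>) = ?s (\<theta>', unspin l x, \<eta>)" using spin_vec_cong[OF \<theta>'(2,3), of l "unspin l x"] \<theta> by simp
      then have "(x, \<eta>) \<in> ?s ` ({-pi..pi} \<times> K)" using m \<theta>'(1) by blast
      then show False using that by blast
    qed
    then show "(unspin l x, \<eta>) \<in> halfspace l \<times> fibre N - K"
      using that unspin_nonneg[of l x] by (auto simp: halfspace_def)
  qed
  ultimately show ?thesis unfolding linear_at_infinity_def by auto
qed

lemma cylinder_iff: "(t, x, T, X) \<in> cylinder \<Lambda> \<longleftrightarrow> 0 < t \<and> (x, (1 / t) *\<^sub>R X, T) \<in> \<Lambda>"
proof
  assume "0 < t \<and> (x, (1 / t) *\<^sub>R X, T) \<in> \<Lambda>"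
  moreover from this have "X = t *\<^sub>R ((1 / t) *\<^sub>R X)" by simp
  ultimately show "(t, x, T, X) \<in> cylinder \<Lambda>" unfolding cylinder_def by blast
qed (auto simp: cylinder_def)

lemma spin_cylinder_iff:
  "q' \<in> cylinder (spin_legendrian l \<Lambda>) \<longleftrightarrow> (\<exists>\<theta>. \<exists>q\<in>cylinder \<Lambda>. q' = spin_cot l \<theta> q)"
proof
  assume "q' \<in> cylinder (spin_legendrian l \<Lambda>)"
  then obtain t x y z \<theta> where "q' = (t, spin_vec l \<theta> x, z, t *\<^sub>R spin_vec l \<theta> y)" "0 < t" "(x, y, z) \<in> \<Lambda>"
    unfolding cylinder_def spin_legendrian_def by blast
  then have "q' = spin_cot l \<theta> (t, x, z, t *\<^sub>R y)" "(t, x, z, t *\<^sub>R y) \<in> cylinder \<Lambda>"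
    by (auto simp: spin_cot_simp linear_scale[OF linear_spin_vec] cylinder_def)
  then show "\<exists>\<theta>. \<exists>q\<in>cylinder \<Lambda>. q' = spin_cot l \<theta> q" by blast
next
  assume "\<exists>\<theta>. \<exists>q\<in>cylinder \<Lambda>. q' = spin_cot l \<theta> q"
  then obtain \<theta> t x y z where "q' = spin_cot l \<theta> (t, x, z, t *\<^sub>R y)" "0 < t" "(x, y, z) \<in> \<Lambda>"
    unfolding cylinder_def by blast
  then have "q' = (t, spin_vec l \<theta> x, z, t *\<^sub>R spin_vec l \<theta> y)" "0 < t"
    "(spin_vec l \<theta> x, spin_vec l \<theta> y, z) \<in> spin_legendrian l \<Lambda>"
    by (auto simp: spin_cot_simp linear_scale[OF linear_spin_vec] spin_legendrian_def)
  then show "q' \<in> cylinder (spin_legendrian l \<Lambda>)" unfolding cylinder_def by blast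
qed

lemma fst_spin_cot [simp]: "fst (spin_cot l \<theta> q) = fst q"
  by (simp add: spin_cot_def)

text \<open>\<open>P\<close> is a condition on the time only, which rotation preserves, so the
  agreement of \<open>L\<close> with the cylinder can be rotated point by point.\<close>

lemma spin_end:
  assumes "\<And>q. P (fst q) \<Longrightarrow> q \<in> L \<longleftrightarrow> q \<in> cylinder \<Lambda>" "P (fst q')"
  shows "q' \<in> spin_lagrangian l L \<longleftrightarrow> q' \<in> cylinder (spin_legendrian l \<Lambda>)"
proof -
  have "(\<exists>\<theta>. \<exists>q\<in>L. q' = spin_cot l \<theta> q) \<longleftrightarrow> (\<exists>\<theta>. \<exists>q\<in>cylinder \<Lambda>. q' = spin_cot l \<theta> q)"
  proof safe
    fix \<theta> q assume "q' = spin_cot l \<theta> q" "q \<in> L"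
    moreover from this have "q \<in> cylinder \<Lambda>" using assms by simp
    ultimately show "\<exists>\<theta>'. \<exists>q'\<in>cylinder \<Lambda>. spin_cot l \<theta> q = spin_cot l \<theta>' q'" by blast
  next
    fix \<theta> q assume "q' = spin_cot l \<theta> q" "q \<in> cylinder \<Lambda>"
    moreover from this have "q \<in> L" using assms by simp
    ultimately show "\<exists>\<theta>'. \<exists>q'\<in>L. spin_cot l \<theta> q = spin_cot l \<theta>' q'" by blast
  qed
  then show ?thesis unfolding spin_lagrangian_iff spin_cylinder_iff .
qed

theorem proposition3p5:
  fixes l :: "'n::finite"
    and N :: nat
    and \<Lambda>m \<Lambda>p :: "((real ^ 'n) \<times> (real ^ 'n) \<times> real) set"
    and L :: "(real \<times> (real ^ 'n) \<times> real \<times> (real ^ 'n)) set"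
    and fm fp :: "(real ^ 'n) \<times> (nat \<Rightarrow> real) \<Rightarrow> real"
    and F :: "(real \<times> (real ^ 'n)) \<times> (nat \<Rightarrow> real) \<Rightarrow> real"
  assumes "spinnable_cobordism l \<Lambda>m L \<Lambda>p"
    and "compatible_families (halfspace l) N \<Lambda>m fm L F \<Lambda>p fp"
    and "tame (halfspace l) N fm F fp"
    and "spinnable_family l N F"
  shows "\<exists>N' fm' F' fp'.
    compatible_families UNIV N'
      (spin_legendrian l \<Lambda>m) fm' (spin_lagrangian l L) F' (spin_legendrian l \<Lambda>p) fp' \<and>
    tame UNIV N' fm' F' fp'"
proof -
  obtain tm tp where cob: "cobordism_between tm tp (halfspace l) \<Lambda>m L \<Lambda>p"
    and Fm: "\<And>t x \<eta>. 0 < t \<Longrightarrow> t \<le> tm \<Longrightarrow> x \<in> halfspace l \<Longrightarrow> \<eta> \<in> fibre N \<Longrightarrow> F ((t, x), \<eta>) = t * fm (x, \<eta>)"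
    and Fp: "\<And>t x \<eta>. tp \<le> t \<Longrightarrow> x \<in> halfspace l \<Longrightarrow> \<eta> \<in> fibre N \<Longrightarrow> F ((t, x), \<eta>) = t * fp (x, \<eta>)"
    and gen: "generates_lagrangian (halfspace l) N F L"
    using assms(2) unfolding compatible_families_def by blast
  have t: "0 < tm" "tm < tp" and lag: "lagrangian (halfspace l) L"
    and Lm: "{q \<in> L. fst q \<le> tm} = {q \<in> cylinder \<Lambda>m. fst q \<le> tm}"
    and Lp: "{q \<in> L. tp \<le> fst q} = {q \<in> cylinder \<Lambda>p. tp \<le> fst q}"
    and compact: "compact {q \<in> L. tm \<le> fst q \<and> fst q \<le> tp}"
    using cob by (simp_all add: cobordism_between_def)
  interpret spinnable_lagrangian_family l N F L
  proof
    have "{(t, x, T, X) \<in> L. x $ l = 0} = {q \<in> L. fst (snd q) $ l = 0}" by auto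
    then show "submanifold_with_boundary TYPE(real \<times> (real ^ 'n)) L {q \<in> L. fst (snd q) $ l = 0}"
      using assms(1) by (simp add: spinnable_cobordism_def)
    show "\<exists>a\<in>tangent_space TYPE(real \<times> (real ^ 'n)) L q. fst (snd a) $ l \<noteq> 0"
      if "q \<in> L" "fst (snd q) $ l = 0" for q
    proof -
      obtain t x T X where q: "q = (t, x, T, X)" by (metis prod.collapse)
      have "\<exists>(dt, dx, dT, dX)\<in>tangent_space TYPE(real \<times> (real ^ 'n)) L (t, x, T, X). dx $ l \<noteq> 0"
        using assms(1) that unfolding spinnable_cobordism_def q by fastforce
      then show ?thesis unfolding q by (auto simp: case_prod_unfold)
    qed
    show "submanifold_with_boundary TYPE(real \<times> (real ^ 'n)) (L \<union> reflect_cot l ` L) {}"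
      using assms(1) by (simp add: spinnable_cobordism_def)
  qed (fact assms(4) gen lag)+
  let ?\<Lambda>m = "spin_legendrian l \<Lambda>m" and ?\<Lambda>p = "spin_legendrian l \<Lambda>p"
  \<comment> \<open>The ends are spun like \<open>F\<close>, by replacing the rotated coordinates by
    their radius; fibre dimension and cut-off times stay the same.\<close>
  define fm' where "fm' = (\<lambda>(x, \<eta>). fm (unspin l x, \<eta>))"
  define fp' where "fp' = (\<lambda>(x, \<eta>). fp (unspin l x, \<eta>))"
  have half: "unspin l x \<in> halfspace l" for x by (simp add: halfspace_def unspin_nonneg)
  have Fm': "F\<^sub>s ((t, x), \<eta>) = t * fm' (x, \<eta>)" if "0 < t" "t \<le> tm" "\<eta> \<in> fibre N" for t x \<eta>
    using Fm[OF that(1,2) half that(3)] by (simp add: unspin_pt_def fm'_def)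
  have Fp': "F\<^sub>s ((t, x), \<eta>) = t * fp' (x, \<eta>)" if "tp \<le> t" "\<eta> \<in> fibre N" for t x \<eta>
    using Fp[OF that(1) half that(2)] by (simp add: unspin_pt_def fp'_def)
  have Lm': "q \<in> L' \<longleftrightarrow> q \<in> cylinder ?\<Lambda>m" if "fst q \<le> tm" for q
    by (rule spin_end[where P = "\<lambda>t. t \<le> tm"]) (use Lm that in blast)+
  have Lp': "q \<in> L' \<longleftrightarrow> q \<in> cylinder ?\<Lambda>p" if "tp \<le> fst q" for q
    by (rule spin_end[where P = "\<lambda>t. tp \<le> t"]) (use Lp that in blast)+
  \<comment> \<open>Open time intervals inside the two ends, on which \<open>L'\<close> is a
    cylinder and the spun family is \<open>t\<close> times its end; the sample times
    \<open>tm / 2\<close> and \<open>tp + 1\<close> are arbitrary points in them.\<close>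
  have Im: "open {0<..<tm}" "tm / 2 \<in> {0<..<tm}" "{0<..<tm} \<subseteq> {0<..}" using t by auto
  have Ip: "open {tp<..}" "tp + 1 \<in> {tp<..}" "{tp<..} \<subseteq> {0<..}" using t by auto
  have cm: "(t, x, T, X) \<in> L' \<longleftrightarrow> (x, (1 / t) *\<^sub>R X, T) \<in> ?\<Lambda>m" if "t \<in> {0<..<tm}" for t x T X
    using Lm'[of "(t, x, T, X)"] that by (simp add: cylinder_iff)
  have cp: "(t, x, T, X) \<in> L' \<longleftrightarrow> (x, (1 / t) *\<^sub>R X, T) \<in> ?\<Lambda>p" if "t \<in> {tp<..}" for t x T X
    using Lp'[of "(t, x, T, X)"] that t by (simp add: cylinder_iff)
  have "{q \<in> L'. tm \<le> fst q \<and> fst q \<le> tp} = {spin_cot l \<theta> q | \<theta> q. q \<in> {q \<in> L. tm \<le> fst q \<and> fst q \<le> tp}}"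
  proof (intro equalityI subsetI)
    fix q' assume q': "q' \<in> {q \<in> L'. tm \<le> fst q \<and> fst q \<le> tp}"
    then have "q' \<in> L'" by blast
    then obtain \<theta> q where "q \<in> L" "q' = spin_cot l \<theta> q" unfolding spin_lagrangian_iff by blast
    moreover from this have "tm \<le> fst q" "fst q \<le> tp" using q' by simp_all
    ultimately show "q' \<in> {spin_cot l \<theta> q | \<theta> q. q \<in> {q \<in> L. tm \<le> fst q \<and> fst q \<le> tp}}" by blast
  next
    fix q' assume "q' \<in> {spin_cot l \<theta> q | \<theta> q. q \<in> {q \<in> L. tm \<le> fst q \<and> fst q \<le> tp}}"
    then obtain \<theta> q where "q' = spin_cot l \<theta> q" "q \<in> L" "tm \<le> fst q" "fst q \<le> tp" by blast
    moreover from this have "q' \<in> L'" unfolding spin_lagrangian_iff by blast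
    ultimately show "q' \<in> {q \<in> L'. tm \<le> fst q \<and> fst q \<le> tp}" by simp
  qed
  then have "compact {q \<in> L'. tm \<le> fst q \<and> fst q \<le> tp}"
    using compact_spin_cot[OF compact] by simp
  then have "cobordism_between tm tp UNIV ?\<Lambda>m L' ?\<Lambda>p"
    unfolding cobordism_between_def
    using t lagrangian_spun legendrian_of_cylinder[OF lagrangian_spun Im cm]
      legendrian_of_cylinder[OF lagrangian_spun Ip cp] Lm' Lp' by blast
  moreover have "generates_legendrian UNIV N fm' ?\<Lambda>m"
    by (rule generates_legendrian_slice[OF generates_spun Im _ cm]) (use Fm' in auto)
  moreover have "generates_legendrian UNIV N fp' ?\<Lambda>p"
    by (rule generates_legendrian_slice[OF generates_spun Ip _ cp]) (use Fp' in auto)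
  ultimately have "compatible_families UNIV N ?\<Lambda>m fm' L' F\<^sub>s ?\<Lambda>p fp'"
    unfolding compatible_families_def using Fm' Fp' generates_spun by blast
  moreover have "tame UNIV N fm' F\<^sub>s fp'"
    unfolding tame_def
  proof (intro conjI allI impI)
    show "\<exists>a. (\<exists>j<N. a j \<noteq> 0) \<and> linear_at_infinity UNIV N fm' a"
      using assms(3) linear_at_infinity_spin unfolding tame_def fm'_def by blast
    show "\<exists>a. (\<exists>j<N. a j \<noteq> 0) \<and> linear_at_infinity UNIV N fp' a"
      using assms(3) linear_at_infinity_spin unfolding tame_def fp'_def by blast
    fix t :: real assume "0 < t"
    then obtain a where "linear_at_infinity (halfspace l) N (\<lambda>(x, \<eta>). F ((t, x), \<eta>)) a"
      using assms(3) unfolding tame_def by blast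
    from linear_at_infinity_spin[OF this]
    show "\<exists>a. linear_at_infinity UNIV N (\<lambda>(x, \<eta>). F\<^sub>s ((t, x), \<eta>)) a"
      by (auto simp: unspin_pt_def)
  qed
  ultimately show ?thesis by blast
qed

end
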